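(* Let $0<\alpha<\pi/2$ and let $(T(t))_{t\in S_\alpha}$ be a nontrivial strongly continuous bounded analytic semigroup of quasinilpotent operators on a Banach space $\mathcal X$, with generator $A$. Let $F$ be the Fourier--Borel transform of a symmetric measure $\mu$ supported on a compact set $K\subset V_\beta$ for some $\beta$ with $0<\beta<\alpha$, such that $\int_K d\mu=0$. Then there is an $\eta>0$ such that $$\|F(-uA)\|>\sup_{t>0}|F(t)|$$ for all $u\in S_{\alpha-\beta}$ with $|u|\le\eta$.
   Context: For $0<\gamma<\pi/2$, $S_\gamma=\{z\in\mathbb C:\operatorname{Re}z>0,\ |\arg z|<\gamma\}$ and $V_\gamma=\{z\in\mathbb C:\operatorname{Re}z>0,\ |\arg z|\le\gamma\}$ (so $0\notin V_\gamma$). Measures are complex Borel measures. A measure $\mu$ is symmetric if $\mu(\overline S)=\overline{\mu(S)}$ for all Borel sets $S$, where $\overline S=\{\overline z:z\in S\}$. The Fourier--Borel transform of $\mu$ is the entire function $F(z)=\int_K e^{-z\xi}\,d\mu(\xi)$. A strongly continuous analytic semigroup $(T(t))_{t\in S_\alpha}$ on $\mathcal X$ is an analytic map from $S_\alpha$ to the bounded operators on $\mathcal X$ with $T(s+t)=T(s)T(t)$ for $s,t\in S_\alpha$ and $T(t)x\to x$ as $t\to0$ in $S_\gamma$, for every $x\in\mathcal X$ and every $0<\gamma<\alpha$. Its infinitesimal generator $A$ is given by $Ax=\lim_{t\to0+}(T(t)x-x)/t$, with domain the set of $x\in\mathcal X$ for which this limit exists. The semigroup is bounded if $\sup_{t\in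 S_\alpha}\|T(t)\|<\infty$, and nontrivial if it is not the zero semigroup (equivalently $\mathcal X\neq\{0\}$). Quasinilpotent means that each $T(t)$ has spectral radius $0$. For $u\in S_{\alpha-\beta}$, $F(-uA)$ is defined by the Bochner integral $F(-uA)=\int_K T(u\xi)\,d\mu(\xi)$.
   Formalization: The formal theorem additionally assumes that F is not identically zero: for μ = 0 (and whenever F vanishes identically, since then F(-uA) = 0) the claimed strict inequality reads 0 > 0 and fails. *)

theory Defs
  imports "HOL-Analysis.Analysis"
begin

section \<open>Complex Banach spaces\<close>

text \<open>The library's \<open>banach\<close> spaces are real; the complex structure is added on top, so that
  limits, derivatives and bounded operators remain those of the library.\<close>

class complex_vector = real_vector +
  fixes scaleC :: "complex \<Rightarrow> 'a \<Rightarrow> 'a"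
  assumes scaleC_add_right: "scaleC a (x + y) = scaleC a x + scaleC a y"
    and scaleC_add_left: "scaleC (a + b) x = scaleC a x + scaleC b x"
    and scaleC_scaleC: "scaleC a (scaleC b x) = scaleC (a * b) x"
    and scaleC_of_real: "scaleC (complex_of_real r) x = scaleR r x"

class complex_normed_vector = complex_vector + real_normed_vector +
  assumes norm_scaleC: "norm (scaleC a x) = cmod a * norm x"

class complex_banach = complex_normed_vector + banach

instantiation complex :: complex_banach
begin

definition scaleC_complex :: "complex \<Rightarrow> complex \<Rightarrow> complex"
  where "scaleC_complex a x = a * x"

instance
  by standard (auto simp: scaleC_complex_def algebra_simps norm_mult scaleR_conv_of_real)

end

lemma bounded_linear_scaleC_right: "bounded_linear (\<lambda>x::'a::complex_normed_vector. scaleC a x)"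
proof (rule bounded_linear_intro[where K = "cmod a"])
  show "scaleC a (r *\<^sub>R x) = r *\<^sub>R scaleC a x" for r :: real and x :: 'a
    by (simp flip: scaleC_of_real add: scaleC_scaleC mult.commute)
qed (simp_all add: scaleC_add_right norm_scaleC mult.commute)

instantiation blinfun :: (real_normed_vector, complex_normed_vector) complex_normed_vector
begin

definition scaleC_blinfun :: "complex \<Rightarrow> ('a \<Rightarrow>\<^sub>L 'b) \<Rightarrow> ('a \<Rightarrow>\<^sub>L 'b)"
  where "scaleC_blinfun a f = Blinfun (\<lambda>x. scaleC a (blinfun_apply f x))"

lemma blinfun_apply_scaleC: "blinfun_apply (scaleC a f) x = scaleC a (blinfun_apply f x)"
  for f :: "'a \<Rightarrow>\<^sub>L 'b"
  unfolding scaleC_blinfun_def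
  by (simp add: bounded_linear_Blinfun_apply
      bounded_linear_compose[OF bounded_linear_scaleC_right blinfun.bounded_linear_right])

instance
proof
  fix a b :: complex and r :: real and f g :: "'a \<Rightarrow>\<^sub>L 'b"
  show "scaleC a (f + g) = scaleC a f + scaleC a g"
    by (rule blinfun_eqI) (simp add: blinfun_apply_scaleC blinfun.add_left scaleC_add_right)
  show "scaleC (a + b) f = scaleC a f + scaleC b f"
    by (rule blinfun_eqI) (simp add: blinfun_apply_scaleC blinfun.add_left scaleC_add_left)
  show "scaleC a (scaleC b f) = scaleC (a * b) f"
    by (rule blinfun_eqI) (simp add: blinfun_apply_scaleC scaleC_scaleC)
  show "scaleC (complex_of_real r) f = r *\<^sub>R f"
    by (rule blinfun_eqI) (simp add: blinfun_apply_scaleC blinfun.scaleR_left scaleC_of_real)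
  have le: "norm (scaleC c h) \<le> cmod c * norm h" for c and h :: "'a \<Rightarrow>\<^sub>L 'b"
  proof (rule norm_blinfun_bound)
    show "norm (blinfun_apply (scaleC c h) x) \<le> cmod c * norm h * norm x" for x
      using mult_left_mono[OF norm_blinfun[of h x], of "cmod c"]
      by (simp add: blinfun_apply_scaleC norm_scaleC mult.assoc)
  qed simp
  show "norm (scaleC a f) = cmod a * norm f"
  proof (cases "a = 0")
    case True
    then show ?thesis using le[of 0 f] by simp
  next
    case False
    have "scaleC (inverse a) (scaleC a f) = f"
    proof (rule blinfun_eqI)
      fix x
      have "scaleC (1::complex) (blinfun_apply f x) = blinfun_apply f x"
        using scaleC_of_real[of 1 "blinfun_apply f x"] by simp
      then show "blinfun_apply (scaleC (inverse a) (scaleC a f)) x = blinfun_apply f x"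
        using False by (simp add: blinfun_apply_scaleC scaleC_scaleC)
    qed
    then have "norm f \<le> cmod (inverse a) * norm (scaleC a f)"
      using le[of "inverse a" "scaleC a f"] by simp
    then have "cmod a * norm f \<le> norm (scaleC a f)"
      using False by (simp add: norm_divide field_simps)
    with le[of a f] show ?thesis by simp
  qed
qed

end

instance blinfun :: (real_normed_vector, complex_banach) complex_banach ..

text \<open>The bounded operators on a complex Banach space are the complex-linear elements
  of \<^typ>\<open>'a \<Rightarrow>\<^sub>L 'a\<close>; the operator norm is the same.\<close>

definition complex_linear_op :: "('a::complex_normed_vector \<Rightarrow>\<^sub>L 'a) \<Rightarrow> bool"
  where "complex_linear_op L \<longleftrightarrow>
    (\<forall>c x. blinfun_apply L (scaleC c x) = scaleC c (blinfun_apply L x))"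

definition op_spectrum :: "('a::complex_normed_vector \<Rightarrow>\<^sub>L 'a) \<Rightarrow> complex set"
  where "op_spectrum L = {c. \<not> (\<exists>R. complex_linear_op R \<and>
      R o\<^sub>L (scaleC c id_blinfun - L) = id_blinfun \<and>
      (scaleC c id_blinfun - L) o\<^sub>L R = id_blinfun)}"

text \<open>Meaningful for bounded complex-linear operators on nonzero Banach spaces,
  whose spectrum is nonempty and bounded.\<close>

definition op_spectral_radius :: "('a::complex_normed_vector \<Rightarrow>\<^sub>L 'a) \<Rightarrow> real"
  where "op_spectral_radius L = (SUP c\<in>op_spectrum L. cmod c)"

text \<open>Complex differentiability of a vector-valued map at every point of a (typically open) set.\<close>

definition vector_analytic_on :: "(complex \<Rightarrow> 'b::complex_normed_vector) \<Rightarrow> complex set \<Rightarrow> bool"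
  where "vector_analytic_on f S \<longleftrightarrow> (\<forall>z\<in>S. \<exists>D. (f has_derivative (\<lambda>h. scaleC h D)) (at z))"


section \<open>Analytic semigroups\<close>

definition open_sector :: "real \<Rightarrow> complex set"
  where "open_sector \<gamma> = {z. Re z > 0 \<and> \<bar>Arg z\<bar> < \<gamma>}"

definition closed_sector :: "real \<Rightarrow> complex set"
  where "closed_sector \<gamma> = {z. Re z > 0 \<and> \<bar>Arg z\<bar> \<le> \<gamma>}"

text \<open>Only the values of \<open>T\<close> on \<open>open_sector \<alpha>\<close> are constrained.\<close>

definition analytic_semigroup :: "real \<Rightarrow> (complex \<Rightarrow> ('a::complex_banach \<Rightarrow>\<^sub>L 'a)) \<Rightarrow> bool"
  where "analytic_semigroup \<alpha> T \<longleftrightarrow>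
    (\<forall>t\<in>open_sector \<alpha>. complex_linear_op (T t)) \<and>
    vector_analytic_on T (open_sector \<alpha>) \<and>
    (\<forall>s\<in>open_sector \<alpha>. \<forall>t\<in>open_sector \<alpha>. T (s + t) = T s o\<^sub>L T t) \<and>
    (\<forall>x \<gamma>. 0 < \<gamma> \<and> \<gamma> < \<alpha> \<longrightarrow>
       ((\<lambda>t. blinfun_apply (T t) x) \<longlongrightarrow> x) (at 0 within open_sector \<gamma>))"

text \<open>An unbounded operator, represented by its graph.\<close>

definition infinitesimal_generator ::
    "(complex \<Rightarrow> ('a::complex_banach \<Rightarrow>\<^sub>L 'a)) \<Rightarrow> ('a \<times> 'a) set"
  where "infinitesimal_generator T = {(x, y).
    ((\<lambda>t::real. (blinfun_apply (T (complex_of_real t)) x - x) /\<^sub>R t) \<longlongrightarrow> y) (at_right 0)}"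


section \<open>Complex Borel measures on the plane\<close>

text \<open>Values on non-Borel sets are irrelevant.\<close>

definition complex_borel_measure :: "(complex set \<Rightarrow> complex) \<Rightarrow> bool"
  where "complex_borel_measure \<mu> \<longleftrightarrow> \<mu> {} = 0 \<and>
    (\<forall>A :: nat \<Rightarrow> complex set. range A \<subseteq> sets borel \<longrightarrow> disjoint_family A \<longrightarrow>
       (\<lambda>i. \<mu> (A i)) sums \<mu> (\<Union>i. A i))"

definition symmetric_measure :: "(complex set \<Rightarrow> complex) \<Rightarrow> bool"
  where "symmetric_measure \<mu> \<longleftrightarrow> (\<forall>S\<in>sets borel. \<mu> (cnj ` S) = cnj (\<mu> S))"

definition measure_supported_on :: "(complex set \<Rightarrow> complex) \<Rightarrow> complex set \<Rightarrow> bool"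
  where "measure_supported_on \<mu> K \<longleftrightarrow> (\<forall>B\<in>sets borel. B \<inter> K = {} \<longrightarrow> \<mu> B = 0)"

text \<open>The positive measure \<open>|\<mu>|\<close>: supremum over countable Borel partitions.\<close>

definition total_variation :: "(complex set \<Rightarrow> complex) \<Rightarrow> complex measure"
  where "total_variation \<mu> = measure_of UNIV (sets borel)
    (\<lambda>E. SUP A\<in>{A :: nat \<Rightarrow> complex set.
          range A \<subseteq> sets borel \<and> disjoint_family A \<and> (\<Union>i. A i) = E}.
        (\<Sum>i. ennreal (cmod (\<mu> (A i)))))"

definition simple_complex_integral ::
    "(complex set \<Rightarrow> complex) \<Rightarrow> (complex \<Rightarrow> 'b::complex_normed_vector) \<Rightarrow> 'b"
  where "simple_complex_integral \<mu> s = (\<Sum>y\<in>range s. scaleC (\<mu> (s -` {y})) y)"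

text \<open>Bochner integral of a vector-valued function against a complex measure: the limit of
  integrals of simple functions approximating \<open>f\<close> in \<open>L\<^sup>1(|\<mu>|)\<close>. The library's
  \<open>has_bochner_integral\<close> is only available for positive measures and second countable
  target spaces, which excludes spaces of operators.\<close>

definition has_complex_bochner_integral ::
    "(complex set \<Rightarrow> complex) \<Rightarrow> (complex \<Rightarrow> 'b::complex_normed_vector) \<Rightarrow> 'b \<Rightarrow> bool"
  where "has_complex_bochner_integral \<mu> f I \<longleftrightarrow>
    f \<in> borel_measurable (total_variation \<mu>) \<and>
    (\<exists>s :: nat \<Rightarrow> complex \<Rightarrow> 'b.
      (\<forall>i. simple_function (total_variation \<mu>) (s i)) \<and>
      (\<lambda>i. \<integral>\<^sup>+\<xi>. ennreal (norm (f \<xi> - s i \<xi>)) \<partial>total_variation \<mu>) \<longlonglongrightarrow> 0 \<and>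
      (\<lambda>i. simple_complex_integral \<mu> (s i)) \<longlonglongrightarrow> I)"

definition complex_bochner_integral ::
    "(complex set \<Rightarrow> complex) \<Rightarrow> complex set \<Rightarrow> (complex \<Rightarrow> 'b::complex_normed_vector) \<Rightarrow> 'b"
  where "complex_bochner_integral \<mu> K f =
    (THE I. has_complex_bochner_integral \<mu> (\<lambda>\<xi>. indicator K \<xi> *\<^sub>R f \<xi>) I)"

definition fourier_borel_transform ::
    "(complex set \<Rightarrow> complex) \<Rightarrow> complex set \<Rightarrow> complex \<Rightarrow> complex"
  where "fourier_borel_transform \<mu> K z = complex_bochner_integral \<mu> K (\<lambda>\<xi>. exp (- z * \<xi>))"

text \<open>\<open>F(-uA)\<close>, where \<open>F\<close> is the Fourier--Borel transform of \<open>\<mu>\<close> and \<open>A\<close> is the generator of \<open>T\<close>.\<close>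

definition fourier_borel_op ::
    "(complex set \<Rightarrow> complex) \<Rightarrow> complex set \<Rightarrow>
     (complex \<Rightarrow> ('a::complex_banach \<Rightarrow>\<^sub>L 'a)) \<Rightarrow> complex \<Rightarrow> ('a \<Rightarrow>\<^sub>L 'a)"
  where "fourier_borel_op \<mu> K T u = complex_bochner_integral \<mu> K (\<lambda>\<xi>. T (u * \<xi>))"

end

theory Submission
  imports Defs "HOL-Complex_Analysis.Complex_Analysis"
begin

text \<open>Let \<open>m = \<bar>F a\<bar>\<close> be the maximum of \<open>\<bar>F\<bar>\<close> on the positive reals and suppose that \<open>\<parallel>F(-uA)\<parallel> \<le> m\<close>
  for some small \<open>u\<close>. Quasinilpotence makes \<open>(w + A)\<inverse> x = - \<integral>\<^sub>0\<^sup>\<infinity> e\<^sup>w\<^sup>s T(s) x ds\<close> entire in \<open>w\<close>.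
  Put \<open>z = u w\<close>. Where \<open>\<bar>F z\<bar> > m\<close>, the estimate
  \<open>\<parallel>(F(z) - F(-uA)) y\<parallel> \<le> C \<parallel>(z + uA) y\<parallel>\<close> bounds \<open>(z + uA)\<inverse>\<close>; where \<open>Re (z c) < 0\<close> for some
  \<open>c\<close> in the closed sector of half-angle \<open>\<beta>\<close>, boundedness of \<open>t \<mapsto> T(uct)\<close> does.
  As \<open>F\<close> is real on the real axis, \<open>\<bar>F\<bar>\<close> exceeds \<open>m\<close> in some direction from \<open>a\<close>, and by the
  maximum principle the component of \<open>{\<bar>F\<bar> > m}\<close> reached in this way leaves the set where
  \<open>Re (z c) \<ge> 0\<close> for all such \<open>c\<close>. This gives a path from \<open>a\<close> to \<open>-1\<close> which
  together with its conjugate encloses 0 and on which \<open>(z - a)\<^sup>n (z + uA)\<inverse>\<close> is bounded uniformly in \<open>u\<close>.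
  By the maximum principle \<open>(w + A)\<inverse> x = O(\<bar>u\<bar>)\<close> at \<open>w = 0\<close>, which is impossible for \<open>x \<noteq> 0\<close> once
  \<open>\<bar>u\<bar>\<close> is small.\<close>

section \<open>Finiteness of the total variation\<close>

text \<open>The factor |u| comes from the scaling z = u w: (w + A)^-1 equals u (z + uA)^-1, and the
  contour carrying the bound for the second inverse is the same for all u. At w = 0 the vector
  solving A y = x does not depend on u, hence the contradiction. The weight (z - a)^n appears
  because near a the excess |F z| - m is only bounded below by k |z - a|^n; at 0 the weight costs
  just a^n, and F 0 = 0 keeps a and the contour away from 0. A is never applied to a general vector:
  vectors are first smoothed by some T d, and A T d is the derivative of T at d. The integral for
  the inverse is cut off at a finite time, so its mean values over circles follow from Fubini, and
  the maximum principle needs nothing more. Quasinilpotence enters through the decay of T n, faster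
  than any exponential, which removes the cut-off error on the whole contour, however large z / u
  becomes for small u. Spaces of operators need not be separable, so integrals against \<mu> are
  built from finite nets of a compact range.\<close>

definition borel_partitions :: "complex set \<Rightarrow> (nat \<Rightarrow> complex set) set"
  where "borel_partitions E = {A. range A \<subseteq> sets borel \<and> disjoint_family A \<and> (\<Union>i. A i) = E}"

text \<open>The set function that \<open>total_variation\<close> passes to
  \<open>measure_of\<close>. Its countable additivity has to be proved before
  \<open>emeasure (total_variation \<mu>)\<close> gives access to its values.\<close>

definition variation :: "(complex set \<Rightarrow> complex) \<Rightarrow> complex set \<Rightarrow> ennreal"
  where "variation \<mu> E = (SUP A\<in>borel_partitions E. \<Sum>i. ennreal (cmod (\<mu> (A i))))"

lemma borel_partitions_binaryset:
  assumes "A \<in> sets borel" "B \<in> sets borel" "A \<inter> B = {}"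
  shows "binaryset A B \<in> borel_partitions (A \<union> B)"
  using assms unfolding borel_partitions_def disjoint_family_on_def
  by (auto simp: range_binaryset_eq binaryset_def split: if_splits)

lemma borel_partitions_ne: "E \<in> sets borel \<Longrightarrow> borel_partitions E \<noteq> {}"
  using borel_partitions_binaryset[of E "{}"] by auto

lemma variation_upper:
  "A \<in> borel_partitions E \<Longrightarrow> (\<Sum>i. ennreal (cmod (\<mu> (A i)))) \<le> variation \<mu> E"
  unfolding variation_def by (rule SUP_upper)

text \<open>Each modulus is at most |Re| + |Im|. Sorting the indices by the signs of the real and of
  the imaginary parts bounds the sum by the moduli of four partial sums, one of which carries at
  least a quarter. This converts large variation into a single set of large measure.\<close>

lemma sum_cmod_le_4_subset:
  fixes z :: "'i \<Rightarrow> complex"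
  assumes "finite I"
  shows "\<exists>S\<subseteq>I. (\<Sum>i\<in>I. cmod (z i)) \<le> 4 * cmod (\<Sum>i\<in>S. z i)"
proof -
  let ?P = "{i\<in>I. 0 \<le> Re (z i)}" and ?N = "{i\<in>I. \<not> 0 \<le> Re (z i)}"
  let ?Q = "{i\<in>I. 0 \<le> Im (z i)}" and ?R = "{i\<in>I. \<not> 0 \<le> Im (z i)}"
  let ?s = "\<lambda>S. cmod (\<Sum>i\<in>S. z i)"
  have split: "sum f I = sum f {i\<in>I. P i} + sum f {i\<in>I. \<not> P i}" for f :: "'i \<Rightarrow> real" and P
    using sum.inter_filter[OF assms, of f P] sum.inter_filter[OF assms, of f "\<lambda>i. \<not> P i"]
    by (subst sum.union_disjoint[symmetric]) (auto simp: assms intro: sum.cong)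
  have "(\<Sum>i\<in>I. \<bar>Re (z i)\<bar>) = Re (\<Sum>i\<in>?P. z i) - Re (\<Sum>i\<in>?N. z i)"
  proof -
    have "(\<Sum>i\<in>?P. \<bar>Re (z i)\<bar>) = (\<Sum>i\<in>?P. Re (z i))" by (rule sum.cong) auto
    moreover have "(\<Sum>i\<in>?N. \<bar>Re (z i)\<bar>) = (\<Sum>i\<in>?N. - Re (z i))" by (rule sum.cong) auto
    ultimately show ?thesis
      unfolding split[of _ "\<lambda>i. 0 \<le> Re (z i)"] Re_sum by (simp only: sum_negf)
  qed
  also have "\<dots> \<le> ?s ?P + ?s ?N"
    using abs_Re_le_cmod[of "\<Sum>i\<in>?P. z i"] abs_Re_le_cmod[of "\<Sum>i\<in>?N. z i"] by linarith
  finally have re: "(\<Sum>i\<in>I. \<bar>Re (z i)\<bar>) \<le> ?s ?P + ?s ?N" .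
  have "(\<Sum>i\<in>I. \<bar>Im (z i)\<bar>) = Im (\<Sum>i\<in>?Q. z i) - Im (\<Sum>i\<in>?R. z i)"
  proof -
    have "(\<Sum>i\<in>?Q. \<bar>Im (z i)\<bar>) = (\<Sum>i\<in>?Q. Im (z i))" by (rule sum.cong) auto
    moreover have "(\<Sum>i\<in>?R. \<bar>Im (z i)\<bar>) = (\<Sum>i\<in>?R. - Im (z i))" by (rule sum.cong) auto
    ultimately show ?thesis
      unfolding split[of _ "\<lambda>i. 0 \<le> Im (z i)"] Im_sum by (simp only: sum_negf)
  qed
  also have "\<dots> \<le> ?s ?Q + ?s ?R"
    using abs_Im_le_cmod[of "\<Sum>i\<in>?Q. z i"] abs_Im_le_cmod[of "\<Sum>i\<in>?R. z i"] by linarith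
  finally have im: "(\<Sum>i\<in>I. \<bar>Im (z i)\<bar>) \<le> ?s ?Q + ?s ?R" .
  have "(\<Sum>i\<in>I. cmod (z i)) \<le> (\<Sum>i\<in>I. \<bar>Re (z i)\<bar>) + (\<Sum>i\<in>I. \<bar>Im (z i)\<bar>)"
    by (subst sum.distrib[symmetric], rule sum_mono) (rule cmod_le)
  with re im have le: "(\<Sum>i\<in>I. cmod (z i)) \<le> ?s ?P + ?s ?N + ?s ?Q + ?s ?R" by linarith
  show ?thesis
  proof (rule ccontr)
    assume "\<not> ?thesis"
    then have "\<And>S. S \<subseteq> I \<Longrightarrow> (\<Sum>i\<in>I. cmod (z i)) > 4 * ?s S" by (meson not_le)
    then have "4 * ?s ?P < (\<Sum>i\<in>I. cmod (z i))" "4 * ?s ?N < (\<Sum>i\<in>I. cmod (z i))"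
      "4 * ?s ?Q < (\<Sum>i\<in>I. cmod (z i))" "4 * ?s ?R < (\<Sum>i\<in>I. cmod (z i))"
      by (metis (no_types, lifting) mem_Collect_eq subsetI)+
    with le show False by linarith
  qed
qed

lemma ennreal_suminf_swap:
  fixes f :: "nat \<Rightarrow> nat \<Rightarrow> ennreal"
  shows "(\<Sum>i. \<Sum>j. f i j) = (\<Sum>j. \<Sum>i. f i j)"
  using nn_integral_suminf[of f "count_space UNIV"]
  by (simp add: nn_integral_count_space_nat)

lemma cmod_sums_le_suminf_ennreal:
  assumes "f sums s"
  shows "ennreal (cmod s) \<le> (\<Sum>i. ennreal (cmod (f i)))"
proof (rule LIMSEQ_le_const2)
  show "(\<lambda>n. ennreal (cmod (\<Sum>i<n. f i))) \<longlonglongrightarrow> ennreal (cmod s)"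
    using assms unfolding sums_def by (intro tendsto_ennrealI tendsto_norm)
  have "ennreal (cmod (\<Sum>i<n. f i)) \<le> (\<Sum>i. ennreal (cmod (f i)))" for n
  proof -
    have "ennreal (cmod (\<Sum>i<n. f i)) \<le> ennreal (\<Sum>i<n. cmod (f i))"
      by (intro ennreal_leI norm_sum)
    also have "\<dots> = (\<Sum>i<n. ennreal (cmod (f i)))" by simp
    also have "\<dots> \<le> (\<Sum>i. ennreal (cmod (f i)))" by (rule sum_le_suminf) auto
    finally show ?thesis .
  qed
  then show "\<exists>N. \<forall>n\<ge>N. ennreal (cmod (\<Sum>i<n. f i)) \<le> (\<Sum>i. ennreal (cmod (f i)))" by blast
qed

locale complex_measure =
  fixes \<mu> :: "complex set \<Rightarrow> complex"
  assumes complex_borel: "complex_borel_measure \<mu>"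
begin

lemma empty [simp]: "\<mu> {} = 0"
  using complex_borel by (simp add: complex_borel_measure_def)

lemma sums_UN:
  "range A \<subseteq> sets borel \<Longrightarrow> disjoint_family A \<Longrightarrow> (\<lambda>i::nat. \<mu> (A i)) sums \<mu> (\<Union>i. A i)"
  using complex_borel by (simp add: complex_borel_measure_def)

lemma partition_sums: "A \<in> borel_partitions E \<Longrightarrow> (\<lambda>i. \<mu> (A i)) sums \<mu> E"
  using sums_UN[of A] by (auto simp: borel_partitions_def)

lemma add_disjoint:
  assumes "A \<in> sets borel" "B \<in> sets borel" "A \<inter> B = {}"
  shows "\<mu> (A \<union> B) = \<mu> A + \<mu> B"
  using partition_sums[OF borel_partitions_binaryset[OF assms]] binaryset_sums[of \<mu> A B]
  by (simp add: sums_iff)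

lemma finite_UN:
  assumes "finite I" "\<And>i. i \<in> I \<Longrightarrow> A i \<in> sets borel" "disjoint_family_on A I"
  shows "\<mu> (\<Union>i\<in>I. A i) = (\<Sum>i\<in>I. \<mu> (A i))"
  using assms
proof (induction I)
  case (insert i I)
  have "\<mu> (\<Union>i\<in>insert i I. A i) = \<mu> (A i \<union> (\<Union>i\<in>I. A i))" by simp
  also have "\<dots> = \<mu> (A i) + \<mu> (\<Union>i\<in>I. A i)"
    using insert.prems insert.hyps by (intro add_disjoint) (auto simp: disjoint_family_on_def)
  finally show ?case using insert by (simp add: disjoint_family_on_insert)
qed simp

lemma cmod_le_variation:
  assumes "E \<in> sets borel" shows "ennreal (cmod (\<mu> E)) \<le> variation \<mu> E"
proof -
  have "(\<lambda>i. ennreal (cmod (\<mu> (binaryset E {} i)))) sums ennreal (cmod (\<mu> E))"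
    using binaryset_sums[of "\<lambda>E. ennreal (cmod (\<mu> E))" E "{}"] by simp
  then show ?thesis
    using variation_upper[OF borel_partitions_binaryset[OF assms, of "{}"], of \<mu>] by (simp add: sums_iff)
qed

lemma variation_superadditive:
  assumes [measurable]: "D \<in> sets borel" "E \<in> sets borel" and disj: "D \<inter> E = {}"
  shows "variation \<mu> D + variation \<mu> E \<le> variation \<mu> (D \<union> E)"
proof -
  let ?n = "\<lambda>B. ennreal (cmod (\<mu> B))"
  have *: "(\<Sum>i. ?n (A i)) + (\<Sum>i. ?n (B i)) \<le> variation \<mu> (D \<union> E)"
    if A: "A \<in> borel_partitions D" and B: "B \<in> borel_partitions E" for A B
  proof -
    \<comment> \<open>The two partitions are interleaved, even indices running through
      \<open>A\<close> and odd ones through \<open>B\<close>, so the first \<open>2 * n\<close>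
      terms of \<open>C\<close> are the first \<open>n\<close> of each.\<close>
    define C where "C n = (if even n then A (n div 2) else B (n div 2))" for n
    have un: "(\<Union>n. C n) = D \<union> E"
    proof -
      have "A i = C (2 * i)" "B i = C (2 * i + 1)" for i by (auto simp: C_def)
      then have "(\<Union>i. A i) \<union> (\<Union>i. B i) \<subseteq> (\<Union>n. C n)" by blast
      moreover have "(\<Union>n. C n) \<subseteq> (\<Union>i. A i) \<union> (\<Union>i. B i)" by (auto simp: C_def split: if_splits)
      ultimately show ?thesis using A B by (auto simp: borel_partitions_def)
    qed
    have "disjoint_family C"
      unfolding disjoint_family_on_def
    proof (intro ballI impI)
      fix m n :: nat assume "m \<noteq> n"
      then have "even m = even n \<Longrightarrow> m div 2 \<noteq> n div 2"
        by (metis dvd_mult_div_cancel odd_two_times_div_two_succ)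
      moreover have "A i \<inter> B j = {}" "B j \<inter> A i = {}" for i j
        using A B disj unfolding borel_partitions_def by blast+
      moreover have "i \<noteq> j \<Longrightarrow> A i \<inter> A j = {}" "i \<noteq> j \<Longrightarrow> B i \<inter> B j = {}" for i j
        using A B unfolding borel_partitions_def disjoint_family_on_def by blast+
      ultimately show "C m \<inter> C n = {}" by (cases "even m"; cases "even n") (simp_all add: C_def)
    qed
    moreover have "range C \<subseteq> sets borel"
      using A B by (auto simp: C_def borel_partitions_def image_subset_iff)
    ultimately have C: "C \<in> borel_partitions (D \<union> E)" using un by (simp add: borel_partitions_def)
    have part: "(\<Sum>i<n. ?n (A i) + ?n (B i)) = (\<Sum>i<2*n. ?n (C i))" for n
      by (induction n) (auto simp: C_def add_ac)
    have "(\<Sum>i. ?n (A i)) + (\<Sum>i. ?n (B i)) = (\<Sum>i. ?n (A i) + ?n (B i))"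
      by (rule suminf_add) auto
    also have "\<dots> \<le> (\<Sum>i. ?n (C i))"
    proof (rule suminf_le_const)
      show "(\<Sum>i<n. ?n (A i) + ?n (B i)) \<le> (\<Sum>i. ?n (C i))" for n
        unfolding part by (rule sum_le_suminf) auto
    qed simp
    also have "\<dots> \<le> variation \<mu> (D \<union> E)" by (rule variation_upper[OF C])
    finally show ?thesis .
  qed
  have "variation \<mu> D + variation \<mu> E =
      (SUP A\<in>borel_partitions D. (\<Sum>i. ?n (A i)) + variation \<mu> E)"
    unfolding variation_def[of \<mu> D]
    by (rule ennreal_SUP_add_left[symmetric]) (simp add: borel_partitions_ne)
  also have "\<dots> \<le> variation \<mu> (D \<union> E)"
  proof (rule SUP_least)
    fix A assume A: "A \<in> borel_partitions D"
    have "(\<Sum>i. ?n (A i)) + variation \<mu> E =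
        (SUP B\<in>borel_partitions E. (\<Sum>i. ?n (A i)) + (\<Sum>i. ?n (B i)))"
      unfolding variation_def[of \<mu> E]
      by (rule ennreal_SUP_add_right) (simp add: borel_partitions_ne)
    also have "\<dots> \<le> variation \<mu> (D \<union> E)" by (rule SUP_least) (rule *[OF A])
    finally show "(\<Sum>i. ?n (A i)) + variation \<mu> E \<le> variation \<mu> (D \<union> E)" .
  qed
  finally show ?thesis .
qed

lemma variation_mono:
  assumes "D \<in> sets borel" "E \<in> sets borel" "D \<subseteq> E"
  shows "variation \<mu> D \<le> variation \<mu> E"
proof -
  have "variation \<mu> D \<le> variation \<mu> D + variation \<mu> (E - D)" by simp
  also have "\<dots> \<le> variation \<mu> (D \<union> (E - D))" using assms by (intro variation_superadditive) auto
  finally show ?thesis using assms by (simp add: Un_absorb1)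
qed

lemma variation_empty: "variation \<mu> {} = 0"
proof -
  have "(\<Sum>i. ennreal (cmod (\<mu> (A i)))) = 0" if "A \<in> borel_partitions {}" for A
    using that by (simp add: borel_partitions_def)
  then have "variation \<mu> {} = (SUP A\<in>borel_partitions {}. 0)"
    unfolding variation_def by (intro SUP_cong refl)
  then show ?thesis by (simp add: borel_partitions_ne)
qed

lemma borel_partitions_Int:
  assumes "A \<in> borel_partitions E" "B \<in> sets borel" "B \<subseteq> E"
  shows "(\<lambda>i. A i \<inter> B) \<in> borel_partitions B"
proof -
  have "range (\<lambda>i. A i \<inter> B) \<subseteq> sets borel" using assms by (auto simp: borel_partitions_def)
  moreover have "disjoint_family (\<lambda>i. A i \<inter> B)"
    using assms(1) by (fastforce simp: borel_partitions_def disjoint_family_on_def)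
  moreover have "(\<Union>i. A i \<inter> B) = B" using assms(1,3) by (auto simp: borel_partitions_def)
  ultimately show ?thesis by (simp add: borel_partitions_def)
qed

text \<open>A partition of the union is cut along the sets \<open>A i\<close>; Tonelli for double
  series regroups the pieces by \<open>i\<close>.\<close>

lemma variation_countably_subadditive:
  assumes A: "range A \<subseteq> sets borel" "disjoint_family A"
  shows "variation \<mu> (\<Union>i. A i) \<le> (\<Sum>i. variation \<mu> (A i))"
  unfolding variation_def[of \<mu> "\<Union>i. A i"]
proof (rule SUP_least)
  fix B assume B: "B \<in> borel_partitions (\<Union>i. A i)"
  have "(\<Sum>j. ennreal (cmod (\<mu> (B j)))) \<le> (\<Sum>j. \<Sum>i. ennreal (cmod (\<mu> (B j \<inter> A i))))"
  proof (rule suminf_le)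
    fix j
    have "A \<in> borel_partitions (\<Union>i. A i)" using A by (simp add: borel_partitions_def)
    then have "(\<lambda>i. B j \<inter> A i) \<in> borel_partitions (B j)"
      using borel_partitions_Int[of A _ "B j"] B
      by (subst Int_commute, elim borel_partitions_Int) (auto simp: borel_partitions_def)
    then show "ennreal (cmod (\<mu> (B j))) \<le> (\<Sum>i. ennreal (cmod (\<mu> (B j \<inter> A i))))"
      by (intro cmod_sums_le_suminf_ennreal partition_sums)
  qed auto
  also have "\<dots> = (\<Sum>i. \<Sum>j. ennreal (cmod (\<mu> (B j \<inter> A i))))" by (rule ennreal_suminf_swap)
  also have "\<dots> \<le> (\<Sum>i. variation \<mu> (A i))"
  proof (rule suminf_le)
    fix i
    have "(\<lambda>j. B j \<inter> A i) \<in> borel_partitions (A i)"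
      using A(1) by (intro borel_partitions_Int[OF B]) auto
    then show "(\<Sum>j. ennreal (cmod (\<mu> (B j \<inter> A i)))) \<le> variation \<mu> (A i)"
      by (rule variation_upper)
  qed auto
  finally show "(\<Sum>j. ennreal (cmod (\<mu> (B j)))) \<le> (\<Sum>i. variation \<mu> (A i))" .
qed

lemma variation_countably_additive: "countably_additive (sets borel) (variation \<mu>)"
  unfolding countably_additive_def
proof (intro allI impI antisym)
  fix A :: "nat \<Rightarrow> complex set"
  assume A: "range A \<subseteq> sets borel" "disjoint_family A" "\<Union> (range A) \<in> sets borel"
  show "variation \<mu> (\<Union> (range A)) \<le> (\<Sum>i. variation \<mu> (A i))"
    by (rule variation_countably_subadditive[OF A(1,2)])
  have fin: "(\<Sum>i<n. variation \<mu> (A i)) \<le> variation \<mu> (\<Union>i<n. A i)" for n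
  proof (induction n)
    case (Suc n)
    have "(\<Sum>i<Suc n. variation \<mu> (A i)) \<le> variation \<mu> (\<Union>i<n. A i) + variation \<mu> (A n)"
      using Suc by (simp add: add_right_mono)
    also have "\<dots> \<le> variation \<mu> ((\<Union>i<n. A i) \<union> A n)"
    proof (rule variation_superadditive)
      show "(\<Union>i<n. A i) \<inter> A n = {}"
        using disjoint_family_onD[OF A(2), of _ n] by fastforce
    qed (use A(1) in auto)
    also have "(\<Union>i<n. A i) \<union> A n = (\<Union>i<Suc n. A i)" by (auto simp: less_Suc_eq)
    finally show ?case .
  qed simp
  show "(\<Sum>i. variation \<mu> (A i)) \<le> variation \<mu> (\<Union> (range A))"
  proof (rule suminf_le_const)
    fix n
    have "variation \<mu> (\<Union>i<n. A i) \<le> variation \<mu> (\<Union> (range A))"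
      using A by (intro variation_mono) auto
    with fin[of n] show "(\<Sum>i<n. variation \<mu> (A i)) \<le> variation \<mu> (\<Union> (range A))" by simp
  qed simp
qed

lemma space_total_variation [simp]: "space (total_variation \<mu>) = UNIV"
  and sets_total_variation [simp, measurable_cong]: "sets (total_variation \<mu>) = sets borel"
proof -
  have "sigma_sets UNIV (sets borel) = sets (borel :: complex measure)"
    using sets.sigma_sets_eq[of "borel :: complex measure"] by (simp only: space_borel)
  then show "space (total_variation \<mu>) = UNIV" "sets (total_variation \<mu>) = sets borel"
    unfolding total_variation_def by (simp_all only: space_measure_of sets_measure_of subset_UNIV Pow_UNIV)
qed

lemma emeasure_total_variation:
  assumes "E \<in> sets borel" shows "emeasure (total_variation \<mu>) E = variation \<mu> E"
proof (rule emeasure_measure_of)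
  show "total_variation \<mu> = measure_of UNIV (sets borel) (variation \<mu>)"
    unfolding total_variation_def variation_def borel_partitions_def ..
  show "positive (sets (total_variation \<mu>)) (variation \<mu>)"
    by (simp add: positive_def variation_empty)
  show "countably_additive (sets (total_variation \<mu>)) (variation \<mu>)"
    using variation_countably_additive by simp
qed (use assms in auto)

text \<open>A set of infinite variation splits off a piece whose measure exceeds 1,
  leaving a set of infinite variation; repeating this contradicts convergence of \<open>\<Sum>i. \<mu> (A i)\<close>.\<close>

lemma infinite_variation_split:
  assumes E: "E \<in> sets borel" and inf: "variation \<mu> E = top"
  shows "\<exists>B\<subseteq>E. B \<in> sets borel \<and> variation \<mu> B = top \<and> cmod (\<mu> (E - B)) > 1"
proof -
  \<comment> \<open>The 4 pays for the passage to a subset. The term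
    \<open>1 + cmod (\<mu> E)\<close> makes both \<open>C\<close> and \<open>E - C\<close> have
    measure of modulus above 1, so whichever of them has infinite variation can be kept.\<close>
  have "ennreal (4 * (1 + cmod (\<mu> E))) < variation \<mu> E" using inf by simp
  then obtain A where A: "A \<in> borel_partitions E"
    and "ennreal (4 * (1 + cmod (\<mu> E))) < (\<Sum>i. ennreal (cmod (\<mu> (A i))))"
    unfolding variation_def less_SUP_iff by blast
  then obtain n where "ennreal (4 * (1 + cmod (\<mu> E))) < (\<Sum>i<n. ennreal (cmod (\<mu> (A i))))"
    unfolding suminf_eq_SUP less_SUP_iff by blast
  then have n: "4 * (1 + cmod (\<mu> E)) < (\<Sum>i<n. cmod (\<mu> (A i)))"
    by (simp add: ennreal_less_iff del: ennreal_plus)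
  obtain S where S: "S \<subseteq> {..<n}" "(\<Sum>i<n. cmod (\<mu> (A i))) \<le> 4 * cmod (\<Sum>i\<in>S. \<mu> (A i))"
    using sum_cmod_le_4_subset[of "{..<n}" "\<lambda>i. \<mu> (A i)"] by auto
  define C where "C = (\<Union>i\<in>S. A i)"
  have C: "C \<in> sets borel" "C \<subseteq> E"
    using A unfolding C_def borel_partitions_def by (auto intro!: sets.countable_UN')
  have "\<mu> C = (\<Sum>i\<in>S. \<mu> (A i))"
    unfolding C_def using A S(1)
    by (intro finite_UN) (auto simp: borel_partitions_def disjoint_family_on_def intro: finite_subset)
  then have big: "1 + cmod (\<mu> E) < cmod (\<mu> C)" using n S(2) by simp
  have "\<mu> E = \<mu> C + \<mu> (E - C)"
    using add_disjoint[of C "E - C"] C E by (simp add: Un_absorb1)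
  then have big': "1 < cmod (\<mu> (E - C))"
    using big norm_triangle_ineq4[of "\<mu> E" "\<mu> (E - C)"] by simp
  have "variation \<mu> E = variation \<mu> C + variation \<mu> (E - C)"
  proof -
    have "emeasure (total_variation \<mu>) (C \<union> (E - C)) =
      emeasure (total_variation \<mu>) C + emeasure (total_variation \<mu>) (E - C)"
      using C E by (intro plus_emeasure[symmetric]) auto
    then show ?thesis using C E by (simp add: emeasure_total_variation Un_absorb1)
  qed
  then consider "variation \<mu> C = top" | "variation \<mu> (E - C) = top"
    using inf by (metis ennreal_add_eq_top)
  then show ?thesis
  proof cases
    case 1
    then show ?thesis using C big' by blast
  next
    case 2
    moreover have "E - (E - C) = C" using C by blast
    ultimately show ?thesis
      using C E order.strict_trans1[OF _ big, of 1] by (intro exI[of _ "E - C"]) auto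
  qed
qed

lemma variation_finite: "variation \<mu> UNIV < top"
proof (rule ccontr)
  assume "\<not> variation \<mu> UNIV < top"
  then have "variation \<mu> UNIV = top" by (metis less_top)
  then have "\<exists>E. \<forall>n. (E n \<in> sets borel \<and> variation \<mu> (E n) = top) \<and>
      (E (Suc n) \<subseteq> E n \<and> cmod (\<mu> (E n - E (Suc n))) > 1)"
  proof (intro dependent_nat_choice)
    fix D n assume "D \<in> sets borel \<and> variation \<mu> D = top"
    then show "\<exists>B. (B \<in> sets borel \<and> variation \<mu> B = top) \<and> B \<subseteq> D \<and> cmod (\<mu> (D - B)) > 1"
      using infinite_variation_split[of D] by blast
  qed (auto intro: exI[of _ UNIV])
  then obtain E where E: "\<And>n. E n \<in> sets borel" "\<And>n::nat. E (Suc n) \<subseteq> E n"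
    "\<And>n. cmod (\<mu> (E n - E (Suc n))) > 1" by blast
  define A where "A n = E n - E (Suc n)" for n
  have dec: "E m \<subseteq> E n" if "n \<le> m" for m n
    using lift_Suc_antimono_le[of E, OF E(2) that] .
  have "disjoint_family A"
    unfolding disjoint_family_on_def
  proof (intro ballI impI)
    fix m n :: nat assume "m \<noteq> n"
    then have "Suc m \<le> n \<or> Suc n \<le> m" by auto
    then show "A m \<inter> A n = {}" using dec unfolding A_def by blast
  qed
  moreover have "range A \<subseteq> sets borel" using E by (auto simp: A_def)
  ultimately have "summable (\<lambda>n. \<mu> (A n))" using sums_UN[of A] by (auto simp: sums_iff)
  then have "(\<lambda>n. \<mu> (A n)) \<longlonglongrightarrow> 0" by (rule summable_LIMSEQ_zero)
  then have "eventually (\<lambda>n. dist (\<mu> (A n)) 0 < 1) sequentially" by (rule tendstoD) simp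
  then obtain n where "cmod (\<mu> (A n)) < 1"
    unfolding eventually_sequentially dist_0_norm dist_norm by auto
  with E(3)[of n] show False by (simp add: A_def)
qed

lemma finite_measure_total_variation: "finite_measure (total_variation \<mu>)"
  by (rule finite_measureI) (use variation_finite in \<open>simp add: emeasure_total_variation\<close>)

end

section \<open>Integration against a complex measure\<close>

lemma bounded_bilinear_scaleC:
  "bounded_bilinear (scaleC :: complex \<Rightarrow> 'a::complex_normed_vector \<Rightarrow> 'a)"
proof
  fix r :: real and a :: complex and b :: 'a
  show "scaleC (r *\<^sub>R a) b = r *\<^sub>R scaleC a b"
    by (simp add: scaleR_conv_of_real flip: scaleC_of_real scaleC_scaleC)
  show "scaleC a (r *\<^sub>R b) = r *\<^sub>R scaleC a b"
    by (simp flip: scaleC_of_real add: scaleC_scaleC mult.commute)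
  show "\<exists>K. \<forall>a b. norm (scaleC a b :: 'a) \<le> norm a * norm b * K"
    by (intro exI[of _ 1]) (simp add: norm_scaleC)
qed (simp_all add: scaleC_add_left scaleC_add_right)

interpretation scaleC: bounded_bilinear "scaleC :: complex \<Rightarrow> 'a::complex_normed_vector \<Rightarrow> 'a"
  by (rule bounded_bilinear_scaleC)

lemma scaleC_one [simp]: "scaleC 1 x = x"
  using scaleC_of_real[of 1 x] by simp

lemma continuous_on_scaleC [continuous_intros]:
  fixes g :: "'a::topological_space \<Rightarrow> 'b::complex_normed_vector"
  shows "continuous_on S f \<Longrightarrow> continuous_on S g \<Longrightarrow> continuous_on S (\<lambda>x. scaleC (f x) (g x))"
  by (rule scaleC.continuous_on)

lemma simple_function_measurable_finite:
  assumes "simple_function M s"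
  shows "s \<in> measurable M (count_space (s ` space M))"
  using assms by (subst measurable_count_space_eq2) (auto simp: simple_function_def)

lemma ennreal_tendsto_zero_le:
  fixes a b :: "nat \<Rightarrow> ennreal"
  assumes "\<And>i. a i \<le> b i" "b \<longlonglongrightarrow> 0"
  shows "a \<longlonglongrightarrow> 0"
  using assms by (intro tendsto_sandwich[OF _ _ tendsto_const assms(2)] always_eventually allI) simp_all

context complex_measure
begin

text \<open>In a target that is not second countable, a difference of measurable functions need not
  be measurable. As \<open>s\<close> has finitely many values, each value \<open>y\<close> is
  treated separately, where only the continuous map \<open>x \<mapsto> norm (x - y)\<close> is
  composed with \<open>f\<close>.\<close>

lemma measurable_norm_diff_simple:
  assumes f: "f \<in> borel_measurable (total_variation \<mu>)" and s: "simple_function (total_variation \<mu>) s"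
  shows "(\<lambda>\<xi>. ennreal (norm (f \<xi> - s \<xi> :: 'b::complex_normed_vector))) \<in> borel_measurable (total_variation \<mu>)"
proof (rule measurable_compose_countable'[where g = s and f = "\<lambda>y \<xi>. ennreal (norm (f \<xi> - y))"])
  show "s \<in> measurable (total_variation \<mu>) (count_space (range s))"
    using simple_function_measurable_finite[OF s] by simp
  show "countable (range s)"
    using s by (auto simp: simple_function_def intro: countable_finite)
  fix y :: 'b
  have "(\<lambda>x. ennreal (norm (x - y))) \<in> borel_measurable borel"
    by (intro borel_measurable_continuous_onI continuous_on_ennreal continuous_intros)
  from measurable_compose[OF f this]
  show "(\<lambda>\<xi>. ennreal (norm (f \<xi> - y))) \<in> borel_measurable (total_variation \<mu>)" .
qed

text \<open>The labelling \<open>p\<close> may be finer than the values of the integrand. Taking for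
  \<open>p\<close> a pair of simple functions puts both on a common partition, which gives
  linearity.\<close>

lemma simple_complex_integral_partition:
  fixes g :: "'c \<Rightarrow> 'b::complex_normed_vector"
  assumes p: "simple_function (total_variation \<mu>) p"
  shows "simple_complex_integral \<mu> (\<lambda>\<xi>. g (p \<xi>)) = (\<Sum>c\<in>range p. scaleC (\<mu> (p -` {c})) (g c))"
proof -
  have fin: "finite (range p)" and meas: "\<And>c. p -` {c} \<in> sets borel"
    using simple_functionD[OF p] by simp_all
  have ran: "range (\<lambda>\<xi>. g (p \<xi>)) = g ` range p" by auto
  have "\<mu> ((\<lambda>\<xi>. g (p \<xi>)) -` {y}) = (\<Sum>c\<in>{c\<in>range p. g c = y}. \<mu> (p -` {c}))" for y
  proof -
    have "(\<lambda>\<xi>. g (p \<xi>)) -` {y} = (\<Union>c\<in>{c\<in>range p. g c = y}. p -` {c})" by auto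
    also have "\<mu> \<dots> = (\<Sum>c\<in>{c\<in>range p. g c = y}. \<mu> (p -` {c}))"
      by (rule finite_UN) (use fin meas in \<open>auto simp: disjoint_family_on_def\<close>)
    finally show ?thesis .
  qed
  then have "simple_complex_integral \<mu> (\<lambda>\<xi>. g (p \<xi>)) =
      (\<Sum>y\<in>g ` range p. \<Sum>c\<in>{c\<in>range p. g c = y}. scaleC (\<mu> (p -` {c})) (g c))"
    unfolding simple_complex_integral_def ran by (auto simp: scaleC.sum_left intro!: sum.cong)
  also have "\<dots> = (\<Sum>c\<in>range p. scaleC (\<mu> (p -` {c})) (g c))"
    by (rule sum.image_gen[OF fin, symmetric])
  finally show ?thesis .
qed

lemma simple_complex_integral_diff:
  assumes "simple_function (total_variation \<mu>) s" "simple_function (total_variation \<mu>) t"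
  shows "simple_complex_integral \<mu> (\<lambda>\<xi>. s \<xi> - t \<xi>) =
    simple_complex_integral \<mu> s - simple_complex_integral \<mu> t"
proof -
  have p: "simple_function (total_variation \<mu>) (\<lambda>\<xi>. (s \<xi>, t \<xi>))"
    using assms by (rule simple_function_Pair)
  show ?thesis
    using simple_complex_integral_partition[OF p, of "\<lambda>(a, b). a - b"]
      simple_complex_integral_partition[OF p, of fst] simple_complex_integral_partition[OF p, of snd]
    by (simp add: case_prod_beta scaleC.diff_right sum_subtractf)
qed

lemma norm_simple_complex_integral_le:
  assumes s: "simple_function (total_variation \<mu>) s"
  shows "ennreal (norm (simple_complex_integral \<mu> s)) \<le> (\<integral>\<^sup>+\<xi>. ennreal (norm (s \<xi>)) \<partial>total_variation \<mu>)"
proof -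
  have meas: "\<And>c. s -` {c} \<in> sets borel"
    using simple_functionD[OF s] by simp
  have "norm (simple_complex_integral \<mu> s) \<le> (\<Sum>y\<in>range s. cmod (\<mu> (s -` {y})) * norm y)"
    unfolding simple_complex_integral_def by (rule order.trans[OF norm_sum]) (simp add: norm_scaleC)
  then have "ennreal (norm (simple_complex_integral \<mu> s)) \<le>
      (\<Sum>y\<in>range s. ennreal (norm y) * ennreal (cmod (\<mu> (s -` {y}))))"
    by (simp add: ennreal_mult[symmetric] mult.commute ennreal_leI)
  also have "\<dots> \<le> (\<Sum>y\<in>range s. ennreal (norm y) * emeasure (total_variation \<mu>) (s -` {y}))"
    by (intro sum_mono mult_left_mono) (simp_all add: emeasure_total_variation meas cmod_le_variation)
  also have "\<dots> = integral\<^sup>S (total_variation \<mu>) (\<lambda>\<xi>. ennreal (norm (s \<xi>)))"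
    using simple_function_partition[OF simple_function_compose1[OF s, of "\<lambda>y. ennreal (norm y)"] s,
      of "\<lambda>y. ennreal (norm y)"] by (simp add: vimage_def)
  also have "\<dots> = (\<integral>\<^sup>+\<xi>. ennreal (norm (s \<xi>)) \<partial>total_variation \<mu>)"
    by (rule nn_integral_eq_simple_integral[symmetric]) (rule simple_function_compose1[OF s])
  finally show ?thesis .
qed

lemma nn_integral_norm_triangle:
  fixes f s :: "complex \<Rightarrow> 'b::complex_normed_vector" and g t :: "complex \<Rightarrow> 'c::complex_normed_vector"
  assumes "f \<in> borel_measurable (total_variation \<mu>)" "simple_function (total_variation \<mu>) s"
    "g \<in> borel_measurable (total_variation \<mu>)" "simple_function (total_variation \<mu>) t"
    and le: "\<And>\<xi>. norm (h \<xi>) \<le> norm (f \<xi> - s \<xi>) + norm (g \<xi> - t \<xi>)"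
  shows "(\<integral>\<^sup>+\<xi>. ennreal (norm (h \<xi>)) \<partial>total_variation \<mu>) \<le>
    (\<integral>\<^sup>+\<xi>. ennreal (norm (f \<xi> - s \<xi>)) \<partial>total_variation \<mu>) +
    (\<integral>\<^sup>+\<xi>. ennreal (norm (g \<xi> - t \<xi>)) \<partial>total_variation \<mu>)"
proof -
  have "(\<integral>\<^sup>+\<xi>. ennreal (norm (h \<xi>)) \<partial>total_variation \<mu>) \<le>
      (\<integral>\<^sup>+\<xi>. ennreal (norm (f \<xi> - s \<xi>)) + ennreal (norm (g \<xi> - t \<xi>)) \<partial>total_variation \<mu>)"
    using le by (intro nn_integral_mono) (simp flip: ennreal_plus add: ennreal_leI)
  also have "\<dots> = (\<integral>\<^sup>+\<xi>. ennreal (norm (f \<xi> - s \<xi>)) \<partial>total_variation \<mu>) +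
      (\<integral>\<^sup>+\<xi>. ennreal (norm (g \<xi> - t \<xi>)) \<partial>total_variation \<mu>)"
    by (rule nn_integral_add; rule measurable_norm_diff_simple) fact+
  finally show ?thesis .
qed

text \<open>Measurability of the difference is a premise because it does not follow from that of
  \<open>f\<close> and \<open>g\<close> in a nonseparable target. For uniqueness of the integral the
  difference is the zero function, so the premise is free there.\<close>

lemma has_complex_bochner_integral_diff:
  assumes f: "has_complex_bochner_integral \<mu> f I" and g: "has_complex_bochner_integral \<mu> g J"
    and fg: "(\<lambda>\<xi>. f \<xi> - g \<xi>) \<in> borel_measurable (total_variation \<mu>)"
  shows "has_complex_bochner_integral \<mu> (\<lambda>\<xi>. f \<xi> - g \<xi>) (I - J)"
proof -
  let ?M = "total_variation \<mu>"
  obtain s where s: "\<And>i. simple_function ?M (s i)"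
      "(\<lambda>i. \<integral>\<^sup>+\<xi>. ennreal (norm (f \<xi> - s i \<xi>)) \<partial>?M) \<longlonglongrightarrow> 0"
      "(\<lambda>i. simple_complex_integral \<mu> (s i)) \<longlonglongrightarrow> I"
    and fm: "f \<in> borel_measurable ?M"
    using f unfolding has_complex_bochner_integral_def by blast
  obtain t where t: "\<And>i. simple_function ?M (t i)"
      "(\<lambda>i. \<integral>\<^sup>+\<xi>. ennreal (norm (g \<xi> - t i \<xi>)) \<partial>?M) \<longlonglongrightarrow> 0"
      "(\<lambda>i. simple_complex_integral \<mu> (t i)) \<longlonglongrightarrow> J"
    and gm: "g \<in> borel_measurable ?M"
    using g unfolding has_complex_bochner_integral_def by blast
  show ?thesis
    unfolding has_complex_bochner_integral_def
  proof (intro conjI fg exI[of _ "\<lambda>i \<xi>. s i \<xi> - t i \<xi>"] allI)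
    show "simple_function ?M (\<lambda>\<xi>. s i \<xi> - t i \<xi>)" for i
      by (rule simple_function_compose2[OF s(1) t(1)])
    show "(\<lambda>i. simple_complex_integral \<mu> (\<lambda>\<xi>. s i \<xi> - t i \<xi>)) \<longlonglongrightarrow> I - J"
      using tendsto_diff[OF s(3) t(3)] by (simp add: simple_complex_integral_diff s t)
    have lim: "(\<lambda>i. (\<integral>\<^sup>+\<xi>. ennreal (norm (f \<xi> - s i \<xi>)) \<partial>?M) +
        (\<integral>\<^sup>+\<xi>. ennreal (norm (g \<xi> - t i \<xi>)) \<partial>?M)) \<longlonglongrightarrow> 0"
      using tendsto_add[OF s(2) t(2)] by simp
    have "(\<integral>\<^sup>+\<xi>. ennreal (norm (f \<xi> - g \<xi> - (s i \<xi> - t i \<xi>))) \<partial>?M) \<le>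
        (\<integral>\<^sup>+\<xi>. ennreal (norm (f \<xi> - s i \<xi>)) \<partial>?M) + (\<integral>\<^sup>+\<xi>. ennreal (norm (g \<xi> - t i \<xi>)) \<partial>?M)" for i
    proof (rule nn_integral_norm_triangle[OF fm s(1) gm t(1)])
      fix \<xi>
      show "norm (f \<xi> - g \<xi> - (s i \<xi> - t i \<xi>)) \<le> norm (f \<xi> - s i \<xi>) + norm (g \<xi> - t i \<xi>)"
        using norm_triangle_ineq4[of "f \<xi> - s i \<xi>" "g \<xi> - t i \<xi>"] by (simp add: algebra_simps)
    qed
    then show "(\<lambda>i. \<integral>\<^sup>+\<xi>. ennreal (norm (f \<xi> - g \<xi> - (s i \<xi> - t i \<xi>))) \<partial>?M) \<longlonglongrightarrow> 0"
      using lim by (rule ennreal_tendsto_zero_le)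
  qed
qed

lemma norm_has_complex_bochner_integral_le:
  assumes f: "has_complex_bochner_integral \<mu> f I"
  shows "ennreal (norm I) \<le> (\<integral>\<^sup>+\<xi>. ennreal (norm (f \<xi>)) \<partial>total_variation \<mu>)"
proof -
  let ?M = "total_variation \<mu>"
  obtain s where s: "\<And>i. simple_function ?M (s i)"
      "(\<lambda>i. \<integral>\<^sup>+\<xi>. ennreal (norm (f \<xi> - s i \<xi>)) \<partial>?M) \<longlonglongrightarrow> 0"
      "(\<lambda>i. simple_complex_integral \<mu> (s i)) \<longlonglongrightarrow> I"
    and fm: "f \<in> borel_measurable ?M"
    using f unfolding has_complex_bochner_integral_def by blast
  have zero: "simple_function ?M (\<lambda>_. 0)" by simp
  have "ennreal (norm (simple_complex_integral \<mu> (s i))) \<le>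
      (\<integral>\<^sup>+\<xi>. ennreal (norm (f \<xi> - s i \<xi>)) \<partial>?M) + (\<integral>\<^sup>+\<xi>. ennreal (norm (f \<xi>)) \<partial>?M)" for i
  proof -
    have "ennreal (norm (simple_complex_integral \<mu> (s i))) \<le> (\<integral>\<^sup>+\<xi>. ennreal (norm (s i \<xi>)) \<partial>?M)"
      by (rule norm_simple_complex_integral_le[OF s(1)])
    also have "\<dots> \<le> (\<integral>\<^sup>+\<xi>. ennreal (norm (f \<xi> - s i \<xi>)) \<partial>?M) + (\<integral>\<^sup>+\<xi>. ennreal (norm (f \<xi> - 0)) \<partial>?M)"
    proof (rule nn_integral_norm_triangle[OF fm s(1) fm zero])
      show "norm (s i \<xi>) \<le> norm (f \<xi> - s i \<xi>) + norm (f \<xi> - 0)" for \<xi>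
        using norm_triangle_ineq4[of "f \<xi>" "f \<xi> - s i \<xi>"] by simp
    qed
    finally show ?thesis by simp
  qed
  moreover have "(\<lambda>i. (\<integral>\<^sup>+\<xi>. ennreal (norm (f \<xi> - s i \<xi>)) \<partial>?M) + (\<integral>\<^sup>+\<xi>. ennreal (norm (f \<xi>)) \<partial>?M))
      \<longlonglongrightarrow> 0 + (\<integral>\<^sup>+\<xi>. ennreal (norm (f \<xi>)) \<partial>?M)"
    by (intro tendsto_add s(2) tendsto_const)
  moreover have "(\<lambda>i. ennreal (norm (simple_complex_integral \<mu> (s i)))) \<longlonglongrightarrow> ennreal (norm I)"
    by (intro tendsto_ennrealI tendsto_norm s(3))
  ultimately show ?thesis
    using LIMSEQ_le[of _ "ennreal (norm I)"] by fastforce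
qed

lemma has_complex_bochner_integral_unique:
  assumes f: "has_complex_bochner_integral \<mu> f I" and g: "has_complex_bochner_integral \<mu> f J"
  shows "I = J"
  using norm_has_complex_bochner_integral_le[OF has_complex_bochner_integral_diff[OF f g]]
  by (simp add: ennreal_eq_0_iff)

lemma complex_bochner_integral_eqI:
  assumes "has_complex_bochner_integral \<mu> (\<lambda>\<xi>. indicator K \<xi> *\<^sub>R f \<xi>) I"
  shows "complex_bochner_integral \<mu> K f = I"
  unfolding complex_bochner_integral_def
  using assms has_complex_bochner_integral_unique by blast

definition total_mass :: real
  where "total_mass = measure (total_variation \<mu>) UNIV"

lemma total_mass_nonneg [simp]: "0 \<le> total_mass"
  by (simp add: total_mass_def)

lemma emeasure_UNIV_eq: "emeasure (total_variation \<mu>) UNIV = ennreal total_mass"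
proof -
  interpret finite_measure "total_variation \<mu>" by (rule finite_measure_total_variation)
  show ?thesis by (simp add: total_mass_def emeasure_eq_measure)
qed

lemma nn_integral_le_total_mass:
  assumes "\<And>\<xi>. norm (f \<xi>) \<le> C"
  shows "(\<integral>\<^sup>+\<xi>. ennreal (norm (f \<xi>)) \<partial>total_variation \<mu>) \<le> ennreal (C * total_mass)"
proof -
  have C: "0 \<le> C" using assms[of undefined] norm_ge_zero order.trans by blast
  have "(\<integral>\<^sup>+\<xi>. ennreal (norm (f \<xi>)) \<partial>total_variation \<mu>) \<le> (\<integral>\<^sup>+\<xi>. ennreal C \<partial>total_variation \<mu>)"
    using assms by (intro nn_integral_mono) (simp add: ennreal_leI)
  also have "\<dots> = ennreal (C * total_mass)"
    using C by (simp add: emeasure_UNIV_eq ennreal_mult)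
  finally show ?thesis .
qed

lemma norm_has_complex_bochner_integral_le_bound:
  assumes f: "has_complex_bochner_integral \<mu> f I" and "\<And>\<xi>. norm (f \<xi>) \<le> C"
  shows "norm I \<le> C * total_mass"
proof -
  have C: "0 \<le> C" using assms(2)[of undefined] norm_ge_zero order.trans by blast
  have "ennreal (norm I) \<le> ennreal (C * total_mass)"
    by (rule order.trans[OF norm_has_complex_bochner_integral_le[OF f] nn_integral_le_total_mass[OF assms(2)]])
  then show ?thesis using C by simp
qed

lemma has_complex_bochner_integral_linear:
  assumes f: "has_complex_bochner_integral \<mu> f I"
    and L: "bounded_linear L" "\<And>c x. L (scaleC c x) = scaleC c (L x)"
  shows "has_complex_bochner_integral \<mu> (\<lambda>\<xi>. L (f \<xi>)) (L I)"
proof -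
  let ?M = "total_variation \<mu>"
  interpret L: bounded_linear L by (rule L(1))
  obtain s where s: "\<And>i. simple_function ?M (s i)"
      "(\<lambda>i. \<integral>\<^sup>+\<xi>. ennreal (norm (f \<xi> - s i \<xi>)) \<partial>?M) \<longlonglongrightarrow> 0"
      "(\<lambda>i. simple_complex_integral \<mu> (s i)) \<longlonglongrightarrow> I"
    and fm: "f \<in> borel_measurable ?M"
    using f unfolding has_complex_bochner_integral_def by blast
  obtain C where C: "0 \<le> C" "\<And>x. norm (L x) \<le> norm x * C" using L.nonneg_bounded by blast
  show ?thesis
    unfolding has_complex_bochner_integral_def
  proof (intro conjI exI[of _ "\<lambda>i \<xi>. L (s i \<xi>)"] allI)
    have "L \<in> borel_measurable borel"
      by (intro borel_measurable_continuous_onI L.continuous_on continuous_on_id)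
    then show "(\<lambda>\<xi>. L (f \<xi>)) \<in> borel_measurable ?M" using fm by (rule measurable_compose[rotated])
    show "simple_function ?M (\<lambda>\<xi>. L (s i \<xi>))" for i by (rule simple_function_compose1[OF s(1)])
    have eq: "simple_complex_integral \<mu> (\<lambda>\<xi>. L (s i \<xi>)) = L (simple_complex_integral \<mu> (s i))" for i
      using simple_complex_integral_partition[OF s(1), of L i]
      by (simp add: simple_complex_integral_def L.sum L(2))
    show "(\<lambda>i. simple_complex_integral \<mu> (\<lambda>\<xi>. L (s i \<xi>))) \<longlonglongrightarrow> L I"
      unfolding eq by (intro L.tendsto s(3))
    have le: "(\<integral>\<^sup>+\<xi>. ennreal (norm (L (f \<xi>) - L (s i \<xi>))) \<partial>?M) \<le>
        ennreal C * (\<integral>\<^sup>+\<xi>. ennreal (norm (f \<xi> - s i \<xi>)) \<partial>?M)" for i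
    proof -
      have "(\<integral>\<^sup>+\<xi>. ennreal (norm (L (f \<xi>) - L (s i \<xi>))) \<partial>?M) \<le>
          (\<integral>\<^sup>+\<xi>. ennreal C * ennreal (norm (f \<xi> - s i \<xi>)) \<partial>?M)"
      proof (rule nn_integral_mono)
        fix \<xi>
        show "ennreal (norm (L (f \<xi>) - L (s i \<xi>))) \<le> ennreal C * ennreal (norm (f \<xi> - s i \<xi>))"
          using C(2)[of "f \<xi> - s i \<xi>"] C(1)
          by (simp add: L.diff ennreal_mult[symmetric] mult.commute ennreal_leI)
      qed
      also have "\<dots> = ennreal C * (\<integral>\<^sup>+\<xi>. ennreal (norm (f \<xi> - s i \<xi>)) \<partial>?M)"
        by (rule nn_integral_cmult) (rule measurable_norm_diff_simple[OF fm s(1)])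
      finally show ?thesis .
    qed
    have "(\<lambda>i. ennreal C * (\<integral>\<^sup>+\<xi>. ennreal (norm (f \<xi> - s i \<xi>)) \<partial>?M)) \<longlonglongrightarrow> ennreal C * 0"
      by (rule ennreal_tendsto_cmult[OF _ s(2)]) simp
    then show "(\<lambda>i. \<integral>\<^sup>+\<xi>. ennreal (norm (L (f \<xi>) - L (s i \<xi>))) \<partial>?M) \<longlonglongrightarrow> 0"
      using le by (intro ennreal_tendsto_zero_le[OF le]) simp
  qed
qed

text \<open>The approximant takes the first point of the finite net that lies within
  \<open>e\<close> of \<open>f \<xi>\<close>; choosing the least index keeps the choice
  measurable.\<close>

lemma simple_function_approx:
  fixes f :: "complex \<Rightarrow> 'b::complex_normed_vector"
  assumes f: "f \<in> borel_measurable (total_variation \<mu>)" and "finite Y"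
    and Y: "\<And>\<xi>. \<exists>y\<in>Y. dist (f \<xi>) y < e"
  shows "\<exists>s. simple_function (total_variation \<mu>) s \<and> (\<forall>\<xi>. norm (f \<xi> - s \<xi>) < e)"
proof -
  obtain ys where ys: "set ys = Y" using finite_list[OF \<open>finite Y\<close>] by blast
  define P where "P i \<xi> \<longleftrightarrow> i < length ys \<and> dist (f \<xi>) (ys ! i) < e" for i \<xi>
  define k where "k \<xi> = (LEAST i. P i \<xi>)" for \<xi>
  have k: "P (k \<xi>) \<xi>" for \<xi>
  proof -
    obtain y where "y \<in> set ys" "dist (f \<xi>) y < e" using Y[of \<xi>] ys by auto
    then have "\<exists>i. P i \<xi>" unfolding P_def by (metis in_set_conv_nth)
    then show ?thesis unfolding k_def by (rule LeastI_ex)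
  qed
  have "{\<xi>. P i \<xi>} \<in> sets borel" for i
  proof (cases "i < length ys")
    case True
    have "open (ball (ys ! i) e)" by simp
    then have "f -` ball (ys ! i) e \<inter> space (total_variation \<mu>) \<in> sets (total_variation \<mu>)"
      by (intro measurable_sets[OF f]) simp
    moreover have "f -` ball (ys ! i) e \<inter> space (total_variation \<mu>) = {\<xi>. P i \<xi>}"
      using True by (auto simp: P_def dist_commute)
    ultimately show ?thesis by simp
  qed (simp add: P_def)
  then have "(\<lambda>\<xi>. P i \<xi>) \<in> measurable (total_variation \<mu>) (count_space UNIV)" for i
    by (simp add: pred_def)
  then have "k \<in> measurable (total_variation \<mu>) (count_space UNIV)"
    unfolding k_def by (rule measurable_Least)
  then have meas: "k -` {i} \<in> sets borel" for i
    using measurable_sets[of k "total_variation \<mu>" "count_space UNIV" "{i}"] by simp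
  have "range k \<subseteq> {..<length ys}" using k by (auto simp: P_def)
  then have "finite (range k)" by (rule finite_subset) simp
  then have "simple_function (total_variation \<mu>) k"
    using meas by (simp add: simple_function_def)
  then have "simple_function (total_variation \<mu>) (\<lambda>\<xi>. ys ! k \<xi>)" by (rule simple_function_compose1)
  moreover have "norm (f \<xi> - ys ! k \<xi>) < e" for \<xi> using k[of \<xi>] by (simp add: P_def dist_norm)
  ultimately show ?thesis by blast
qed

text \<open>Total boundedness of the range stands in for separability: it yields simple functions
  converging uniformly, and finiteness of the total variation makes their integrals a Cauchy
  sequence.\<close>

lemma has_complex_bochner_integral_exists:
  fixes f :: "complex \<Rightarrow> 'b::complex_banach"
  assumes f: "f \<in> borel_measurable (total_variation \<mu>)"
    and tb: "\<And>e. e > 0 \<Longrightarrow> \<exists>Y. finite Y \<and> (\<forall>\<xi>. \<exists>y\<in>Y. dist (f \<xi>) y < e)"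
  shows "\<exists>I. has_complex_bochner_integral \<mu> f I"
proof -
  let ?M = "total_variation \<mu>"
  let ?e = "\<lambda>n. inverse (real (Suc n))"
  have "\<exists>s. simple_function ?M s \<and> (\<forall>\<xi>. norm (f \<xi> - s \<xi>) < ?e n)" for n
  proof -
    have "0 < ?e n" by simp
    from tb[OF this] obtain Y where "finite Y" "\<And>\<xi>. \<exists>y\<in>Y. dist (f \<xi>) y < ?e n" by blast
    then show ?thesis by (rule simple_function_approx[OF f])
  qed
  then obtain s where s: "\<And>n. simple_function ?M (s n)" "\<And>n \<xi>. norm (f \<xi> - s n \<xi>) < ?e n"
    by metis
  have cauchy: "norm (simple_complex_integral \<mu> (s m) - simple_complex_integral \<mu> (s n)) \<le>
      (?e m + ?e n) * total_mass" for m n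
  proof -
    have "norm (s m \<xi> - s n \<xi>) \<le> ?e m + ?e n" for \<xi>
      using norm_triangle_ineq4[of "f \<xi> - s n \<xi>" "f \<xi> - s m \<xi>"] s(2)[of \<xi> m] s(2)[of \<xi> n] by simp
    then have "(\<integral>\<^sup>+\<xi>. ennreal (norm (s m \<xi> - s n \<xi>)) \<partial>?M) \<le> ennreal ((?e m + ?e n) * total_mass)"
      by (rule nn_integral_le_total_mass)
    with norm_simple_complex_integral_le[OF simple_function_compose2[OF s(1)[of m] s(1)[of n], of "(-)"]]
    have "ennreal (norm (simple_complex_integral \<mu> (\<lambda>\<xi>. s m \<xi> - s n \<xi>))) \<le> ennreal ((?e m + ?e n) * total_mass)"
      by (rule order.trans)
    then show ?thesis by (simp add: simple_complex_integral_diff s(1))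
  qed
  have lim: "(\<lambda>n. ?e n * (2 * total_mass)) \<longlonglongrightarrow> 0"
    using tendsto_mult_right[OF LIMSEQ_inverse_real_of_nat, of "2 * total_mass"] by simp
  have "Cauchy (\<lambda>n. simple_complex_integral \<mu> (s n))"
  proof (rule metric_CauchyI)
    fix e :: real assume "e > 0"
    from tendstoD[OF lim this] obtain N where "?e N * (2 * total_mass) < e"
      by (auto simp: eventually_sequentially)
    moreover have "(?e m + ?e n) * total_mass \<le> ?e N * (2 * total_mass)" if "N \<le> m" "N \<le> n" for m n
    proof -
      have "?e m \<le> ?e N" "?e n \<le> ?e N" using that by (simp_all add: le_imp_inverse_le)
      then have "?e m + ?e n \<le> ?e N + ?e N" by (rule add_mono)
      from mult_right_mono[OF this total_mass_nonneg] show ?thesis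
        by (simp only: distrib_right mult_2 distrib_left)
    qed
    ultimately show "\<exists>N. \<forall>m\<ge>N. \<forall>n\<ge>N.
        dist (simple_complex_integral \<mu> (s m)) (simple_complex_integral \<mu> (s n)) < e"
      unfolding dist_norm using cauchy by (meson le_less_trans)
  qed
  then obtain I where I: "(\<lambda>n. simple_complex_integral \<mu> (s n)) \<longlonglongrightarrow> I"
    using Cauchy_convergent convergentD by blast
  have "(\<lambda>n. ennreal (?e n * total_mass)) \<longlonglongrightarrow> ennreal 0"
    by (rule tendsto_ennrealI[OF tendsto_mult_left_zero[OF LIMSEQ_inverse_real_of_nat]])
  then have lim0: "(\<lambda>n. ennreal (?e n * total_mass)) \<longlonglongrightarrow> 0" by (simp only: ennreal_0)
  have le: "(\<integral>\<^sup>+\<xi>. ennreal (norm (f \<xi> - s n \<xi>)) \<partial>?M) \<le> ennreal (?e n * total_mass)" for n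
    using s(2) by (intro nn_integral_le_total_mass less_imp_le)
  have "(\<lambda>n. \<integral>\<^sup>+\<xi>. ennreal (norm (f \<xi> - s n \<xi>)) \<partial>?M) \<longlonglongrightarrow> 0"
    by (rule ennreal_tendsto_zero_le[OF le lim0])
  with f s(1) I have "has_complex_bochner_integral \<mu> f I"
    unfolding has_complex_bochner_integral_def by (intro conjI exI[of _ s]) auto
  then show ?thesis ..
qed

lemma borel_measurable_indicator_continuous:
  fixes f :: "complex \<Rightarrow> 'b::complex_normed_vector"
  assumes "closed K" "continuous_on K f"
  shows "(\<lambda>\<xi>. indicator K \<xi> *\<^sub>R f \<xi>) \<in> borel_measurable (total_variation \<mu>)"
  using borel_measurable_continuous_on_indicator[OF borel_closed assms(2), OF assms(1)]
  by (simp add: measurable_cong_sets[OF sets_total_variation refl])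

lemma has_complex_bochner_integral_continuous:
  fixes f :: "complex \<Rightarrow> 'b::complex_banach"
  assumes K: "compact K" and f: "continuous_on K f"
  shows "has_complex_bochner_integral \<mu> (\<lambda>\<xi>. indicator K \<xi> *\<^sub>R f \<xi>) (complex_bochner_integral \<mu> K f)"
proof -
  have "\<exists>I. has_complex_bochner_integral \<mu> (\<lambda>\<xi>. indicator K \<xi> *\<^sub>R f \<xi>) I"
  proof (rule has_complex_bochner_integral_exists)
    show "(\<lambda>\<xi>. indicator K \<xi> *\<^sub>R f \<xi>) \<in> borel_measurable (total_variation \<mu>)"
      by (rule borel_measurable_indicator_continuous[OF compact_imp_closed[OF K] f])
    fix e :: real assume "e > 0"
    \<comment> \<open>The point 0 is added because it is the value of the integrand off
      \<open>K\<close>.\<close>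
    have "compact (insert 0 (f ` K))"
      by (rule compact_insert[OF compact_continuous_image[OF f K]])
    moreover have "insert 0 (f ` K) \<subseteq> (\<Union>y\<in>insert 0 (f ` K). ball y e)"
    proof
      fix x assume "x \<in> insert 0 (f ` K)"
      moreover have "x \<in> ball x e" using \<open>e > 0\<close> by (simp only: centre_in_ball)
      ultimately show "x \<in> (\<Union>y\<in>insert 0 (f ` K). ball y e)" by (rule UN_I)
    qed
    ultimately obtain Y where Y: "finite Y" "insert 0 (f ` K) \<subseteq> (\<Union>y\<in>Y. ball y e)"
      using compactE_image[of "insert 0 (f ` K)" "insert 0 (f ` K)" "\<lambda>y. ball y e"] open_ball by metis
    have "\<exists>y\<in>Y. dist (indicator K \<xi> *\<^sub>R f \<xi>) y < e" for \<xi>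
    proof -
      have "indicator K \<xi> *\<^sub>R f \<xi> \<in> insert 0 (f ` K)" by (auto simp: indicator_def)
      then have "indicator K \<xi> *\<^sub>R f \<xi> \<in> (\<Union>y\<in>Y. ball y e)" using Y(2) by (rule rev_subsetD)
      then show ?thesis by (simp add: dist_commute)
    qed
    with Y(1) show "\<exists>Y. finite Y \<and> (\<forall>\<xi>. \<exists>y\<in>Y. dist (indicator K \<xi> *\<^sub>R f \<xi>) y < e)"
      by (intro exI[of _ Y]) simp
  qed
  then obtain I where "has_complex_bochner_integral \<mu> (\<lambda>\<xi>. indicator K \<xi> *\<^sub>R f \<xi>) I" ..
  then show ?thesis using complex_bochner_integral_eqI[of K f I] by simp
qed

lemma complex_bochner_integral_diff:
  fixes f g :: "complex \<Rightarrow> 'b::complex_banach"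
  assumes K: "compact K" and f: "continuous_on K f" and g: "continuous_on K g"
  shows "complex_bochner_integral \<mu> K (\<lambda>\<xi>. f \<xi> - g \<xi>) =
    complex_bochner_integral \<mu> K f - complex_bochner_integral \<mu> K g"
proof (rule complex_bochner_integral_eqI)
  have "(\<lambda>\<xi>. indicator K \<xi> *\<^sub>R (f \<xi> - g \<xi>)) \<in> borel_measurable (total_variation \<mu>)"
    using K f g by (intro borel_measurable_indicator_continuous compact_imp_closed continuous_intros)
  then show "has_complex_bochner_integral \<mu> (\<lambda>\<xi>. indicator K \<xi> *\<^sub>R (f \<xi> - g \<xi>))
      (complex_bochner_integral \<mu> K f - complex_bochner_integral \<mu> K g)"
    using has_complex_bochner_integral_diff[OF has_complex_bochner_integral_continuous[OF K f]
      has_complex_bochner_integral_continuous[OF K g]] by (simp add: scaleR_right_diff_distrib)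
qed

text \<open>Serves to pass from operator-valued and scalar integrals to vectors: evaluation at
  \<open>y\<close> and multiplication of \<open>y\<close> by a scalar are both maps \<open>L\<close>
  of this kind.\<close>

lemma complex_bochner_integral_linear:
  fixes f :: "complex \<Rightarrow> 'b::complex_banach" and L :: "'b \<Rightarrow> 'c::complex_banach"
  assumes K: "compact K" and f: "continuous_on K f"
    and L: "bounded_linear L" "\<And>c x. L (scaleC c x) = scaleC c (L x)"
  shows "complex_bochner_integral \<mu> K (\<lambda>\<xi>. L (f \<xi>)) = L (complex_bochner_integral \<mu> K f)"
proof (rule complex_bochner_integral_eqI)
  show "has_complex_bochner_integral \<mu> (\<lambda>\<xi>. indicator K \<xi> *\<^sub>R L (f \<xi>)) (L (complex_bochner_integral \<mu> K f))"
    using has_complex_bochner_integral_linear[OF has_complex_bochner_integral_continuous[OF K f] L]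
    by (simp add: linear_cmul[OF bounded_linear.linear[OF L(1)]])
qed

lemma norm_complex_bochner_integral_le:
  fixes f :: "complex \<Rightarrow> 'b::complex_banach"
  assumes K: "compact K" and f: "continuous_on K f" and C: "0 \<le> C" "\<And>\<xi>. \<xi> \<in> K \<Longrightarrow> norm (f \<xi>) \<le> C"
  shows "norm (complex_bochner_integral \<mu> K f) \<le> C * total_mass"
proof (rule norm_has_complex_bochner_integral_le_bound[OF has_complex_bochner_integral_continuous[OF K f]])
  show "norm (indicator K \<xi> *\<^sub>R f \<xi>) \<le> C" for \<xi>
    using C by (cases "\<xi> \<in> K") simp_all
qed

lemma emeasure_total_variation_null:
  assumes "measure_supported_on \<mu> K" "B \<in> sets borel" "B \<inter> K = {}"
  shows "emeasure (total_variation \<mu>) B = 0"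
proof -
  have "(\<Sum>i. ennreal (cmod (\<mu> (A i)))) = 0" if "A \<in> borel_partitions B" for A
  proof -
    have "\<mu> (A i) = 0" for i
    proof -
      have "A i \<in> sets borel" "A i \<subseteq> B" using that by (auto simp: borel_partitions_def)
      moreover from this have "A i \<inter> K = {}" using assms(3) by blast
      ultimately show ?thesis using assms(1) by (simp add: measure_supported_on_def)
    qed
    then show ?thesis by simp
  qed
  then have "variation \<mu> B = (SUP A\<in>borel_partitions B. 0)"
    unfolding variation_def by (intro SUP_cong refl)
  then show ?thesis using assms(2) by (simp add: emeasure_total_variation borel_partitions_ne)
qed

end

section \<open>Conjugation symmetry of the measure and of its integrals\<close>

lemma cnj_image_eq_vimage: "cnj ` E = cnj -` E"
proof (intro set_eqI iffI)
  fix x assume "x \<in> cnj -` E"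
  then have "cnj x \<in> E" by simp
  then show "x \<in> cnj ` E" by (rule image_eqI[rotated]) simp
qed auto

lemma cnj_image_borel: "E \<in> sets borel \<Longrightarrow> cnj ` E \<in> sets borel"
proof -
  assume "E \<in> sets borel"
  moreover have "cnj \<in> borel_measurable borel"
    by (intro borel_measurable_continuous_onI continuous_intros)
  ultimately show ?thesis
    unfolding cnj_image_eq_vimage using measurable_sets[of cnj borel borel E] by simp
qed

locale symmetric_complex_measure = complex_measure +
  assumes symmetric: "symmetric_measure \<mu>"
begin

lemma cnj_image: "E \<in> sets borel \<Longrightarrow> \<mu> (cnj ` E) = cnj (\<mu> E)"
  using symmetric by (simp add: symmetric_measure_def)

lemma variation_cnj_image_le:
  assumes "E \<in> sets borel" shows "variation \<mu> E \<le> variation \<mu> (cnj ` E)"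
  unfolding variation_def[of \<mu> E]
proof (rule SUP_least)
  fix A assume A: "A \<in> borel_partitions E"
  have "(\<lambda>i. cnj ` A i) \<in> borel_partitions (cnj ` E)"
  proof -
    have "range (\<lambda>i. cnj ` A i) \<subseteq> sets borel"
      using A by (auto simp: borel_partitions_def intro: cnj_image_borel)
    moreover have "disjoint_family (\<lambda>i. cnj ` A i)"
      using A unfolding borel_partitions_def disjoint_family_on_def cnj_image_eq_vimage by blast
    moreover have "(\<Union>i. cnj ` A i) = cnj ` E" using A unfolding borel_partitions_def by blast
    ultimately show ?thesis by (simp add: borel_partitions_def)
  qed
  from variation_upper[OF this, of \<mu>]
  have "(\<Sum>i. ennreal (cmod (\<mu> (cnj ` A i)))) \<le> variation \<mu> (cnj ` E)" .
  moreover have "cmod (\<mu> (cnj ` A i)) = cmod (\<mu> (A i))" for i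
    using A by (subst cnj_image) (auto simp: borel_partitions_def)
  ultimately show "(\<Sum>i. ennreal (cmod (\<mu> (A i)))) \<le> variation \<mu> (cnj ` E)" by (simp only:)
qed

lemma variation_cnj_image:
  assumes "E \<in> sets borel" shows "variation \<mu> (cnj ` E) = variation \<mu> E"
proof (rule antisym)
  have "cnj ` cnj ` E = E" by (simp add: image_image)
  then show "variation \<mu> (cnj ` E) \<le> variation \<mu> E"
    using variation_cnj_image_le[OF cnj_image_borel[OF assms]] by simp
qed (rule variation_cnj_image_le[OF assms])

lemma distr_cnj_total_variation: "distr (total_variation \<mu>) (total_variation \<mu>) cnj = total_variation \<mu>"
proof (rule measure_eqI)
  have meas: "cnj \<in> measurable (total_variation \<mu>) (total_variation \<mu>)"
    by (subst measurable_cong_sets[OF sets_total_variation sets_total_variation])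
      (intro borel_measurable_continuous_onI continuous_intros)
  fix E assume "E \<in> sets (distr (total_variation \<mu>) (total_variation \<mu>) cnj)"
  then have E: "E \<in> sets borel" by simp
  then have "emeasure (distr (total_variation \<mu>) (total_variation \<mu>) cnj) E =
      emeasure (total_variation \<mu>) (cnj ` E)"
    using meas by (subst emeasure_distr) (auto simp: cnj_image_eq_vimage)
  then show "emeasure (distr (total_variation \<mu>) (total_variation \<mu>) cnj) E = emeasure (total_variation \<mu>) E"
    using E by (simp add: emeasure_total_variation cnj_image_borel variation_cnj_image)
qed simp

text \<open>Conjugating both the arguments and the values of the approximating simple functions
  leaves their distance to the integrand unchanged, since the total variation is invariant under
  conjugation.\<close>

lemma has_complex_bochner_integral_cnj:
  fixes f :: "complex \<Rightarrow> complex"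
  assumes f: "has_complex_bochner_integral \<mu> f I"
  shows "has_complex_bochner_integral \<mu> (\<lambda>\<xi>. cnj (f (cnj \<xi>))) (cnj I)"
proof -
  let ?M = "total_variation \<mu>"
  have meas: "cnj \<in> measurable ?M ?M" "cnj \<in> borel_measurable borel"
    by (subst measurable_cong_sets[OF sets_total_variation sets_total_variation])
      (intro borel_measurable_continuous_onI continuous_intros)+
  obtain s where s: "\<And>i. simple_function ?M (s i)"
      "(\<lambda>i. \<integral>\<^sup>+\<xi>. ennreal (norm (f \<xi> - s i \<xi>)) \<partial>?M) \<longlonglongrightarrow> 0"
      "(\<lambda>i. simple_complex_integral \<mu> (s i)) \<longlonglongrightarrow> I"
    and fm: "f \<in> borel_measurable ?M"
    using f unfolding has_complex_bochner_integral_def by blast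
  show ?thesis
    unfolding has_complex_bochner_integral_def
  proof (intro conjI exI[of _ "\<lambda>i \<xi>. cnj (s i (cnj \<xi>))"] allI)
    show "(\<lambda>\<xi>. cnj (f (cnj \<xi>))) \<in> borel_measurable ?M"
      by (rule measurable_compose[OF measurable_compose[OF meas(1) fm] meas(2)])
    have vim: "(\<lambda>\<xi>. cnj (s i (cnj \<xi>))) -` {y} = cnj ` (s i -` {cnj y})" for i y
      unfolding cnj_image_eq_vimage by auto
    have ran: "range (\<lambda>\<xi>. cnj (s i (cnj \<xi>))) = cnj ` range (s i)" for i
    proof -
      have "range cnj = UNIV" by (rule surjI[of cnj cnj]) simp
      then have "range (\<lambda>\<xi>. s i (cnj \<xi>)) = range (s i)" by (metis image_image)
      then show ?thesis by (metis image_image)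
    qed
    have sb: "s i -` {y} \<in> sets borel" for i y using simple_functionD(2)[OF s(1)[of i], of "{y}"] by simp
    show "simple_function ?M (\<lambda>\<xi>. cnj (s i (cnj \<xi>)))" for i
      unfolding simple_function_def space_total_variation ran
      using simple_functionD(1)[OF s(1)[of i]]
      by (simp add: vim cnj_image_borel sb)
    have "simple_complex_integral \<mu> (\<lambda>\<xi>. cnj (s i (cnj \<xi>))) = cnj (simple_complex_integral \<mu> (s i))" for i
    proof -
      have "inj_on cnj (range (s i))" by (rule inj_onI) simp
      then show ?thesis
        unfolding simple_complex_integral_def ran
        by (simp add: sum.reindex vim cnj_image[OF sb] scaleC_complex_def)
    qed
    then show "(\<lambda>i. simple_complex_integral \<mu> (\<lambda>\<xi>. cnj (s i (cnj \<xi>)))) \<longlonglongrightarrow> cnj I"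
      using tendsto_cnj[OF s(3)] by simp
    have "(\<integral>\<^sup>+\<xi>. ennreal (norm (cnj (f (cnj \<xi>)) - cnj (s i (cnj \<xi>)))) \<partial>?M) =
        (\<integral>\<^sup>+\<xi>. ennreal (norm (f \<xi> - s i \<xi>)) \<partial>?M)" for i
    proof -
      have "(\<integral>\<^sup>+\<xi>. ennreal (norm (f \<xi> - s i \<xi>)) \<partial>?M) =
          (\<integral>\<^sup>+\<xi>. ennreal (norm (f \<xi> - s i \<xi>)) \<partial>distr ?M ?M cnj)"
        by (simp add: distr_cnj_total_variation)
      also have "\<dots> = (\<integral>\<^sup>+\<xi>. ennreal (norm (f (cnj \<xi>) - s i (cnj \<xi>))) \<partial>?M)"
        by (rule nn_integral_distr[OF meas(1)])
          (use measurable_norm_diff_simple[OF fm s(1)] distr_cnj_total_variation in simp)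
      finally show ?thesis
        by (simp flip: complex_cnj_diff)
    qed
    then show "(\<lambda>i. \<integral>\<^sup>+\<xi>. ennreal (norm (cnj (f (cnj \<xi>)) - cnj (s i (cnj \<xi>)))) \<partial>?M) \<longlonglongrightarrow> 0"
      using s(2) by simp
  qed
qed

text \<open>\<open>K\<close> itself need not be symmetric, but \<open>\<mu>\<close> lives on \<open>K \<inter> cnj ` K\<close>.\<close>

lemma complex_bochner_integral_cnj:
  fixes f :: "complex \<Rightarrow> complex"
  assumes K: "compact K" "measure_supported_on \<mu> K" and f: "continuous_on UNIV f"
  shows "complex_bochner_integral \<mu> K (\<lambda>\<xi>. cnj (f (cnj \<xi>))) = cnj (complex_bochner_integral \<mu> K f)"
proof -
  let ?M = "total_variation \<mu>"
  define g where "g \<xi> = indicator K \<xi> *\<^sub>R cnj (f (cnj \<xi>))" for \<xi>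
  define h where "h \<xi> = cnj (indicator K (cnj \<xi>) *\<^sub>R f (cnj \<xi>))" for \<xi>
  have cont: "continuous_on K (\<lambda>\<xi>. cnj (f (cnj \<xi>)))"
    by (intro continuous_intros continuous_on_compose2[OF f]) auto
  have g: "has_complex_bochner_integral \<mu> g (complex_bochner_integral \<mu> K (\<lambda>\<xi>. cnj (f (cnj \<xi>))))"
    unfolding g_def by (rule has_complex_bochner_integral_continuous[OF K(1) cont])
  have h: "has_complex_bochner_integral \<mu> h (cnj (complex_bochner_integral \<mu> K f))"
    unfolding h_def
    by (intro has_complex_bochner_integral_cnj has_complex_bochner_integral_continuous K(1)
      continuous_on_subset[OF f] subset_UNIV)
  have gm: "g \<in> borel_measurable ?M" and hm: "h \<in> borel_measurable ?M"
    using g h by (auto simp: has_complex_bochner_integral_def)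
  have gh: "(\<lambda>\<xi>. g \<xi> - h \<xi>) \<in> borel_measurable ?M" using gm hm by (rule borel_measurable_diff)
  have Kb: "- K \<in> sets borel" using compact_imp_closed[OF K(1)] by (simp add: borel_open open_Compl)
  have null1: "emeasure ?M (- K) = 0"
    by (rule emeasure_total_variation_null[OF K(2) Kb]) simp
  have null2: "emeasure ?M (cnj ` (- K)) = 0"
    using null1 by (simp add: emeasure_total_variation Kb cnj_image_borel variation_cnj_image)
  have "AE \<xi> in ?M. \<xi> \<notin> - K"
    by (rule AE_not_in) (use null1 Kb in \<open>simp add: null_sets_def\<close>)
  moreover have "AE \<xi> in ?M. \<xi> \<notin> cnj ` (- K)"
    by (rule AE_not_in) (use null2 cnj_image_borel[OF Kb] in \<open>simp add: null_sets_def\<close>)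
  ultimately have "AE \<xi> in ?M. ennreal (norm (g \<xi> - h \<xi>)) = 0"
  proof eventually_elim
    case (elim \<xi>)
    then have "\<xi> \<in> K" "cnj \<xi> \<in> K" by (auto simp: cnj_image_eq_vimage)
    then show ?case by (simp add: g_def h_def)
  qed
  then have "(\<integral>\<^sup>+\<xi>. ennreal (norm (g \<xi> - h \<xi>)) \<partial>?M) = 0"
    by (subst nn_integral_cong_AE) auto
  with norm_has_complex_bochner_integral_le[OF has_complex_bochner_integral_diff[OF g h gh]]
  show ?thesis by (simp add: ennreal_eq_0_iff)
qed

end

section \<open>Mean values, the maximum principle and quasinilpotent operators\<close>

lemma has_vector_derivative_circle:
  "((\<lambda>t. z + of_real r * cis (2 * pi * t)) has_vector_derivative
    (2 * of_real pi * \<i> * of_real r * cis (2 * pi * t))) (at t within S)"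
proof -
  have "((\<lambda>w. z + of_real r * exp (\<i> * (2 * of_real pi * w))) has_field_derivative
      (2 * of_real pi * \<i> * of_real r * exp (\<i> * (2 * of_real pi * of_real t)))) (at (of_real t))"
    by (auto intro!: derivative_eq_intros simp: algebra_simps)
  from has_vector_derivative_real_field[OF this] show ?thesis
    by (simp add: cis_conv_exp has_vector_derivative_at_within)
qed

interpretation blinfun_compose: bounded_bilinear
  "(o\<^sub>L) :: ('b::real_normed_vector \<Rightarrow>\<^sub>L 'c::real_normed_vector) \<Rightarrow> ('a::real_normed_vector \<Rightarrow>\<^sub>L 'b) \<Rightarrow> _"
  by (rule bounded_bilinear_blinfun_compose)

lemma scaleC_eq_0_iff: "scaleC a x = 0 \<longleftrightarrow> a = 0 \<or> (x::'a::complex_normed_vector) = 0"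
  unfolding norm_eq_zero[of "scaleC a x", symmetric] norm_scaleC by simp

text \<open>The derivative of the circle mean with respect to the radius is the mean of
  \<open>cis * f'\<close>. Multiplied by 2 pi i r it is the increment of \<open>f\<close> around a
  closed curve, so it vanishes; the mean is therefore constant in \<open>r\<close> and equals its
  value at radius 0.\<close>

lemma vector_mean_value:
  fixes f f' :: "complex \<Rightarrow> 'b::complex_banach"
  assumes deriv: "\<And>z. (f has_derivative (\<lambda>h. scaleC h (f' z))) (at z)"
    and cont: "continuous_on UNIV f'"
  shows "integral {0..1} (\<lambda>t. f (z + of_real r * cis (2 * pi * t))) = f z"
proof -
  define c where "c r t = z + of_real r * cis (2 * pi * t)" for r t :: real
  define m where "m r = integral {0..1} (\<lambda>t. f (c r t))" for r
  have fcont: "continuous_on UNIV f"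
    by (rule has_derivative_continuous_on) (rule has_derivative_at_withinI[OF deriv])
  have ccont: "continuous_on S (\<lambda>x. c (g x) (h x))"
    if "continuous_on S g" "continuous_on S h" for S :: "'x::topological_space set" and g h
    unfolding c_def by (intro continuous_intros that)
  note fc = continuous_on_compose2[OF fcont _ subset_UNIV] continuous_on_compose2[OF cont _ subset_UNIV]
  have der_m: "(m has_vector_derivative integral {0..1} (\<lambda>t. scaleC (cis (2 * pi * t)) (f' (c r t)))) (at r)" for r
  proof -
    have "((\<lambda>r. integral (cbox 0 1) (\<lambda>t. f (c r t))) has_vector_derivative
        integral (cbox 0 1) (\<lambda>t. scaleC (cis (2 * pi * t)) (f' (c r t)))) (at r within UNIV)"
    proof (rule leibniz_rule_vector_derivative)
      fix r t :: real
      have "((\<lambda>r. c r t) has_vector_derivative cis (2 * pi * t)) (at r)"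
        unfolding c_def has_vector_derivative_def
        by (auto intro!: derivative_eq_intros simp: scaleR_conv_of_real)
      from vector_derivative_diff_chain_within[OF this has_derivative_at_withinI[OF deriv]]
      show "((\<lambda>r. f (c r t)) has_vector_derivative scaleC (cis (2 * pi * t)) (f' (c r t))) (at r within UNIV)"
        by (simp add: o_def)
    next
      fix r :: real
      show "(\<lambda>t. f (c r t)) integrable_on cbox 0 1"
        by (intro integrable_continuous fc ccont continuous_intros)
    next
      show "continuous_on (UNIV \<times> cbox 0 1) (\<lambda>(r, t). scaleC (cis (2 * pi * t)) (f' (c r t)))"
        unfolding case_prod_beta by (intro continuous_intros fc ccont)
    qed auto
    then show ?thesis by (simp add: m_def[abs_def])
  qed
  have zero: "integral {0..1} (\<lambda>t. scaleC (cis (2 * pi * t)) (f' (c r t))) = 0" if "r \<noteq> 0" for r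
  proof -
    let ?a = "2 * of_real pi * \<i> * of_real r :: complex"
    have "((\<lambda>t. scaleC (?a * cis (2 * pi * t)) (f' (c r t))) has_integral f (c r 1) - f (c r 0)) {0..1}"
    proof (rule fundamental_theorem_of_calculus)
      fix t :: real
      have "((\<lambda>t. c r t) has_vector_derivative ?a * cis (2 * pi * t)) (at t within {0..1})"
        unfolding c_def by (rule has_vector_derivative_circle)
      from vector_derivative_diff_chain_within[OF this has_derivative_at_withinI[OF deriv]]
      show "((\<lambda>t. f (c r t)) has_vector_derivative scaleC (?a * cis (2 * pi * t)) (f' (c r t)))
          (at t within {0..1})" by (simp add: o_def)
    qed simp
    moreover have "((\<lambda>t. scaleC ?a (scaleC (cis (2 * pi * t)) (f' (c r t)))) has_integral
        scaleC ?a (integral {0..1} (\<lambda>t. scaleC (cis (2 * pi * t)) (f' (c r t))))) {0..1}"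
      by (intro has_integral_linear[OF integrable_integral bounded_linear_scaleC_right, unfolded o_def]
          integrable_continuous_real continuous_intros fc ccont)
    moreover have "c r 1 = c r 0" by (simp add: c_def)
    ultimately have "scaleC ?a (integral {0..1} (\<lambda>t. scaleC (cis (2 * pi * t)) (f' (c r t)))) = 0"
      by (simp add: scaleC_scaleC has_integral_unique)
    then show ?thesis using that by (simp add: scaleC_eq_0_iff)
  qed
  \<comment> \<open>The derivative was shown to vanish only for nonzero radius; continuity of
    \<open>m\<close> bridges the exceptional point 0.\<close>
  have "m r = m 0"
  proof (rule has_derivative_zero_unique_strong_convex[of UNIV "{0}" m 0 "m 0" r])
    show "continuous_on UNIV m"
      by (intro continuous_at_imp_continuous_on ballI has_vector_derivative_continuous[OF der_m])
    show "(m has_derivative (\<lambda>h. 0)) (at r)" if "r \<in> UNIV - {0}" for r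
      using der_m[of r] zero[of r] that by (simp add: has_vector_derivative_def)
  qed auto
  then show ?thesis by (simp add: m_def c_def)
qed

lemma norm_integral_unit_interval_le:
  fixes f :: "real \<Rightarrow> 'b::banach"
  assumes "continuous_on {0..1} f" "\<And>t. t \<in> {0..1} \<Longrightarrow> norm (f t) \<le> C"
  shows "norm (integral {0..1} f) \<le> C"
proof -
  have "norm (integral {0..1} f) \<le> integral {0..1::real} (\<lambda>_. C)"
    by (rule integral_norm_bound_integral[OF integrable_continuous_real[OF assms(1)]]) (use assms in auto)
  then show ?thesis by simp
qed

text \<open>Adding \<open>e * (cmod z)\<^sup>2\<close> makes the sub-mean-value property strict, so the sum has no interior
  maximum.\<close>

lemma maximum_principle_mean_value:
  fixes h :: "complex \<Rightarrow> 'b::banach"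
  assumes W: "open W" "bounded W" and cont: "continuous_on (closure W) h"
    and mv: "\<And>z r. z \<in> W \<Longrightarrow> 0 < r \<Longrightarrow> cball z r \<subseteq> W \<Longrightarrow>
      integral {0..1} (\<lambda>t. h (z + of_real r * cis (2 * pi * t))) = h z"
    and bd: "\<And>z. z \<in> frontier W \<Longrightarrow> norm (h z) \<le> C" and z0: "z0 \<in> W"
  shows "norm (h z0) \<le> C"
proof (rule ccontr)
  assume "\<not> norm (h z0) \<le> C"
  then have gt: "C < norm (h z0)" by simp
  have "bounded (closure W)" using W(2) by (rule bounded_closure)
  then obtain R where R: "R > 0" "\<And>z. z \<in> closure W \<Longrightarrow> cmod z \<le> R"
    by (auto simp: bounded_pos)
  \<comment> \<open>With this \<open>e\<close> the perturbation is at most half of the excess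
    \<open>norm (h z0) - C\<close> on the closure of \<open>W\<close>, so a maximum of
    \<open>g\<close> on the frontier would lie below \<open>g z0\<close>.\<close>
  define e where "e = (norm (h z0) - C) / (2 * R\<^sup>2)"
  have e: "e > 0" "e * R\<^sup>2 = (norm (h z0) - C) / 2" using gt R by (auto simp: e_def)
  define g where "g z = norm (h z) + e * (cmod z)\<^sup>2" for z
  have "compact (closure W)" using W(2) by simp
  moreover have "continuous_on (closure W) g" unfolding g_def[abs_def] by (intro continuous_intros cont)
  moreover have z0c: "z0 \<in> closure W" by (rule subsetD[OF closure_subset z0])
  moreover have "closure W \<noteq> {}" using z0c by auto
  ultimately have "\<exists>p\<in>closure W. \<forall>z\<in>closure W. g z \<le> g p" by (intro continuous_attains_sup)
  then obtain p where p: "p \<in> closure W" "\<And>z. z \<in> closure W \<Longrightarrow> g z \<le> g p" by auto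
  have "p \<notin> frontier W"
  proof
    assume "p \<in> frontier W"
    then have "norm (h p) \<le> C" by (rule bd)
    moreover have "e * (cmod p)\<^sup>2 \<le> e * R\<^sup>2" using R p(1) e by (intro mult_left_mono power_mono) auto
    ultimately have "g p < norm (h z0)" using gt e by (simp add: g_def)
    also have "\<dots> \<le> g z0" using e by (simp add: g_def)
    finally show False using p(2)[OF z0c] by simp
  qed
  then have pW: "p \<in> W" using p(1) W(1) by (simp add: frontier_def interior_open)
  then obtain r where r: "r > 0" "cball p r \<subseteq> W" using W(1) by (auto simp: open_contains_cball)
  define c where "c t = p + of_real r * cis (2 * pi * t)" for t
  have cW: "c t \<in> W" for t
  proof -
    have "c t \<in> cball p r" using r by (simp add: c_def dist_norm norm_mult)
    then show ?thesis by (rule subsetD[OF r(2)])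
  qed
  have ccont: "continuous_on {0..1} c" unfolding c_def[abs_def] by (intro continuous_intros)
  have hcont: "continuous_on {0..1} (\<lambda>t. h (c t))"
    by (rule continuous_on_compose2[OF cont ccont]) (use cW subsetD[OF closure_subset] in auto)
  \<comment> \<open>The square \<open>(cmod (c t))\<^sup>2\<close> is affine in
    \<open>Re (cnj p * c t)\<close>, so its circle mean follows from the mean value property of a
    linear function; it exceeds \<open>(cmod p)\<^sup>2\<close> by \<open>r\<^sup>2\<close>.\<close>
  have int_c: "integral {0..1} (\<lambda>t. cnj p * c t) = cnj p * p"
    unfolding c_def
    by (rule vector_mean_value[where f' = "\<lambda>_. cnj p"])
      (auto intro!: derivative_eq_intros simp: scaleC_complex_def)
  have int_c: "((\<lambda>t. cnj p * c t) has_integral cnj p * p) {0..1}"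
    unfolding int_c[symmetric]
    by (intro integrable_integral integrable_continuous_real continuous_intros ccont)
  have int_u: "((\<lambda>t. g p - e * (2 * Re (cnj p * c t) - (cmod p)\<^sup>2 + r\<^sup>2)) has_integral
      (g p - e * (2 * Re (cnj p * p) - (cmod p)\<^sup>2 + r\<^sup>2))) {0..1}"
  proof -
    have const: "((\<lambda>t. a) has_integral a) {0..1::real}" for a :: real
      using has_integral_const_real[of a 0 1] by simp
    show ?thesis
      by (intro has_integral_diff has_integral_add has_integral_mult_right const
        has_integral_linear[OF int_c bounded_linear_Re, unfolded o_def])
  qed
  have sq: "(cmod (c t))\<^sup>2 = 2 * Re (cnj p * c t) - (cmod p)\<^sup>2 + r\<^sup>2" for t
  proof -
    have "cmod (c t - p) = r" using r by (simp add: c_def norm_mult)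
    then have "r\<^sup>2 = (Re (c t) - Re p)\<^sup>2 + (Im (c t) - Im p)\<^sup>2" using cmod_power2[of "c t - p"] by simp
    then show ?thesis unfolding cmod_power2 by (simp add: power2_eq_square algebra_simps)
  qed
  have "norm (h p) = norm (integral {0..1} (\<lambda>t. h (c t)))"
    unfolding c_def using mv[OF pW r] by simp
  also have "\<dots> \<le> integral {0..1} (\<lambda>t. g p - e * (2 * Re (cnj p * c t) - (cmod p)\<^sup>2 + r\<^sup>2))"
  proof (rule integral_norm_bound_integral)
    show "(\<lambda>t. h (c t)) integrable_on {0..1}" using hcont by (rule integrable_continuous_real)
    show "(\<lambda>t. g p - e * (2 * Re (cnj p * c t) - (cmod p)\<^sup>2 + r\<^sup>2)) integrable_on {0..1}"
      using int_u by blast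
    fix t
    have "g (c t) \<le> g p" by (intro p(2) subsetD[OF closure_subset cW])
    then show "norm (h (c t)) \<le> g p - e * (2 * Re (cnj p * c t) - (cmod p)\<^sup>2 + r\<^sup>2)"
      unfolding sq[symmetric] g_def by simp
  qed
  also have "\<dots> = g p - e * (2 * Re (cnj p * p) - (cmod p)\<^sup>2 + r\<^sup>2)"
    using int_u by (rule integral_unique)
  also have "Re (cnj p * p) = (cmod p)\<^sup>2"
    unfolding cmod_power2 by (simp add: power2_eq_square)
  finally have "e * r\<^sup>2 \<le> 0" by (simp add: g_def algebra_simps)
  then show False using e r by (simp add: mult_le_0_iff)
qed

section \<open>Algebra of bounded operators, Neumann series and quasinilpotence\<close>

lemma blinfun_eq_iff: "f = g \<longleftrightarrow> (\<forall>x. blinfun_apply f x = blinfun_apply g x)"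
  by (auto intro: blinfun_eqI)

lemma blinfun_compose_id [simp]: "X o\<^sub>L id_blinfun = X" "id_blinfun o\<^sub>L X = X"
  by (simp_all add: blinfun_eq_iff)

lemma complex_linear_op_compose:
  "complex_linear_op X \<Longrightarrow> complex_linear_op Y \<Longrightarrow> complex_linear_op (X o\<^sub>L Y)"
  by (simp add: complex_linear_op_def)

lemma scaleC_blinfun_compose_left: "scaleC c X o\<^sub>L Y = scaleC c (X o\<^sub>L Y)"
  by (rule blinfun_eqI) (simp add: blinfun_apply_scaleC)

lemma scaleC_blinfun_compose_right:
  "complex_linear_op X \<Longrightarrow> X o\<^sub>L scaleC c Y = scaleC c (X o\<^sub>L Y)"
  by (rule blinfun_eqI) (simp add: blinfun_apply_scaleC complex_linear_op_def)

lemma complex_linear_op_id: "complex_linear_op id_blinfun"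
  by (simp add: complex_linear_op_def)

lemma complex_linear_op_scaleC: "complex_linear_op X \<Longrightarrow> complex_linear_op (scaleC c X)"
  by (simp add: complex_linear_op_def blinfun_apply_scaleC scaleC_scaleC mult.commute)

lemma complex_linear_op_add: "complex_linear_op X \<Longrightarrow> complex_linear_op Y \<Longrightarrow> complex_linear_op (X + Y)"
  by (simp add: complex_linear_op_def blinfun.add_left scaleC_add_right)

lemma complex_linear_op_limit:
  fixes X :: "nat \<Rightarrow> 'a::complex_normed_vector \<Rightarrow>\<^sub>L 'a"
  assumes "\<And>n. complex_linear_op (X n)" "X \<longlonglongrightarrow> Y"
  shows "complex_linear_op Y"
  unfolding complex_linear_op_def
proof (intro allI)
  fix c x
  have "(\<lambda>n. blinfun_apply (X n) (scaleC c x)) \<longlonglongrightarrow> blinfun_apply Y (scaleC c x)"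
    by (intro tendsto_intros assms)
  moreover have "(\<lambda>n. scaleC c (blinfun_apply (X n) x)) \<longlonglongrightarrow> scaleC c (blinfun_apply Y x)"
    by (intro scaleC.tendsto tendsto_intros assms)
  ultimately show "blinfun_apply Y (scaleC c x) = scaleC c (blinfun_apply Y x)"
    using assms(1) LIMSEQ_unique by (simp add: complex_linear_op_def)
qed

primrec blinfun_power :: "('a::real_normed_vector \<Rightarrow>\<^sub>L 'a) \<Rightarrow> nat \<Rightarrow> ('a \<Rightarrow>\<^sub>L 'a)"
  where "blinfun_power L 0 = id_blinfun"
  | "blinfun_power L (Suc n) = L o\<^sub>L blinfun_power L n"

lemma blinfun_power_Suc2: "blinfun_power L (Suc n) = blinfun_power L n o\<^sub>L L"
  by (induction n) (simp_all add: blinfun_eq_iff)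

lemma complex_linear_op_power: "complex_linear_op L \<Longrightarrow> complex_linear_op (blinfun_power L n)"
  by (induction n) (auto intro: complex_linear_op_id complex_linear_op_compose)

lemma norm_blinfun_power_le: "norm (blinfun_power L n) \<le> norm (L :: 'a::real_normed_vector \<Rightarrow>\<^sub>L 'a) ^ n"
proof (induction n)
  case 0
  show ?case by (simp add: norm_blinfun_id_le)
next
  case (Suc n)
  have "norm (blinfun_power L (Suc n)) \<le> norm L * norm (blinfun_power L n)"
    using norm_blinfun_compose by simp
  also have "\<dots> \<le> norm L * norm L ^ n" by (rule mult_left_mono[OF Suc]) simp
  finally show ?case by simp
qed

text \<open>For |c| > norm L the Neumann series of c^-(n+1) L^n converges to an inverse of c - L;
  the partial sums telescope from both sides. The bound makes the supremum in
  \<open>op_spectral_radius\<close> an honest upper bound, so spectral radius 0 excludes every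
  nonzero spectral value.\<close>

lemma op_spectrum_bounded:
  fixes L :: "'a::complex_banach \<Rightarrow>\<^sub>L 'a"
  assumes L: "complex_linear_op L" and c: "c \<in> op_spectrum L"
  shows "cmod c \<le> norm L"
proof (rule ccontr)
  assume "\<not> cmod c \<le> norm L"
  then have gt: "norm L < cmod c" by simp
  then have c0: "c \<noteq> 0" by auto
  define q where "q = norm L / cmod c"
  have q: "0 \<le> q" "q < 1" using gt c0 by (auto simp: q_def)
  define u where "u n = scaleC (inverse c ^ Suc n) (blinfun_power L n)" for n
  have un: "norm (u n) \<le> inverse (cmod c) * q ^ n" for n
  proof -
    have "norm (u n) = inverse (cmod c) * (inverse (cmod c) ^ n * norm (blinfun_power L n))"
      by (simp add: u_def norm_scaleC norm_mult norm_power norm_inverse)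
    also have "\<dots> \<le> inverse (cmod c) * (inverse (cmod c) ^ n * norm L ^ n)"
      by (intro mult_left_mono norm_blinfun_power_le) auto
    finally show ?thesis by (simp add: q_def divide_inverse power_mult_distrib mult.commute)
  qed
  have "summable (\<lambda>n. inverse (cmod c) * q ^ n)" using q by (intro summable_mult summable_geometric) simp
  then have "summable u" by (rule summable_comparison_test'[where N = 0]) (rule un)
  then have lim: "(\<lambda>N. \<Sum>n<N. u n) \<longlonglongrightarrow> suminf u" by (rule summable_LIMSEQ)
  define R where "R = suminf u"
  have "u \<longlonglongrightarrow> 0" using \<open>summable u\<close> by (rule summable_LIMSEQ_zero)
  then have u0: "(\<lambda>n. scaleC c (u n)) \<longlonglongrightarrow> 0"
    using scaleC.tendsto[OF tendsto_const, of u 0 _ c] by (simp add: scaleC.zero_right)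
  have c_Suc: "c * inverse c ^ Suc (Suc n) = inverse c ^ Suc n" for n using c0 by simp
  have cu: "scaleC c (u (Suc n)) = L o\<^sub>L u n" "scaleC c (u (Suc n)) = u n o\<^sub>L L" for n
    unfolding u_def scaleC_scaleC c_Suc scaleC_blinfun_compose_right[OF L] scaleC_blinfun_compose_left
    by (simp, simp only: blinfun_power_Suc2)
  have clin: "complex_linear_op (\<Sum>n<N. u n)" for N
  proof (induction N)
    case (Suc N)
    then show ?case
      by (simp add: complex_linear_op_add u_def complex_linear_op_scaleC complex_linear_op_power L)
  qed (simp add: complex_linear_op_def scaleC.zero_right)
  have left: "(scaleC c id_blinfun - L) o\<^sub>L (\<Sum>n<N. u n) = id_blinfun - scaleC c (u N)"
    and right: "(\<Sum>n<N. u n) o\<^sub>L (scaleC c id_blinfun - L) = id_blinfun - scaleC c (u N)" for N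
  proof -
    have u00: "scaleC c (u 0) = id_blinfun" using c0 by (simp add: u_def scaleC_scaleC)
    have id: "scaleC c id_blinfun o\<^sub>L X = scaleC c X" "complex_linear_op X \<Longrightarrow> X o\<^sub>L scaleC c id_blinfun = scaleC c X"
      for X :: "'a \<Rightarrow>\<^sub>L 'a"
      by (auto intro!: blinfun_eqI simp: blinfun_apply_scaleC complex_linear_op_def)
    show "(scaleC c id_blinfun - L) o\<^sub>L (\<Sum>n<N. u n) = id_blinfun - scaleC c (u N)"
      by (induction N) (simp_all add: u00 cu(1) id blinfun_compose.add_right blinfun_compose.diff_left
        blinfun_compose.zero_right)
    show "(\<Sum>n<N. u n) o\<^sub>L (scaleC c id_blinfun - L) = id_blinfun - scaleC c (u N)"
    proof (induction N)
      case (Suc N)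
      have "u N o\<^sub>L (scaleC c id_blinfun - L) = scaleC c (u N) - (u N o\<^sub>L L)"
        by (subst blinfun_compose.diff_right, subst id(2))
          (simp_all add: u_def complex_linear_op_scaleC complex_linear_op_power L)
      then show ?case using Suc by (simp add: cu(2) blinfun_compose.add_left)
    qed (simp add: u00 blinfun_compose.zero_left)
  qed
  have limI: "(\<lambda>N. id_blinfun - scaleC c (u N)) \<longlonglongrightarrow> id_blinfun"
    using tendsto_diff[OF tendsto_const u0, of id_blinfun] by simp
  have "R o\<^sub>L (scaleC c id_blinfun - L) = id_blinfun"
    using blinfun_compose.tendsto[OF lim tendsto_const, of "scaleC c id_blinfun - L"] limI
    unfolding right R_def by (rule LIMSEQ_unique)
  moreover have "(scaleC c id_blinfun - L) o\<^sub>L R = id_blinfun"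
    using blinfun_compose.tendsto[OF tendsto_const lim, of "scaleC c id_blinfun - L"] limI
    unfolding left R_def by (rule LIMSEQ_unique)
  moreover have "complex_linear_op R"
    unfolding R_def by (rule complex_linear_op_limit[OF clin lim])
  ultimately show False using c unfolding op_spectrum_def by blast
qed

lemma op_spectral_radius_upper:
  fixes L :: "'a::complex_banach \<Rightarrow>\<^sub>L 'a"
  assumes "complex_linear_op L" "c \<in> op_spectrum L"
  shows "cmod c \<le> op_spectral_radius L"
  unfolding op_spectral_radius_def
  using assms op_spectrum_bounded by (intro cSUP_upper) (auto intro!: bdd_aboveI)

text \<open>For \<open>w \<noteq> 0\<close> the point \<open>inverse w\<close> lies outside the
  spectrum, and 1 - w L is w times (\<open>inverse w\<close> - L).\<close>

lemma quasinilpotent_inverse_exists: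
  fixes L :: "'a::complex_banach \<Rightarrow>\<^sub>L 'a"
  assumes L: "complex_linear_op L" and qn: "op_spectral_radius L = 0"
  shows "\<exists>S. complex_linear_op S \<and> S o\<^sub>L (id_blinfun - scaleC w L) = id_blinfun \<and>
    (id_blinfun - scaleC w L) o\<^sub>L S = id_blinfun"
proof (cases "w = 0")
  case True
  then show ?thesis
    by (intro exI[of _ id_blinfun]) (simp add: complex_linear_op_id scaleC.zero_left)
next
  case False
  have "inverse w \<notin> op_spectrum L"
    using op_spectral_radius_upper[OF L, of "inverse w"] qn False by auto
  then obtain R where R: "complex_linear_op R" "R o\<^sub>L (scaleC (inverse w) id_blinfun - L) = id_blinfun"
    "(scaleC (inverse w) id_blinfun - L) o\<^sub>L R = id_blinfun"
    by (auto simp: op_spectrum_def)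
  have eq: "id_blinfun - scaleC w L = scaleC w (scaleC (inverse w) id_blinfun - L)"
    using False by (simp add: scaleC.diff_right scaleC_scaleC)
  have "complex_linear_op (scaleC (inverse w) R)" by (rule complex_linear_op_scaleC[OF R(1)])
  moreover have "scaleC (inverse w) R o\<^sub>L (id_blinfun - scaleC w L) = id_blinfun"
    unfolding eq scaleC_blinfun_compose_left scaleC_blinfun_compose_right[OF R(1)] R(2)
    using False by (simp add: scaleC_scaleC)
  moreover have "(id_blinfun - scaleC w L) o\<^sub>L scaleC (inverse w) R = id_blinfun"
  proof -
    have "complex_linear_op (scaleC (inverse w) id_blinfun - L)"
      using complex_linear_op_add[OF complex_linear_op_scaleC[OF complex_linear_op_id] complex_linear_op_scaleC[OF L, of "- 1"]]
      by (simp add: scaleC.minus_left)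
    then show ?thesis
      unfolding eq scaleC_blinfun_compose_left using R(3) False
      by (simp add: scaleC_blinfun_compose_right scaleC_scaleC)
  qed
  ultimately show ?thesis by blast
qed

text \<open>The inverse \<open>S w\<close> of 1 - w L is entire and has Taylor coefficients L^n. In
  place of a Cauchy estimate, the mean value property is applied to
  \<open>S w o\<^sub>L blinfun_power L n\<close>, whose value at 0 is L^n and which on the circle of
  radius \<open>r\<close> is the Taylor remainder over w^n. The resulting recursion costs the factor
  2^n, harmless because \<open>r\<close> is arbitrary.\<close>

lemma quasinilpotent_power_bound:
  fixes L :: "'a::complex_banach \<Rightarrow>\<^sub>L 'a"
  assumes L: "complex_linear_op L" and qn: "op_spectral_radius L = 0"
    and r: "r > 0"
  shows "\<exists>M. \<forall>n. norm (blinfun_power L n) * r ^ n \<le> M * 2 ^ n"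
proof -
  obtain S where S: "\<And>w. complex_linear_op (S w)"
    "\<And>w. S w o\<^sub>L (id_blinfun - scaleC w L) = id_blinfun"
    "\<And>w. (id_blinfun - scaleC w L) o\<^sub>L S w = id_blinfun"
    using quasinilpotent_inverse_exists[OF L qn] by metis
  have resolvent: "S v - S w = scaleC (v - w) ((S v o\<^sub>L L) o\<^sub>L S w)" for v w
  proof -
    have "S v = S v o\<^sub>L ((id_blinfun - scaleC w L) o\<^sub>L S w)" by (simp add: S(3))
    moreover have "S w = (S v o\<^sub>L (id_blinfun - scaleC v L)) o\<^sub>L S w" by (simp add: S(2))
    ultimately have "S v - S w = (S v o\<^sub>L ((id_blinfun - scaleC w L) o\<^sub>L S w)) -
        ((S v o\<^sub>L (id_blinfun - scaleC v L)) o\<^sub>L S w)" by (rule arg_cong2[where f = minus])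
    also have "\<dots> = (S v o\<^sub>L scaleC (v - w) L) o\<^sub>L S w"
      by (rule blinfun_eqI)
        (simp add: blinfun.diff_left blinfun.diff_right blinfun_apply_scaleC scaleC.diff_left)
    finally show ?thesis
      by (simp add: scaleC_blinfun_compose_right[OF S(1)] scaleC_blinfun_compose_left)
  qed
  have isCont: "isCont S w" for w
  proof -
    let ?s = "norm L * norm (S w)"
    have diff: "norm (S v - S w) \<le> cmod (v - w) * norm (S v) * ?s" for v
    proof -
      have "norm ((S v o\<^sub>L L) o\<^sub>L S w) \<le> norm (S v) * norm L * norm (S w)"
        by (rule order.trans[OF norm_blinfun_compose mult_right_mono[OF norm_blinfun_compose norm_ge_zero]])
      from mult_left_mono[OF this norm_ge_zero[of "v - w"]]
      show ?thesis by (simp add: resolvent[of v w] norm_scaleC mult_ac)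
    qed
    \<comment> \<open>The resolvent identity bounds \<open>S v - S w\<close> by a quantity
      containing \<open>norm (S v)\<close> itself. For \<open>v\<close> this close to
      \<open>w\<close> that term can be absorbed, giving
      \<open>norm (S v) \<le> 2 * norm (S w)\<close>.\<close>
    have "eventually (\<lambda>v. cmod (v - w) * ?s < 1 / 2) (at w)"
    proof -
      have "((\<lambda>v. cmod (v - w) * ?s) \<longlongrightarrow> cmod (w - w) * ?s) (at w)" by (intro tendsto_intros)
      from order_tendstoD(2)[OF this, of "1/2"] show ?thesis by simp
    qed
    then have ev: "eventually (\<lambda>v. norm (S v - S w) \<le> cmod (v - w) * (2 * norm (S w)) * ?s) (at w)"
    proof eventually_elim
      case (elim v)
      have "norm (S v) \<le> norm (S w) + norm (S v - S w)" using norm_triangle_sub[of "S v" "S w"] by simp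
      also have "\<dots> \<le> norm (S w) + norm (S v) * (cmod (v - w) * ?s)"
        using diff[of v] by (simp add: mult_ac)
      also have "\<dots> \<le> norm (S w) + norm (S v) * (1 / 2)"
        using elim by (intro add_left_mono mult_left_mono) auto
      finally have "norm (S v) \<le> 2 * norm (S w)" by simp
      then have "cmod (v - w) * norm (S v) * ?s \<le> cmod (v - w) * (2 * norm (S w)) * ?s"
        by (intro mult_right_mono mult_left_mono) auto
      then show ?case using diff[of v] by linarith
    qed
    have "((\<lambda>v. cmod (v - w) * (2 * norm (S w)) * ?s) \<longlongrightarrow> cmod (w - w) * (2 * norm (S w)) * ?s) (at w)"
      by (intro tendsto_intros)
    then have "((\<lambda>v. cmod (v - w) * (2 * norm (S w)) * ?s) \<longlongrightarrow> 0) (at w)"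
      by (simp only: diff_self norm_zero mult_zero_left)
    from Lim_null_comparison[OF ev this] show ?thesis
      unfolding isCont_def by (rule LIM_zero_cancel)
  qed
  then have Scont: "continuous_on A (\<lambda>x. S (g x))" if "continuous_on A g" for A :: "'x::topological_space set" and g
    using that by (intro continuous_on_compose2[OF continuous_at_imp_continuous_on[of UNIV S]]) auto
  have deriv: "(S has_derivative (\<lambda>h. scaleC h ((S w o\<^sub>L L) o\<^sub>L S w))) (at w)" for w
    unfolding has_derivative_at
  proof (intro conjI scaleC.bounded_linear_left)
    let ?D = "\<lambda>h. S (w + h) - S w - scaleC h ((S w o\<^sub>L L) o\<^sub>L S w)"
    have eq: "?D h = scaleC h (((S (w + h) - S w) o\<^sub>L L) o\<^sub>L S w)" for h
    proof -
      have r: "S (w + h) - S w = scaleC h ((S (w + h) o\<^sub>L L) o\<^sub>L S w)" using resolvent[of "w + h" w] by simp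
      have "?D h = scaleC h (((S (w + h) o\<^sub>L L) o\<^sub>L S w) - ((S w o\<^sub>L L) o\<^sub>L S w))"
        unfolding r scaleC.diff_right ..
      then show ?thesis by (simp only: blinfun_compose.diff_left)
    qed
    have "((\<lambda>h. norm (((S (w + h) - S w) o\<^sub>L L) o\<^sub>L S w)) \<longlongrightarrow> 0) (at 0)"
    proof -
      have "((\<lambda>h. S (w + h)) \<longlongrightarrow> S w) (at 0)" using isCont[of w] by (simp add: isCont_iff)
      then have "((\<lambda>h. norm (((S (w + h) - S w) o\<^sub>L L) o\<^sub>L S w)) \<longlongrightarrow> norm (((S w - S w) o\<^sub>L L) o\<^sub>L S w)) (at 0)"
        by (intro tendsto_intros blinfun_compose.tendsto)
      then show ?thesis by (simp add: blinfun_compose.zero_left)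
    qed
    moreover have "\<forall>\<^sub>F h in at 0. norm (((S (w + h) - S w) o\<^sub>L L) o\<^sub>L S w) = norm (?D h) / norm h"
      unfolding eventually_at_filter by (rule always_eventually) (unfold eq, simp add: norm_scaleC)
    ultimately show "((\<lambda>h. norm (?D h) / norm h) \<longlongrightarrow> 0) (at 0)"
      by (rule Lim_transform_eventually)
  qed
  have S0: "S 0 = id_blinfun" using S(2)[of 0] by (simp add: scaleC.zero_left)
  have step: "S w = id_blinfun + scaleC w (S w o\<^sub>L L)" for w
    using S(2)[of w] by (simp add: blinfun_compose.diff_right scaleC_blinfun_compose_right[OF S(1)] algebra_simps)
  have expand: "S w = (\<Sum>k<n. scaleC (w ^ k) (blinfun_power L k)) + scaleC (w ^ n) (S w o\<^sub>L blinfun_power L n)" for w n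
  proof (induction n)
    case (Suc n)
    have "S w o\<^sub>L blinfun_power L n = blinfun_power L n + scaleC w (S w o\<^sub>L blinfun_power L (Suc n))"
      by (subst step) (simp add: blinfun_compose.add_left scaleC_blinfun_compose_left blinfun_eq_iff
          blinfun.add_left blinfun_apply_scaleC)
    then show ?case using Suc by (simp add: scaleC.add_right scaleC_scaleC mult.commute add.assoc)
  qed simp
  have "compact (S ` sphere 0 r)"
    by (intro compact_continuous_image Scont continuous_intros compact_sphere)
  then obtain M where M: "M > 0" "\<And>w. cmod w = r \<Longrightarrow> norm (S w) \<le> M"
    using compact_imp_bounded[of "S ` sphere 0 r"] by (auto simp: bounded_pos)
  define a where "a n = norm (blinfun_power L n) * r ^ n" for n
  have a: "a n \<le> M + (\<Sum>k<n. a k)" for n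
  proof -
    \<comment> \<open>Each earlier coefficient contributes at most \<open>a k\<close> to the
      remainder on the circle; hence the recursion with \<open>M\<close> and all previous
      terms.\<close>
    let ?h = "\<lambda>w. S w o\<^sub>L blinfun_power L n"
    have bd: "norm (?h w) \<le> (M + (\<Sum>k<n. a k)) / r ^ n" if w: "cmod w = r" for w
    proof -
      have "scaleC (w ^ n) (?h w) = S w - (\<Sum>k<n. scaleC (w ^ k) (blinfun_power L k))"
        using expand[of w n] by (simp add: algebra_simps)
      then have "norm (scaleC (w ^ n) (?h w)) = norm (S w - (\<Sum>k<n. scaleC (w ^ k) (blinfun_power L k)))"
        by (rule arg_cong)
      then have "r ^ n * norm (?h w) = norm (S w - (\<Sum>k<n. scaleC (w ^ k) (blinfun_power L k)))"
        by (simp only: norm_scaleC norm_power w)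
      also have "\<dots> \<le> norm (S w) + norm (\<Sum>k<n. scaleC (w ^ k) (blinfun_power L k))"
        by (rule norm_triangle_ineq4)
      also have "\<dots> \<le> M + (\<Sum>k<n. a k)"
        by (intro add_mono M(2) w order.trans[OF norm_sum] sum_mono)
          (simp add: norm_scaleC norm_power w a_def mult.commute)
      finally show ?thesis using r by (simp add: field_simps)
    qed
    have "integral {0..1} (\<lambda>t. ?h (0 + of_real r * cis (2 * pi * t))) = ?h 0"
    proof (rule vector_mean_value)
      show "((\<lambda>w. ?h w) has_derivative (\<lambda>h. scaleC h (((S w o\<^sub>L L) o\<^sub>L S w) o\<^sub>L blinfun_power L n))) (at w)" for w
        using bounded_linear.has_derivative[OF blinfun_compose.bounded_linear_left deriv]
        by (simp add: scaleC_blinfun_compose_left)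
      show "continuous_on UNIV (\<lambda>w. ((S w o\<^sub>L L) o\<^sub>L S w) o\<^sub>L blinfun_power L n)"
        by (intro blinfun_compose.continuous_on Scont continuous_intros)
    qed
    moreover have "norm (integral {0..1} (\<lambda>t. ?h (0 + of_real r * cis (2 * pi * t)))) \<le> (M + (\<Sum>k<n. a k)) / r ^ n"
      using r by (intro norm_integral_unit_interval_le bd blinfun_compose.continuous_on Scont continuous_intros)
        (simp add: norm_mult)
    ultimately have "norm (blinfun_power L n) \<le> (M + (\<Sum>k<n. a k)) / r ^ n" by (simp add: S0)
    then show ?thesis using r by (simp add: a_def field_simps)
  qed
  have "a n \<le> M * 2 ^ n" for n
  proof (induction n rule: less_induct)
    case (less n)
    have "(\<Sum>k<n. a k) \<le> (\<Sum>k<n. M * 2 ^ k)" by (rule sum_mono) (simp add: less)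
    then have "a n \<le> M + (\<Sum>k<n. M * 2 ^ k)" using a[of n] by linarith
    also have "\<dots> = M + M * (2 ^ n - 1)" by (simp add: sum_distrib_left[symmetric] geometric_sum)
    finally show ?case by (simp add: algebra_simps)
  qed
  then show ?thesis unfolding a_def by blast
qed

section \<open>Lower bounds for the generator of an analytic semigroup\<close>

lemma scaleR_scaleC: "r *\<^sub>R scaleC a x = scaleC (of_real r * a) x"
  by (simp flip: scaleC_of_real add: scaleC_scaleC)

text \<open>Replaces the argument by a linear inequality, from which openness of the sector and
  closure under addition are immediate.\<close>

lemma open_sector_iff_tan:
  assumes "0 < \<gamma>" "\<gamma> < pi / 2"
  shows "z \<in> open_sector \<gamma> \<longleftrightarrow> Re z > 0 \<and> \<bar>Im z\<bar> < tan \<gamma> * Re z"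
proof (cases "Re z > 0")
  case True
  have \<gamma>: "arctan (tan \<gamma>) = \<gamma>" using assms by (intro arctan_tan) auto
  have "\<bar>Arg z\<bar> < \<gamma> \<longleftrightarrow> arctan (- tan \<gamma>) < arctan (Im z / Re z) \<and> arctan (Im z / Re z) < arctan (tan \<gamma>)"
    using arg_conv_arctan[OF True] by (auto simp: arctan_minus \<gamma>)
  also have "\<dots> \<longleftrightarrow> \<bar>Im z\<bar> < tan \<gamma> * Re z"
    unfolding arctan_less_iff using True by (auto simp: field_simps)
  finally show ?thesis using True by (simp add: open_sector_def)
qed (simp add: open_sector_def)

lemma open_open_sector: "0 < \<gamma> \<Longrightarrow> \<gamma> < pi / 2 \<Longrightarrow> open (open_sector \<gamma>)"
proof -
  assume \<gamma>: "0 < \<gamma>" "\<gamma> < pi / 2"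
  have "open_sector \<gamma> = {z. Re z > 0} \<inter> {z. \<bar>Im z\<bar> < tan \<gamma> * Re z}"
    using open_sector_iff_tan[OF \<gamma>] by auto
  then show ?thesis by (auto intro!: open_Int open_Collect_less continuous_intros)
qed

lemma open_sector_add:
  assumes "0 < \<gamma>" "\<gamma> < pi / 2" "s \<in> open_sector \<gamma>" "t \<in> open_sector \<gamma>"
  shows "s + t \<in> open_sector \<gamma>"
proof -
  have "\<bar>Im s + Im t\<bar> \<le> \<bar>Im s\<bar> + \<bar>Im t\<bar>" by simp
  then show ?thesis
    using assms(3,4) unfolding open_sector_iff_tan[OF assms(1,2)] by (simp add: distrib_left)
qed

lemma open_sector_of_real: "0 < \<gamma> \<Longrightarrow> 0 < t \<Longrightarrow> of_real t \<in> open_sector \<gamma>"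
  by (simp add: open_sector_def)

text \<open>The two arguments stay within \<alpha> < pi / 2 when added, so no multiple of 2 pi
  intervenes. This places \<open>u * \<xi>\<close> in the domain of the semigroup for \<xi> in
  \<open>K\<close>.\<close>

lemma open_sector_times:
  assumes "0 < \<beta>" "\<beta> < \<alpha>" "\<alpha> < pi / 2" and u: "u \<in> open_sector (\<alpha> - \<beta>)" and c: "c \<in> closed_sector \<beta>"
  shows "u * c \<in> open_sector \<alpha>"
proof -
  have u': "Re u > 0" "\<bar>Arg u\<bar> < \<alpha> - \<beta>" and c': "Re c > 0" "\<bar>Arg c\<bar> \<le> \<beta>"
    using u c by (auto simp: open_sector_def closed_sector_def)
  have "u \<noteq> 0" "c \<noteq> 0" using u' c' by auto
  moreover have "Arg u + Arg c \<in> {-pi<..pi}" using u' c' assms(1-3) by auto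
  ultimately have Arg: "Arg (u * c) = Arg u + Arg c" by (intro Arg_times)
  then have lt: "\<bar>Arg (u * c)\<bar> < \<alpha>" using u' c' by linarith
  have "cos (Arg (u * c)) > 0" using lt assms(3) by (intro cos_gt_zero_pi) auto
  then have "Re (rcis (cmod (u * c)) (Arg (u * c))) > 0"
    using \<open>u \<noteq> 0\<close> \<open>c \<noteq> 0\<close> by (simp add: norm_mult)
  then have "Re (u * c) > 0" unfolding rcis_cmod_Arg .
  with lt show ?thesis by (simp add: open_sector_def)
qed

lemma open_sector_scale: "0 < s \<Longrightarrow> z \<in> open_sector \<gamma> \<Longrightarrow> z * of_real s \<in> open_sector \<gamma>"
  by (auto simp: open_sector_def)

text \<open>Fubini moves the circle mean inside the integral over \<open>s\<close>, where it acts on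
  the scalar function \<open>\<phi> s\<close> alone. This spares any holomorphy argument for the
  vector-valued integral.\<close>

lemma mean_value_integral:
  fixes \<phi> :: "real \<Rightarrow> complex \<Rightarrow> complex" and x :: "real \<Rightarrow> 'b::complex_banach"
  assumes hol: "\<And>s. \<phi> s holomorphic_on UNIV" and cont: "continuous_on UNIV (\<lambda>(s, z). \<phi> s z)"
    and x: "continuous_on {0..n} x"
  shows "integral {0..1} (\<lambda>t. integral {0..n} (\<lambda>s. scaleC (\<phi> s (z + of_real r * cis (2 * pi * t))) (x s))) =
    integral {0..n} (\<lambda>s. scaleC (\<phi> s z) (x s))"
proof -
  define c where "c t = z + of_real r * cis (2 * pi * t)" for t
  have c: "continuous_on S (\<lambda>x. c (g x))" if "continuous_on S g" for S :: "'x::topological_space set" and g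
    unfolding c_def by (intro continuous_on_add continuous_on_mult continuous_on_const continuous_on_cis
      continuous_on_mult_left that)
  have \<phi>c: "continuous_on S (\<lambda>x. \<phi> (g x) (h x))" if "continuous_on S g" "continuous_on S h"
    for S :: "'x::topological_space set" and g h
  proof -
    have "continuous_on S ((\<lambda>(s, z). \<phi> s z) \<circ> (\<lambda>x. (g x, h x)))"
      by (rule continuous_on_compose[OF continuous_on_Pair[OF that] continuous_on_subset[OF cont subset_UNIV]])
    then show ?thesis by (simp only: o_def case_prod_conv)
  qed
  have mv: "integral {0..1} (\<lambda>t. \<phi> s (c t)) = \<phi> s z" for s
    unfolding c_def
  proof (rule vector_mean_value[where f = "\<phi> s" and f' = "deriv (\<phi> s)"])
    show "(\<phi> s has_derivative (\<lambda>h. scaleC h (deriv (\<phi> s) z))) (at z)" for z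
    proof -
      have "(\<lambda>h. scaleC h (deriv (\<phi> s) z)) = (*) (deriv (\<phi> s) z)"
        by (simp add: fun_eq_iff scaleC_complex_def)
      then show ?thesis
        using holomorphic_derivI[OF hol open_UNIV, of z s] by (simp add: has_field_derivative_def)
    qed
    show "continuous_on UNIV (deriv (\<phi> s))"
      by (intro holomorphic_on_imp_continuous_on holomorphic_deriv[OF hol] open_UNIV)
  qed
  have "integral (cbox 0 1) (\<lambda>t. integral (cbox 0 n) (\<lambda>s. scaleC (\<phi> s (c t)) (x s))) =
      integral (cbox 0 n) (\<lambda>s. integral (cbox 0 1) (\<lambda>t. scaleC (\<phi> s (c t)) (x s)))"
  proof (rule integral_swap_continuous)
    show "continuous_on (cbox (0, 0) (1, n)) (\<lambda>(t, s). scaleC (\<phi> s (c t)) (x s))"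
      unfolding case_prod_beta
      by (intro continuous_intros \<phi>c c continuous_on_compose2[OF x]) auto
  qed
  moreover have "integral {0..1} (\<lambda>t. scaleC (\<phi> s (c t)) (x s)) = scaleC (\<phi> s z) (x s)" for s
  proof -
    have "(\<lambda>t. \<phi> s (c t)) integrable_on {0..1}"
      by (intro integrable_continuous_real \<phi>c c continuous_intros)
    from integral_linear[OF this scaleC.bounded_linear_left, of "x s"]
    show ?thesis by (simp add: o_def mv)
  qed
  ultimately show ?thesis by (simp add: c_def)
qed

section \<open>Calculus of a bounded analytic semigroup along rays\<close>

locale bounded_analytic_semigroup =
  fixes \<alpha> :: real and T :: "complex \<Rightarrow> ('a::complex_banach \<Rightarrow>\<^sub>L 'a)"
  assumes \<alpha>: "0 < \<alpha>" "\<alpha> < pi / 2"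
    and semigroup: "analytic_semigroup \<alpha> T"
    and bdd: "bounded (T ` open_sector \<alpha>)"
begin

abbreviation "S \<equiv> open_sector \<alpha>"

lemma open_S: "open S" by (rule open_open_sector[OF \<alpha>])

lemmas S_add = open_sector_add[OF \<alpha>]

lemma S_of_real [simp]: "0 < t \<Longrightarrow> of_real t \<in> S"
  by (rule open_sector_of_real[OF \<alpha>(1)])

lemma T_linear: "t \<in> S \<Longrightarrow> complex_linear_op (T t)"
  and T_add: "s \<in> S \<Longrightarrow> t \<in> S \<Longrightarrow> T (s + t) = T s o\<^sub>L T t"
  using semigroup by (auto simp: analytic_semigroup_def)

lemma T_scaleC: "t \<in> S \<Longrightarrow> blinfun_apply (T t) (scaleC c x) = scaleC c (blinfun_apply (T t) x)"
  using T_linear by (simp add: complex_linear_op_def)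

text \<open>Stands for A T(t), a bounded operator for every \<open>t\<close> in the sector, so that
  the domain of A never has to be discussed.\<close>

definition D :: "complex \<Rightarrow> ('a \<Rightarrow>\<^sub>L 'a)"
  where "D t = (SOME D. (T has_derivative (\<lambda>h. scaleC h D)) (at t))"

lemma has_derivative_T: "t \<in> S \<Longrightarrow> (T has_derivative (\<lambda>h. scaleC h (D t))) (at t)"
  unfolding D_def using semigroup
  by (intro someI_ex[of "\<lambda>D. (T has_derivative (\<lambda>h. scaleC h D)) (at t)"])
    (auto simp: analytic_semigroup_def vector_analytic_on_def)

lemma continuous_on_T: "continuous_on S T"
  by (rule has_derivative_continuous_on) (rule has_derivative_at_withinI[OF has_derivative_T])

lemma continuous_on_T_compose:
  "continuous_on X g \<Longrightarrow> (\<And>x. x \<in> X \<Longrightarrow> g x \<in> S) \<Longrightarrow> continuous_on X (\<lambda>x. T (g x))"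
  by (rule continuous_on_compose2[OF continuous_on_T]) auto

text \<open>The semigroup law is differentiated in each of its two variables; comparing with the
  derivative of the shifted \<open>T\<close> gives one identity each.\<close>

lemma D_add:
  assumes "s \<in> S" "t \<in> S"
  shows "D (s + t) = T s o\<^sub>L D t" "D (s + t) = D s o\<^sub>L T t"
proof -
  have shift: "((\<lambda>x. x + d) has_derivative (\<lambda>h. h)) (at a)" for a d :: complex
    by (auto intro!: derivative_eq_intros)
  have T': "((\<lambda>x. T (x + d)) has_derivative (\<lambda>h. scaleC h (D (a + d)))) (at a)" if "a + d \<in> S" for a d
    using has_derivative_compose[OF shift has_derivative_T[OF that]] .
  have 1: "((\<lambda>x. T s o\<^sub>L T x) has_derivative (\<lambda>h. T s o\<^sub>L scaleC h (D t))) (at t)"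
    by (rule bounded_linear.has_derivative[OF blinfun_compose.bounded_linear_right has_derivative_T[OF assms(2)]])
  have 2: "((\<lambda>x. T x o\<^sub>L T t) has_derivative (\<lambda>h. scaleC h (D s) o\<^sub>L T t)) (at s)"
    by (rule bounded_linear.has_derivative[OF blinfun_compose.bounded_linear_left has_derivative_T[OF assms(1)]])
  have "((\<lambda>x. T (x + s)) has_derivative (\<lambda>h. T s o\<^sub>L scaleC h (D t))) (at t)"
    by (rule has_derivative_transform_within_open[OF 1 open_S assms(2)])
      (simp add: T_add[OF assms(1)] add.commute[of _ s])
  moreover have "((\<lambda>x. T (x + s)) has_derivative (\<lambda>h. scaleC h (D (t + s)))) (at t)"
    using T'[of t s] S_add[OF assms(2,1)] by simp
  ultimately have "(\<lambda>h. scaleC h (D (t + s))) = (\<lambda>h. T s o\<^sub>L scaleC h (D t))"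
    by (rule has_derivative_unique[rotated])
  from fun_cong[OF this, of 1] show "D (s + t) = T s o\<^sub>L D t" by (simp add: add.commute)
  have "((\<lambda>x. T (x + t)) has_derivative (\<lambda>h. scaleC h (D s) o\<^sub>L T t)) (at s)"
    by (rule has_derivative_transform_within_open[OF 2 open_S assms(1)]) (simp add: T_add[OF _ assms(2)])
  moreover have "((\<lambda>x. T (x + t)) has_derivative (\<lambda>h. scaleC h (D (s + t)))) (at s)"
    using T'[of s t] S_add[OF assms] by simp
  ultimately have "(\<lambda>h. scaleC h (D (s + t))) = (\<lambda>h. scaleC h (D s) o\<^sub>L T t)"
    by (rule has_derivative_unique[rotated])
  from fun_cong[OF this, of 1] show "D (s + t) = D s o\<^sub>L T t" by simp
qed

lemma D_scaleC:
  assumes "t \<in> S"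
  shows "blinfun_apply (D t) (scaleC c x) = scaleC c (blinfun_apply (D t) x)"
proof -
  have 1: "((\<lambda>t. blinfun_apply (T t) y) has_derivative (\<lambda>h. scaleC h (blinfun_apply (D t) y))) (at t)" for y
    using bounded_linear.has_derivative[OF blinfun.bounded_linear_left has_derivative_T[OF assms]]
    by (simp add: blinfun_apply_scaleC)
  have "((\<lambda>t. scaleC c (blinfun_apply (T t) x)) has_derivative (\<lambda>h. scaleC h (blinfun_apply (D t) (scaleC c x)))) (at t)"
    by (rule has_derivative_transform_within_open[OF 1 open_S assms]) (rule T_scaleC)
  moreover have "((\<lambda>t. scaleC c (blinfun_apply (T t) x)) has_derivative
      (\<lambda>h. scaleC c (scaleC h (blinfun_apply (D t) x)))) (at t)"
    by (rule bounded_linear.has_derivative[OF bounded_linear_scaleC_right 1])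
  ultimately have "(\<lambda>h. scaleC h (blinfun_apply (D t) (scaleC c x))) = (\<lambda>h. scaleC c (scaleC h (blinfun_apply (D t) x)))"
    by (rule has_derivative_unique)
  from fun_cong[OF this, of 1] show ?thesis by simp
qed

definition M :: real
  where "M = (SOME M. 0 < M \<and> (\<forall>t\<in>S. norm (T t) \<le> M))"

lemma M: "0 < M" "\<And>t. t \<in> S \<Longrightarrow> norm (T t) \<le> M"
proof -
  have "\<exists>M>0. \<forall>t\<in>S. norm (T t) \<le> M" using bdd by (auto simp: bounded_pos)
  then have "0 < M \<and> (\<forall>t\<in>S. norm (T t) \<le> M)"
    unfolding M_def by (rule someI_ex[of "\<lambda>M. 0 < M \<and> (\<forall>t\<in>S. norm (T t) \<le> M)"])
  then show "0 < M" "\<And>t. t \<in> S \<Longrightarrow> norm (T t) \<le> M" by auto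
qed

lemma norm_T_apply_le: "t \<in> S \<Longrightarrow> norm (blinfun_apply (T t) x) \<le> M * norm x"
  by (rule order.trans[OF norm_blinfun mult_right_mono[OF M(2)]]) auto

text \<open>Since \<open>A (T d v) = D d v\<close>, this is \<open>(z + u A) (T d v)\<close>; no other values of \<open>A\<close> are needed.\<close>

definition res :: "complex \<Rightarrow> complex \<Rightarrow> complex \<Rightarrow> 'a \<Rightarrow> 'a"
  where "res u d z v = scaleC z (blinfun_apply (T d) v) + scaleC u (blinfun_apply (D d) v)"

lemma has_vector_derivative_exp_T:
  assumes d: "d \<in> S" and t: "u * c * of_real s + d \<in> S"
  shows "((\<lambda>s. scaleC (exp (z * c * of_real s)) (blinfun_apply (T (u * c * of_real s + d)) v)) has_vector_derivative
    scaleC (exp (z * c * of_real s)) (scaleC (z * c) (blinfun_apply (T (u * c * of_real s + d)) v) +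
      scaleC (u * c) (blinfun_apply (D (u * c * of_real s + d)) v))) (at s within X)"
proof -
  let ?p = "\<lambda>s::real. u * c * of_real s + d"
  have "((\<lambda>s. ?p s) has_derivative (\<lambda>h. u * c * of_real h)) (at s within X)"
    by (auto intro!: derivative_eq_intros)
  from has_derivative_compose[OF this has_derivative_T[OF t]]
  have "((\<lambda>s. T (?p s)) has_derivative (\<lambda>h. scaleC (u * c * of_real h) (D (?p s)))) (at s within X)" .
  then have 1: "((\<lambda>s. blinfun_apply (T (?p s)) v) has_derivative
      (\<lambda>h. blinfun_apply (scaleC (u * c * of_real h) (D (?p s))) v)) (at s within X)"
    by (rule bounded_linear.has_derivative[OF blinfun.bounded_linear_left])
  have "((\<lambda>w. exp (z * c * w)) has_field_derivative z * c * exp (z * c * of_real s)) (at (of_real s))"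
    by (auto intro!: derivative_eq_intros simp: algebra_simps)
  from has_vector_derivative_real_field[OF this]
  have 2: "((\<lambda>s. exp (z * c * of_real s)) has_derivative (\<lambda>h. h *\<^sub>R (z * c * exp (z * c * of_real s)))) (at s within X)"
    by (simp add: has_vector_derivative_def)
  show ?thesis
    unfolding has_vector_derivative_def
    by (rule has_derivative_eq_rhs[OF scaleC.FDERIV[OF 2 1]])
      (auto simp: fun_eq_iff blinfun_apply_scaleC scaleC_scaleC scaleC.add_right
        scaleR_conv_of_real scaleR_scaleC algebra_simps)
qed

text \<open>Along the ray in direction \<open>c\<close> the derivative of e^(zcs) T(ucs + d) v
  factors through \<open>res u d z v\<close>, so the increment is controlled by that vector. The
  majorant \<phi> is left free: an exponential serves the half-plane estimate, a linear function the
  unit interval. The smoothing by \<open>d\<close> makes \<open>s = 0\<close> admissible, while the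
  bound on the derivative is needed only for \<open>s > 0\<close>, where \<open>u * c * s\<close>
  lies in the sector.\<close>

lemma norm_exp_T_diff_le:
  assumes uc: "u * c \<in> S" and d: "d \<in> S" and b: "0 < b"
    and \<phi>: "\<And>s. (\<phi> has_real_derivative \<phi>' s) (at s)"
    and le: "\<And>s. 0 < s \<Longrightarrow> s < b \<Longrightarrow> cmod c * exp (Re (z * c) * s) * M * norm (res u d z v) \<le> \<phi>' s"
  shows "norm (scaleC (exp (z * c * of_real b)) (blinfun_apply (T (u * c * of_real b + d)) v) -
    blinfun_apply (T d) v) \<le> \<phi> b - \<phi> 0"
proof -
  define g where "g s = scaleC (exp (z * c * of_real s)) (blinfun_apply (T (u * c * of_real s + d)) v)" for s
  define g' where "g' s = scaleC (exp (z * c * of_real s)) (scaleC (z * c) (blinfun_apply (T (u * c * of_real s + d)) v) +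
      scaleC (u * c) (blinfun_apply (D (u * c * of_real s + d)) v))" for s
  have S0: "u * c * of_real s \<in> S" if "0 < s" for s using open_sector_scale[OF that uc] .
  have S: "u * c * of_real s + d \<in> S" if "0 \<le> s" for s
    using that d S0[of s] S_add by (cases "s = 0") auto
  have deriv: "(g has_vector_derivative g' s) (at s within X)" if "0 \<le> s" for s X
    unfolding g_def[abs_def] g'_def by (rule has_vector_derivative_exp_T[OF d S[OF that]])
  have "norm (g b - g 0) \<le> \<phi> b - \<phi> 0"
  proof (rule differentiable_bound_general[OF b])
    show "continuous_on {0..b} g"
      unfolding continuous_on_eq_continuous_within
      using has_vector_derivative_continuous[OF deriv] by auto
    show "continuous_on {0..b} \<phi>"
      by (rule DERIV_continuous_on[OF DERIV_subset[OF \<phi>]]) auto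
    fix s :: real assume s: "0 < s" "s < b"
    show "(g has_vector_derivative g' s) (at s)" using deriv[of s UNIV] s by simp
    show "(\<phi> has_vector_derivative \<phi>' s) (at s)"
      using \<phi>[of s] by (simp add: has_real_derivative_iff_has_vector_derivative)
    \<comment> \<open>Key factorisation: by the semigroup law and \<open>D_add\<close>, the operator
      T(ucs) splits off both terms and leaves z T(d) v + u D(d) v.\<close>
    have "g' s = scaleC (c * exp (z * c * of_real s)) (blinfun_apply (T (u * c * of_real s)) (res u d z v))"
      using S0[OF s(1)] d
      by (simp add: g'_def res_def T_add D_add(1) blinfun.add_right T_scaleC scaleC.add_right scaleC_scaleC mult_ac)
    then have "norm (g' s) \<le> cmod (c * exp (z * c * of_real s)) * (M * norm (res u d z v))"
      using mult_left_mono[OF norm_T_apply_le[OF S0[OF s(1)]] norm_ge_zero]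
      by (simp add: norm_scaleC)
    also have "\<dots> = cmod c * exp (Re (z * c) * s) * M * norm (res u d z v)"
      by (simp add: norm_mult)
    finally show "norm (g' s) \<le> \<phi>' s" using le[OF s] by simp
  qed
  then show ?thesis by (simp add: g_def)
qed

text \<open>The usual resolvent bound for the bounded semigroup t \<mapsto> T(uct): the end point
  contribution dies out as \<open>b\<close> tends to infinity, and integrating C e^(-ks) over the
  half-line gives C / k.\<close>

lemma norm_le_res_half_plane:
  assumes uc: "u * c \<in> S" and d: "d \<in> S" and neg: "Re (z * c) < 0"
  shows "- Re (z * c) * norm (blinfun_apply (T d) v) \<le> cmod c * M * norm (res u d z v)"
proof -
  define k where "k = - Re (z * c)"
  have k: "k > 0" using neg by (simp add: k_def)
  define C where "C = cmod c * M * norm (res u d z v)"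
  have C: "0 \<le> C" using M by (simp add: C_def)
  have b: "norm (blinfun_apply (T d) v) \<le> C / k + exp (- k * b) * (M * norm v)" if "0 < b" for b
  proof -
    let ?g = "scaleC (exp (z * c * of_real b)) (blinfun_apply (T (u * c * of_real b + d)) v)"
    have "norm (?g - blinfun_apply (T d) v) \<le> - C / k * exp (- k * b) - (- C / k * exp (- k * 0))"
    proof (rule norm_exp_T_diff_le[OF uc d that])
      show "((\<lambda>s. - C / k * exp (- k * s)) has_real_derivative C * exp (- k * s)) (at s)" for s
        using k by (auto intro!: derivative_eq_intros)
      show "cmod c * exp (Re (z * c) * s) * M * norm (res u d z v) \<le> C * exp (- k * s)" for s
        by (simp add: C_def k_def mult_ac)
    qed
    also have "\<dots> \<le> C / k" using C k by (simp add: field_simps)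
    finally have 1: "norm (?g - blinfun_apply (T d) v) \<le> C / k" .
    have "norm ?g \<le> exp (- k * b) * (M * norm v)"
      using norm_T_apply_le[OF S_add[OF open_sector_scale[OF that uc] d], of v]
      by (simp add: norm_scaleC k_def)
    with 1 show ?thesis using norm_triangle_sub[of "blinfun_apply (T d) v" ?g] by (simp add: norm_minus_commute)
  qed
  have "((\<lambda>b. C / k + exp (- k * b) * (M * norm v)) \<longlongrightarrow> C / k + 0 * (M * norm v)) at_top"
  proof (intro tendsto_intros)
    have "filterlim (\<lambda>b. k * b) at_top at_top"
      by (rule filterlim_tendsto_pos_mult_at_top[OF tendsto_const k filterlim_ident])
    then have "filterlim (\<lambda>b. - k * b) at_bot at_top" by (simp add: filterlim_uminus_at_top)
    then show "((\<lambda>b. exp (- k * b)) \<longlongrightarrow> 0) at_top" by (rule filterlim_compose[OF exp_at_bot])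
  qed
  then have "norm (blinfun_apply (T d) v) \<le> C / k + 0 * (M * norm v)"
  proof (rule tendsto_lowerbound)
    show "\<forall>\<^sub>F b in at_top. norm (blinfun_apply (T d) v) \<le> C / k + exp (- k * b) * (M * norm v)"
      using eventually_gt_at_top[of 0] by eventually_elim (rule b)
  qed simp
  then have "k * norm (blinfun_apply (T d) v) \<le> C" using k by (simp add: field_simps)
  then show ?thesis by (simp only: k_def C_def)
qed

text \<open>Divisibility of e^(-zc) - T(uc) by z + uA, in quantitative form. The 2 in the exponent
  counts e^(zcs) under the derivative bound and the final multiplication by e^(-zc).\<close>

lemma norm_exp_minus_T_le:
  assumes uc: "u * c \<in> S" and d: "d \<in> S"
  shows "norm (scaleC (exp (- z * c)) (blinfun_apply (T d) v) - blinfun_apply (T (u * c)) (blinfun_apply (T d) v))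
    \<le> exp (2 * (cmod z * cmod c)) * cmod c * M * norm (res u d z v)"
proof -
  let ?m = "cmod z * cmod c"
  let ?C = "cmod c * exp ?m * M * norm (res u d z v)"
  have Re: "\<bar>Re (z * c)\<bar> \<le> ?m" using abs_Re_le_cmod[of "z * c"] by (simp add: norm_mult)
  have "norm (scaleC (exp (z * c * of_real 1)) (blinfun_apply (T (u * c * of_real 1 + d)) v) - blinfun_apply (T d) v)
      \<le> ?C * 1 - ?C * 0"
  proof (rule norm_exp_T_diff_le[OF uc d])
    show "((\<lambda>s. ?C * s) has_real_derivative ?C) (at s)" for s
      by (auto intro!: derivative_eq_intros)
    fix s :: real assume s: "0 < s" "s < 1"
    have "Re (z * c) * s \<le> ?m * s" using s Re by (intro mult_right_mono) linarith+
    also have "\<dots> \<le> ?m * 1" using s by (intro mult_left_mono) auto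
    finally show "cmod c * exp (Re (z * c) * s) * M * norm (res u d z v) \<le> ?C"
      using M by (intro mult_right_mono mult_left_mono) auto
  qed simp
  then have le: "norm (scaleC (exp (z * c)) (blinfun_apply (T (u * c)) (blinfun_apply (T d) v)) - blinfun_apply (T d) v) \<le> ?C"
    using uc d by (simp add: T_add)
  have "scaleC (exp (- z * c)) (blinfun_apply (T d) v) - blinfun_apply (T (u * c)) (blinfun_apply (T d) v) =
      - scaleC (exp (- z * c)) (scaleC (exp (z * c)) (blinfun_apply (T (u * c)) (blinfun_apply (T d) v)) - blinfun_apply (T d) v)"
    by (simp add: scaleC.diff_right scaleC_scaleC flip: exp_add)
  then have "norm (scaleC (exp (- z * c)) (blinfun_apply (T d) v) - blinfun_apply (T (u * c)) (blinfun_apply (T d) v)) =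
      exp (Re (- z * c)) * norm (scaleC (exp (z * c)) (blinfun_apply (T (u * c)) (blinfun_apply (T d) v)) - blinfun_apply (T d) v)"
    by (simp add: norm_scaleC)
  also have "\<dots> \<le> exp ?m * ?C" using le Re by (intro mult_mono) auto
  also have "\<dots> = exp (2 * ?m) * cmod c * M * norm (res u d z v)"
    by (simp add: mult_exp_exp mult_ac flip: exp_add)
  finally show ?thesis .
qed

text \<open>Only positive powers are compared, since \<open>T 0\<close> is not constrained.\<close>

lemma T_of_nat: "blinfun_power (T 1) (Suc n) = T (of_nat (Suc n))"
proof (induction n)
  case (Suc n)
  have "T (of_real 1 + of_real (real (Suc n))) = T (of_real 1) o\<^sub>L T (of_real (real (Suc n)))"
    by (rule T_add) (simp_all only: S_of_real zero_less_one of_nat_0_less_iff zero_less_Suc)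
  then show ?case using Suc by simp
qed simp

text \<open>As \<open>n\<close> grows, \<open>orbit_integral d x n w\<close> approaches the solution \<open>y\<close> of \<open>(w + A) y = T d x\<close>.\<close>

definition orbit_integral :: "real \<Rightarrow> 'a \<Rightarrow> real \<Rightarrow> complex \<Rightarrow> 'a"
  where "orbit_integral d x n w =
    - integral {0..n} (\<lambda>s. scaleC (exp (w * of_real s)) (blinfun_apply (T (of_real (s + d))) x))"

lemma continuous_on_orbit:
  "0 < d \<Longrightarrow> continuous_on {0..n} (\<lambda>s. blinfun_apply (T (of_real (s + d))) x)"
  by (intro continuous_intros continuous_on_T_compose S_of_real) simp_all

lemma T_orbit_integral:
  assumes "0 < d" "0 < e"
  shows "blinfun_apply (T (of_real e)) (orbit_integral d x n w) = orbit_integral (d + e) x n w"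
proof -
  let ?f = "\<lambda>s. scaleC (exp (w * of_real s)) (blinfun_apply (T (of_real (s + d))) x)"
  have "?f integrable_on {0..n}"
    by (intro integrable_continuous_real continuous_intros continuous_on_orbit assms)
  then have "integral {0..n} (blinfun_apply (T (of_real e)) \<circ> ?f) = blinfun_apply (T (of_real e)) (integral {0..n} ?f)"
    by (rule integral_linear[OF _ blinfun.bounded_linear_right])
  moreover have "integral {0..n} (blinfun_apply (T (of_real e)) \<circ> ?f) =
      integral {0..n} (\<lambda>s. scaleC (exp (w * of_real s)) (blinfun_apply (T (of_real (s + (d + e)))) x))"
  proof (rule integral_cong)
    fix s assume s: "s \<in> {0..n}"
    have "T (of_real e + of_real (s + d)) = T (of_real e) o\<^sub>L T (of_real (s + d))"
      using s assms by (intro T_add S_of_real) auto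
    moreover have "of_real e + of_real (s + d) = (of_real (s + (d + e)) :: complex)" by simp
    ultimately have "T (of_real (s + (d + e))) = T (of_real e) o\<^sub>L T (of_real (s + d))" by (simp only:)
    then show "(blinfun_apply (T (of_real e)) \<circ> ?f) s =
        scaleC (exp (w * of_real s)) (blinfun_apply (T (of_real (s + (d + e)))) x)"
      using assms by (simp only: o_def T_scaleC[OF S_of_real] blinfun_apply_blinfun_compose)
  qed
  ultimately show ?thesis by (simp add: orbit_integral_def blinfun.minus_right)
qed

text \<open>The integrand of w y + A y is the total derivative of e^(ws) T(s + d + e) x, so only the
  two end points survive. Passing from w to z = u w produces the factor \<open>u\<close> in front,
  the source of the final smallness.\<close>

lemma res_orbit_integral:
  assumes d: "0 < d" and e: "0 < e" and n: "0 \<le> n"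
  shows "res u (of_real e) (u * w) (orbit_integral d x n w) =
    scaleC u (blinfun_apply (T (of_real (d + e))) x -
      scaleC (exp (w * of_real n)) (blinfun_apply (T (of_real (n + (d + e)))) x))"
proof -
  define p where "p = d + e"
  have "0 < p" using d e by (simp add: p_def)
  then have p: "0 < p" "of_real p \<in> S" by (simp_all only: S_of_real)
  let ?y = "\<lambda>s. scaleC (exp (w * of_real s)) (blinfun_apply (T (of_real (s + p))) x)"
  let ?y' = "\<lambda>s. scaleC (exp (w * of_real s)) (blinfun_apply (D (of_real (s + p))) x)"
  let ?f = "\<lambda>s. scaleC (exp (w * of_real s)) (blinfun_apply (T (of_real (s + d))) x)"
  have "((\<lambda>s. scaleC (exp (w * of_real s)) (scaleC w (blinfun_apply (T (of_real (s + p))) x) +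
      blinfun_apply (D (of_real (s + p))) x)) has_integral ?y n - ?y 0) {0..n}"
  proof (rule fundamental_theorem_of_calculus[OF n])
    fix s assume "s \<in> {0..n}"
    then have "1 * 1 * of_real s + of_real p \<in> S"
      using p S_of_real[of "s + p"] by simp
    from has_vector_derivative_exp_T[OF p(2) this, of w x]
    show "(?y has_vector_derivative scaleC (exp (w * of_real s)) (scaleC w (blinfun_apply (T (of_real (s + p))) x) +
      blinfun_apply (D (of_real (s + p))) x)) (at s within {0..n})" by simp
  qed
  then have 1: "((\<lambda>s. scaleC w (?y s) + ?y' s) has_integral ?y n - ?y 0) {0..n}"
    by (simp add: scaleC.add_right scaleC_scaleC mult.commute)
  have yint: "?y integrable_on {0..n}"
    by (intro integrable_continuous_real continuous_intros continuous_on_orbit p)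
  have 2: "((\<lambda>s. scaleC w (?y s)) has_integral scaleC w (integral {0..n} ?y)) {0..n}"
    using has_integral_linear[OF integrable_integral[OF yint] bounded_linear_scaleC_right] by (simp add: o_def)
  have "?f integrable_on {0..n}"
    by (intro integrable_continuous_real continuous_intros continuous_on_orbit d)
  \<comment> \<open>The bounded operator \<open>D e\<close> may be taken under the integral, where
    \<open>D_add\<close> merges it with T(s + d) into D(s + d + e).\<close>
  then have "((blinfun_apply (D (of_real e)) \<circ> ?f) has_integral blinfun_apply (D (of_real e)) (integral {0..n} ?f)) {0..n}"
    by (intro has_integral_linear integrable_integral blinfun.bounded_linear_right)
  moreover have "(blinfun_apply (D (of_real e)) \<circ> ?f) s = ?y' s" if "s \<in> {0..n}" for s
  proof -
    have "D (of_real e + of_real (s + d)) = D (of_real e) o\<^sub>L T (of_real (s + d))"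
      using that d e by (intro D_add(2) S_of_real) auto
    moreover have "of_real e + of_real (s + d) = (of_real (s + p) :: complex)" by (simp add: p_def)
    ultimately have "D (of_real (s + p)) = D (of_real e) o\<^sub>L T (of_real (s + d))" by (simp only:)
    then show ?thesis
      using e by (simp only: o_def D_scaleC[OF S_of_real] blinfun_apply_blinfun_compose)
  qed
  ultimately have "(?y' has_integral blinfun_apply (D (of_real e)) (integral {0..n} ?f)) {0..n}"
    by (rule has_integral_cong[THEN iffD1, rotated])
  from has_integral_add[OF 2 this] 1
  have eq: "scaleC w (integral {0..n} ?y) + blinfun_apply (D (of_real e)) (integral {0..n} ?f) = ?y n - ?y 0"
    by (rule has_integral_unique)
  have "res u (of_real e) (u * w) (orbit_integral d x n w) =
      - scaleC u (scaleC w (integral {0..n} ?y) + blinfun_apply (D (of_real e)) (integral {0..n} ?f))"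
    unfolding res_def T_orbit_integral[OF d e]
    by (simp add: orbit_integral_def p_def scaleC.minus_right blinfun.minus_right scaleC.add_right scaleC_scaleC)
  then show ?thesis unfolding eq by (simp add: p_def scaleC.diff_right)
qed

text \<open>Quasinilpotence of T(1) alone gives decay along the integers that beats every
  exponential rate \<rho>.\<close>

lemma orbit_decay:
  assumes qn: "op_spectral_radius (T 1) = 0" and d: "0 < d"
  shows "(\<lambda>n. exp (\<rho> * real n) * norm (blinfun_apply (T (of_real (real n + d))) x)) \<longlonglongrightarrow> 0"
proof -
  have "complex_linear_op (T 1)" using T_linear[OF S_of_real[of 1]] by simp
  \<comment> \<open>The radius is chosen so that, after the growth e^(\<rho> n) and the loss 2^n, a
    factor (2/4)^n remains.\<close>
  then obtain C where C: "\<And>n. norm (blinfun_power (T 1) n) * (4 * exp \<rho>) ^ n \<le> C * 2 ^ n"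
    using quasinilpotent_power_bound[OF _ qn, of "4 * exp \<rho>"] by auto
  define B where "B = norm (blinfun_apply (T (of_real d)) x)"
  have le: "exp (\<rho> * real (Suc n)) * norm (blinfun_apply (T (of_real (real (Suc n) + d))) x) \<le> C * B * (1 / 2) ^ Suc n" for n
  proof -
    have "T (of_real (real (Suc n)) + of_real d) = T (of_real (real (Suc n))) o\<^sub>L T (of_real d)"
      by (rule T_add[OF S_of_real S_of_real[OF d]]) simp
    then have "T (of_real (real (Suc n) + d)) = blinfun_power (T 1) (Suc n) o\<^sub>L T (of_real d)"
      unfolding T_of_nat by (simp only: of_real_add of_real_of_nat_eq)
    then have "norm (blinfun_apply (T (of_real (real (Suc n) + d))) x) \<le> norm (blinfun_power (T 1) (Suc n)) * B"
      unfolding B_def using norm_blinfun by (simp only: blinfun_apply_blinfun_compose)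
    then have "exp (\<rho> * real (Suc n)) * norm (blinfun_apply (T (of_real (real (Suc n) + d))) x) \<le>
        exp \<rho> ^ Suc n * (norm (blinfun_power (T 1) (Suc n)) * B)"
      by (intro mult_mono) (simp_all only: exp_of_nat2_mult order_refl exp_ge_zero norm_ge_zero zero_le_power)
    also have "\<dots> = norm (blinfun_power (T 1) (Suc n)) * (4 * exp \<rho>) ^ Suc n * (1 / 4) ^ Suc n * B"
      unfolding power_mult_distrib by (simp add: power_one_over field_simps)
    also have "\<dots> \<le> C * 2 ^ Suc n * (1 / 4) ^ Suc n * B"
      by (intro mult_right_mono C) (simp_all add: B_def)
    also have "\<dots> = C * B * (2 * (1 / 4)) ^ Suc n" unfolding power_mult_distrib by simp
    finally show ?thesis by simp
  qed
  have "(\<lambda>n. C * B * (1 / 2) ^ Suc n) \<longlonglongrightarrow> C * B * 0"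
    by (intro tendsto_mult_left LIMSEQ_Suc LIMSEQ_realpow_zero) simp_all
  then have "(\<lambda>n. C * B * (1 / 2) ^ Suc n) \<longlonglongrightarrow> 0" by simp
  then have "(\<lambda>n. exp (\<rho> * real (Suc n)) * norm (blinfun_apply (T (of_real (real (Suc n) + d))) x)) \<longlonglongrightarrow> 0"
    by (rule Lim_null_comparison[rotated]) (rule always_eventually, use le in simp)
  then show ?thesis by (rule LIMSEQ_imp_Suc)
qed

end

locale semigroup_measure = bounded_analytic_semigroup \<alpha> T + symmetric_complex_measure \<mu>
  for \<alpha> and T :: "complex \<Rightarrow> ('a::complex_banach \<Rightarrow>\<^sub>L 'a)" and \<mu> +
  fixes \<beta> :: real and K :: "complex set"
  assumes \<beta>: "0 < \<beta>" "\<beta> < \<alpha>"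
    and compact_K: "compact K" and K_sector: "K \<subseteq> closed_sector \<beta>"
    and supported: "measure_supported_on \<mu> K"
begin

abbreviation "F \<equiv> fourier_borel_transform \<mu> K"

definition R :: real
  where "R = (SOME R. 0 < R \<and> (\<forall>\<xi>\<in>K. cmod \<xi> \<le> R))"

lemma R: "0 < R" "\<And>\<xi>. \<xi> \<in> K \<Longrightarrow> cmod \<xi> \<le> R"
proof -
  have "\<exists>R. 0 < R \<and> (\<forall>\<xi>\<in>K. cmod \<xi> \<le> R)"
    using compact_imp_bounded[OF compact_K] by (auto simp: bounded_pos)
  then have "0 < R \<and> (\<forall>\<xi>\<in>K. cmod \<xi> \<le> R)" unfolding R_def by (rule someI_ex)
  then show "0 < R" "\<And>\<xi>. \<xi> \<in> K \<Longrightarrow> cmod \<xi> \<le> R" by auto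
qed

lemma mult_in_S: "u \<in> open_sector (\<alpha> - \<beta>) \<Longrightarrow> c \<in> closed_sector \<beta> \<Longrightarrow> u * c \<in> S"
  using open_sector_times[OF \<beta> \<alpha>(2)] .

text \<open>The pointwise division estimate is integrated over \<open>K\<close>. Its constant
  depends on \<open>z\<close>, \<open>R\<close>, \<open>M\<close> and the total mass but not on
  \<open>u\<close>, \<open>d\<close> or \<open>v\<close>, which makes the later barrier uniform in
  \<open>u\<close>.\<close>

lemma norm_le_res_transform:
  assumes u: "u \<in> open_sector (\<alpha> - \<beta>)" and d: "d \<in> S"
  shows "(cmod (F z) - norm (fourier_borel_op \<mu> K T u)) * norm (blinfun_apply (T d) v) \<le>
    exp (2 * (cmod z * R)) * R * M * total_mass * norm (res u d z v)"
proof -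
  let ?y = "blinfun_apply (T d) v"
  let ?C = "exp (2 * (cmod z * R)) * R * M * norm (res u d z v)"
  have uK: "u * \<xi> \<in> S" if "\<xi> \<in> K" for \<xi> using mult_in_S[OF u] K_sector that by blast
  have cont: "continuous_on K (\<lambda>\<xi>. exp (- z * \<xi>))" "continuous_on K (\<lambda>\<xi>. T (u * \<xi>))"
    by (intro continuous_intros continuous_on_T_compose uK)+
  have 1: "complex_bochner_integral \<mu> K (\<lambda>\<xi>. scaleC (exp (- z * \<xi>)) ?y) = scaleC (F z) ?y"
    unfolding fourier_borel_transform_def
    by (rule complex_bochner_integral_linear[OF compact_K cont(1) scaleC.bounded_linear_left])
      (simp add: scaleC_complex_def scaleC_scaleC)
  have 2: "complex_bochner_integral \<mu> K (\<lambda>\<xi>. blinfun_apply (T (u * \<xi>)) ?y) =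
      blinfun_apply (fourier_borel_op \<mu> K T u) ?y"
    unfolding fourier_borel_op_def
    by (rule complex_bochner_integral_linear[OF compact_K cont(2) blinfun.bounded_linear_left])
      (simp add: blinfun_apply_scaleC)
  have cont': "continuous_on K (\<lambda>\<xi>. scaleC (exp (- z * \<xi>)) ?y)" "continuous_on K (\<lambda>\<xi>. blinfun_apply (T (u * \<xi>)) ?y)"
    by (intro continuous_intros cont)+
  have "scaleC (F z) ?y - blinfun_apply (fourier_borel_op \<mu> K T u) ?y =
      complex_bochner_integral \<mu> K (\<lambda>\<xi>. scaleC (exp (- z * \<xi>)) ?y - blinfun_apply (T (u * \<xi>)) ?y)"
    unfolding complex_bochner_integral_diff[OF compact_K cont'] 1 2 ..
  also have "norm \<dots> \<le> ?C * total_mass"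
  proof (rule norm_complex_bochner_integral_le[OF compact_K continuous_on_diff[OF cont']])
    show "0 \<le> ?C" using M R by simp
    fix \<xi> assume \<xi>: "\<xi> \<in> K"
    have "norm (scaleC (exp (- z * \<xi>)) ?y - blinfun_apply (T (u * \<xi>)) ?y) \<le>
        exp (2 * (cmod z * cmod \<xi>)) * cmod \<xi> * M * norm (res u d z v)"
      by (rule norm_exp_minus_T_le[OF uK[OF \<xi>] d])
    also have "\<dots> \<le> ?C"
      using R(2)[OF \<xi>] R(1) M(1)
      by (intro mult_right_mono mult_mono) (auto intro: mult_left_mono)
    finally show "norm (scaleC (exp (- z * \<xi>)) ?y - blinfun_apply (T (u * \<xi>)) ?y) \<le> ?C" .
  qed
  finally have "norm (scaleC (F z) ?y - blinfun_apply (fourier_borel_op \<mu> K T u) ?y) \<le> ?C * total_mass" .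
  moreover have "norm (scaleC (F z) ?y) - norm (blinfun_apply (fourier_borel_op \<mu> K T u) ?y) \<le>
      norm (scaleC (F z) ?y - blinfun_apply (fourier_borel_op \<mu> K T u) ?y)"
    by (rule norm_triangle_ineq2)
  moreover have "norm (blinfun_apply (fourier_borel_op \<mu> K T u) ?y) \<le> norm (fourier_borel_op \<mu> K T u) * norm ?y"
    by (rule norm_blinfun)
  ultimately have "cmod (F z) * norm ?y - norm (fourier_borel_op \<mu> K T u) * norm ?y \<le> ?C * total_mass"
    unfolding norm_scaleC by linarith
  then show ?thesis unfolding left_diff_distrib by (simp only: mult_ac)
qed

end

section \<open>The Fourier--Borel transform\<close>

lemma cmod_exp_minus_1_minus_le: "cmod (exp w - 1 - w) \<le> exp (cmod w) * (cmod w)\<^sup>2"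
proof -
  have "cmod (exp w - (\<Sum>k\<le>1. w ^ k / fact k)) \<le> exp \<bar>Re w\<bar> * cmod w ^ Suc 1 / fact 1"
    by (rule Taylor_exp)
  also have "\<dots> \<le> exp (cmod w) * cmod w ^ Suc 1 / fact 1"
    by (intro divide_right_mono mult_right_mono) (simp_all add: abs_Re_le_cmod)
  finally show ?thesis by (simp add: power2_eq_square algebra_simps)
qed

text \<open>A Phragmen--Lindelof argument: \<open>f ^ n / (1 + z)\<close> decays at infinity, and letting \<open>n\<close>
  tend to infinity removes the factor \<open>1 + z\<close>.\<close>

lemma bounded_on_component_half_plane:
  assumes f: "f holomorphic_on UNIV" and m: "m > 0"
    and V: "V = connected_component_set {z. cmod (f z) > m} p" and p: "cmod (f p) > m"
    and half: "\<And>z. z \<in> V \<Longrightarrow> 0 \<le> Re z" and bd: "\<And>z. z \<in> V \<Longrightarrow> cmod (f z) \<le> C"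
  shows False
proof -
  have cont: "continuous_on X f" for X
    using holomorphic_on_imp_continuous_on[OF f] by (rule continuous_on_subset) simp
  let ?U = "{z. cmod (f z) > m}"
  have openU: "open ?U" by (intro open_Collect_less continuous_intros cont)
  have openV: "open V" unfolding V by (rule open_connected_component[OF openU])
  have pV: "p \<in> V" using p by (simp add: V)
  have frontV: "cmod (f z) \<le> m" if "z \<in> frontier V" for z
  proof -
    \<comment> \<open>A frontier point of a component of the open set \<open>?U\<close> is a
      frontier point of \<open>?U\<close> and so lies outside it.\<close>
    have "frontier V \<subseteq> frontier ?U" unfolding V by (rule frontier_of_connected_component_subset)
    then have "z \<notin> ?U" using that openU by (auto simp: frontier_def interior_open)
    then show ?thesis by simp
  qed
  have half': "0 \<le> Re z" if "z \<in> closure V" for z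
  proof -
    have "closure V \<subseteq> {z. 0 \<le> Re z}"
      by (rule closure_minimal) (use half in \<open>auto intro!: closed_Collect_le continuous_intros\<close>)
    then show ?thesis using that by auto
  qed
  have bd': "cmod (f z) \<le> C" if "z \<in> closure V" for z
  proof -
    have "closure V \<subseteq> {z. cmod (f z) \<le> C}"
      by (rule closure_minimal) (use bd in \<open>auto intro!: closed_Collect_le continuous_intros cont\<close>)
    then show ?thesis using that by auto
  qed
  have one: "cmod (1 + z) \<ge> 1" "cmod (1 + z) \<ge> cmod z" "1 + z \<noteq> 0" if "0 \<le> Re z" for z
  proof -
    show 1: "cmod (1 + z) \<ge> 1" using complex_Re_le_cmod[of "1 + z"] that by simp
    then show "1 + z \<noteq> 0" by auto
    have "(cmod z)\<^sup>2 \<le> (cmod (1 + z))\<^sup>2"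
      unfolding cmod_power2 using that by (simp add: power2_eq_square algebra_simps)
    then show "cmod (1 + z) \<ge> cmod z" by (rule power2_le_imp_le) simp
  qed
  have C: "0 \<le> C" using bd[OF pV] norm_ge_zero order.trans by blast
  have key: "cmod (f p) ^ n \<le> m ^ n * cmod (1 + p)" for n
  proof -
    \<comment> \<open>On the circle of this radius the decay 1 / \<rho> of 1 / (1 + z) brings C^n
      below m^n; the summand \<open>cmod p + 1\<close> keeps \<open>p\<close> inside.\<close>
    define \<rho> where "\<rho> = cmod p + 1 + C ^ n / m ^ n"
    have \<rho>: "cmod p < \<rho>" "C ^ n / m ^ n \<le> \<rho>" "0 < \<rho>" using C m
      by (simp_all add: \<rho>_def add_pos_nonneg add_nonneg_pos divide_nonneg_pos)
    let ?S = "V \<inter> ball 0 \<rho>" and ?h = "\<lambda>z. f z ^ n / (1 + z)"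
    have "cmod (?h p) \<le> m ^ n"
    proof (rule maximum_modulus_frontier[of ?h ?S])
      have sub: "closure ?S \<subseteq> closure V" by (intro closure_mono) auto
      have nz: "1 + z \<noteq> 0" if "z \<in> closure ?S" for z using one(3)[OF half'] that sub by blast
      show "continuous_on (closure ?S) ?h" by (intro continuous_intros cont) (use nz in auto)
      show "?h holomorphic_on interior ?S"
        by (intro holomorphic_intros holomorphic_on_subset[OF f] subset_UNIV)
          (meson closure_subset interior_subset nz subsetD)
      show "bounded ?S" by (rule bounded_subset[of "ball 0 \<rho>"]) auto
      show "p \<in> ?S" using pV \<rho> by simp
      fix z assume z: "z \<in> frontier ?S"
      then have zc: "z \<in> closure V" using sub by (auto simp: frontier_def)
      have "closure ?S \<subseteq> cball 0 \<rho>" by (rule closure_minimal) auto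
      then have "z \<in> cball 0 \<rho>" using z by (auto simp: frontier_def)
      then consider "cmod z = \<rho>" | "cmod z < \<rho>" by fastforce
      then show "cmod (?h z) \<le> m ^ n"
      proof cases
        case 1
        have "cmod (?h z) \<le> C ^ n / \<rho>"
          unfolding norm_divide norm_power
          using 1 \<rho> C bd'[OF zc] one(2)[OF half'[OF zc]] by (intro frac_le power_mono) auto
        also have "\<dots> \<le> m ^ n" using \<rho> m by (simp add: field_simps)
        finally show ?thesis .
      next
        case 2
        have "open ?S" using openV by auto
        then have "frontier ?S = closure ?S - ?S" by (simp only: frontier_def interior_open)
        then have "z \<notin> ?S" using z by blast
        then have "z \<notin> V" using 2 by simp
        then have "z \<in> frontier V" using zc openV by (auto simp: frontier_def interior_open)
        then have "cmod (?h z) \<le> m ^ n / 1"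
          unfolding norm_divide norm_power
          using m one(1)[OF half'[OF zc]] frontV by (intro frac_le power_mono) auto
        then show ?thesis by simp
      qed
    qed
    moreover have "0 < cmod (1 + p)" using one(1)[OF half[OF pV]] by linarith
    ultimately show ?thesis unfolding norm_divide norm_power by (simp only: pos_divide_le_eq)
  qed
  have "1 < cmod (f p) / m" using p m by simp
  then obtain n where "cmod (1 + p) < (cmod (f p) / m) ^ n" using real_arch_pow by blast
  then show False using key[of n] m by (simp add: power_divide field_simps)
qed

text \<open>If the winding number \<open>w\<close> of \<open>\<gamma>\<close> around 0 had zero real part, then
  \<open>exp (2 * pi * \<i> * w) = b / a\<close> would be positive; so \<open>\<gamma>\<close> followed by its reversed conjugate
  has winding number \<open>2 * Re w \<noteq> 0\<close>.\<close>

lemma inside_path_union_cnj: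
  assumes \<gamma>: "path \<gamma>" "pathstart \<gamma> = of_real a" "pathfinish \<gamma> = of_real b" "0 < a" "b < 0" "0 \<notin> path_image \<gamma>"
  shows "0 \<in> inside (path_image \<gamma> \<union> cnj ` path_image \<gamma>)"
proof -
  let ?w = "winding_number \<gamma> 0"
  have cnj_path: "path (cnj \<circ> \<gamma>)"
    using \<gamma>(1) by (intro path_continuous_image continuous_intros)
  have img: "path_image (cnj \<circ> \<gamma>) = cnj ` path_image \<gamma>" by (simp add: path_image_def image_comp)
  have ends: "pathstart (cnj \<circ> \<gamma>) = of_real a" "pathfinish (cnj \<circ> \<gamma>) = of_real b"
    using \<gamma>(2,3) by (simp_all add: pathstart_def pathfinish_def)
  have zero: "0 \<notin> cnj ` path_image \<gamma>" using \<gamma>(6) by (auto simp: image_iff)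
  define l where "l = \<gamma> +++ reversepath (cnj \<circ> \<gamma>)"
  have l: "path l" "pathfinish l = pathstart l"
    unfolding l_def using \<gamma> cnj_path ends by (simp_all add: path_join)
  have limg: "path_image l = path_image \<gamma> \<union> cnj ` path_image \<gamma>"
    unfolding l_def using \<gamma> ends by (subst path_image_join) (simp_all add: img)
  have "winding_number (cnj \<circ> \<gamma>) 0 = - cnj ?w"
    using winding_number_cnj[OF \<gamma>(1,6)] by simp
  then have "winding_number l 0 = ?w + cnj ?w"
    unfolding l_def using \<gamma> cnj_path ends zero
    by (subst winding_number_join) (simp_all add: img winding_number_reversepath)
  also have "\<dots> = of_real (2 * Re ?w)" by (rule complex_add_cnj)
  finally have wl: "winding_number l 0 = of_real (2 * Re ?w)" .
  have "Re ?w \<noteq> 0"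
  proof
    assume "Re ?w = 0"
    then have "of_real (2 * pi) * \<i> * ?w = of_real (- 2 * pi * Im ?w)" by (simp add: complex_eq_iff)
    then have "of_real b = (of_real (exp (- 2 * pi * Im ?w)) * of_real a :: complex)"
      using winding_number_exp_2pi[OF \<gamma>(1,6)] \<gamma>(2,3) by (simp only: diff_0_right exp_of_real)
    then have "b = exp (- 2 * pi * Im ?w) * a" by (simp only: of_real_mult[symmetric] of_real_eq_iff)
    moreover have "0 < exp (- 2 * pi * Im ?w) * a" using \<gamma>(4) by simp
    ultimately show False using \<gamma>(5) by linarith
  qed
  then have "winding_number l 0 \<noteq> 0" using wl by simp
  then have out: "0 \<notin> outside (path_image l)" using winding_number_zero_in_outside[OF l] by auto
  have "0 \<in> - path_image l" unfolding limg using \<gamma>(6) zero by simp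
  then have "0 \<in> inside (path_image l) \<union> outside (path_image l)" by (simp only: inside_Un_outside)
  then show ?thesis using out by (simp only: Un_iff limg simp_thms)
qed

section \<open>Analyticity, symmetry and decay of \<open>F\<close>\<close>

context semigroup_measure
begin

lemma continuous_exp: "continuous_on X (\<lambda>\<xi>. exp (- z * \<xi> :: complex))"
  by (intro continuous_intros)

text \<open>Differentiation under the integral sign: for |h| at most 1 the second-order Taylor
  remainder of the exponential is O(|h|^2) uniformly on the compact set \<open>K\<close>.\<close>

lemma F_has_field_derivative:
  "(F has_field_derivative complex_bochner_integral \<mu> K (\<lambda>\<xi>. - \<xi> * exp (- z * \<xi>))) (at z)"
proof -
  let ?G = "complex_bochner_integral \<mu> K (\<lambda>\<xi>. - \<xi> * exp (- z * \<xi>))"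
  let ?E = "exp (cmod z * R) * (exp R * R\<^sup>2) * total_mass"
  have contG: "continuous_on K (\<lambda>\<xi>. - \<xi> * exp (- z * \<xi>))" by (intro continuous_intros)
  have est: "cmod (F (z + h) - F z - h * ?G) \<le> (cmod h)\<^sup>2 * ?E" if h: "cmod h \<le> 1" for h
  proof -
    have contD: "continuous_on K (\<lambda>\<xi>. exp (- (z + h) * \<xi>) - exp (- z * \<xi>))"
      and contH: "continuous_on K (\<lambda>\<xi>. h * (- \<xi> * exp (- z * \<xi>)))" by (intro continuous_intros)+
    have hG: "complex_bochner_integral \<mu> K (\<lambda>\<xi>. h * (- \<xi> * exp (- z * \<xi>))) = h * ?G"
      by (rule complex_bochner_integral_linear[OF compact_K contG bounded_linear_mult_right])
        (simp add: scaleC_complex_def)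
    have "F (z + h) - F z - h * ?G = complex_bochner_integral \<mu> K
        (\<lambda>\<xi>. exp (- (z + h) * \<xi>) - exp (- z * \<xi>) - h * (- \<xi> * exp (- z * \<xi>)))"
      unfolding complex_bochner_integral_diff[OF compact_K contD contH]
        complex_bochner_integral_diff[OF compact_K continuous_exp continuous_exp] hG
        fourier_borel_transform_def ..
    also have "cmod \<dots> \<le> exp (cmod z * R) * (exp R * (cmod h * R)\<^sup>2) * total_mass"
    proof (rule norm_complex_bochner_integral_le[OF compact_K continuous_on_diff[OF contD contH]])
      show "0 \<le> exp (cmod z * R) * (exp R * (cmod h * R)\<^sup>2)" by simp
      fix \<xi> assume "\<xi> \<in> K"
      then have \<xi>: "cmod \<xi> \<le> R" by (rule R(2))
      have h\<xi>: "cmod (- h * \<xi>) \<le> cmod h * R" "cmod (- h * \<xi>) \<le> R"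
        using \<xi> h mult_mono[of "cmod h" 1 "cmod \<xi>" R] by (auto simp: norm_mult intro: mult_left_mono)
      have "exp (- (z + h) * \<xi>) - exp (- z * \<xi>) - h * (- \<xi> * exp (- z * \<xi>)) =
          exp (- z * \<xi>) * (exp (- h * \<xi>) - 1 - (- h * \<xi>))"
        by (simp add: algebra_simps flip: exp_add)
      also have "cmod \<dots> = exp (Re (- z * \<xi>)) * cmod (exp (- h * \<xi>) - 1 - (- h * \<xi>))"
        by (simp add: norm_mult)
      also have "\<dots> \<le> exp (cmod z * R) * (exp R * (cmod h * R)\<^sup>2)"
      proof (intro mult_mono)
        have "Re (- z * \<xi>) \<le> cmod (- z * \<xi>)" by (rule complex_Re_le_cmod)
        also have "\<dots> \<le> cmod z * R" using \<xi> by (simp add: norm_mult mult_left_mono)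
        finally show "exp (Re (- z * \<xi>)) \<le> exp (cmod z * R)" by simp
        have "cmod (exp (- h * \<xi>) - 1 - (- h * \<xi>)) \<le> exp (cmod (- h * \<xi>)) * (cmod (- h * \<xi>))\<^sup>2"
          by (rule cmod_exp_minus_1_minus_le)
        also have "\<dots> \<le> exp R * (cmod h * R)\<^sup>2" using h\<xi> by (intro mult_mono power_mono) auto
        finally show "cmod (exp (- h * \<xi>) - 1 - (- h * \<xi>)) \<le> exp R * (cmod h * R)\<^sup>2" .
      qed auto
      finally show "cmod (exp (- (z + h) * \<xi>) - exp (- z * \<xi>) - h * (- \<xi> * exp (- z * \<xi>))) \<le>
        exp (cmod z * R) * (exp R * (cmod h * R)\<^sup>2)" .
    qed
    also have "\<dots> = (cmod h)\<^sup>2 * ?E" by (simp add: power_mult_distrib mult_ac)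
    finally show ?thesis .
  qed
  show ?thesis
    unfolding DERIV_def
  proof (rule LIM_zero_cancel, rule Lim_null_comparison)
    have "eventually (\<lambda>h. h \<noteq> 0 \<and> cmod h < 1) (at 0)"
      unfolding eventually_at by (intro exI[of _ 1]) (auto simp: dist_norm)
    then show "\<forall>\<^sub>F h in at 0. cmod ((F (z + h) - F z) / h - ?G) \<le> cmod h * ?E"
    proof eventually_elim
      case (elim h)
      have "(F (z + h) - F z) / h - ?G = (F (z + h) - F z - h * ?G) / h" using elim by (simp add: field_simps)
      then have "cmod ((F (z + h) - F z) / h - ?G) = cmod (F (z + h) - F z - h * ?G) / cmod h"
        by (simp add: norm_divide)
      also have "\<dots> \<le> (cmod h)\<^sup>2 * ?E / cmod h" using est[of h] elim by (intro divide_right_mono) auto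
      also have "\<dots> = cmod h * ?E" using elim by (simp add: power2_eq_square)
      finally show ?case .
    qed
    have "((\<lambda>h. cmod h * ?E) \<longlongrightarrow> cmod 0 * ?E) (at 0)" by (intro tendsto_intros)
    then show "((\<lambda>h. cmod h * ?E) \<longlongrightarrow> 0) (at 0)" by simp
  qed
qed

lemma F_holomorphic: "F holomorphic_on X"
  using F_has_field_derivative holomorphic_on_def field_differentiable_def
    field_differentiable_at_within by blast

lemma F_continuous: "continuous_on X F"
  by (intro holomorphic_on_imp_continuous_on F_holomorphic)

lemma F_cnj: "F (cnj z) = cnj (F z)"
proof -
  have "continuous_on UNIV (\<lambda>\<xi>. exp (- z * \<xi>))" by (rule continuous_exp)
  from complex_bochner_integral_cnj[OF compact_K supported this]
  show ?thesis by (simp add: fourier_borel_transform_def exp_cnj)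
qed

lemma cmod_F_le:
  assumes "\<And>\<xi>. \<xi> \<in> K \<Longrightarrow> b \<le> Re (z * \<xi>)"
  shows "cmod (F z) \<le> exp (- b) * total_mass"
  unfolding fourier_borel_transform_def
proof (rule norm_complex_bochner_integral_le[OF compact_K continuous_exp])
  fix \<xi> assume "\<xi> \<in> K"
  from assms[OF this] show "cmod (exp (- z * \<xi>)) \<le> exp (- b)" by simp
qed simp

text \<open>The rate \<open>d\<close> is the minimum of \<open>Re\<close> on \<open>K\<close>,
  positive because \<open>K\<close> is compact and lies in the open right half-plane.\<close>

lemma F_of_real_le: "\<exists>d>0. \<forall>t>0. cmod (F (of_real t)) \<le> exp (- d * t) * total_mass"
proof (cases "K = {}")
  case True
  then show ?thesis using cmod_F_le by (intro exI[of _ 1]) auto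
next
  case False
  have "continuous_on K Re" by (intro continuous_intros)
  from continuous_attains_inf[OF compact_K False this]
  obtain p where p: "p \<in> K" "\<And>\<xi>. \<xi> \<in> K \<Longrightarrow> Re p \<le> Re \<xi>" by auto
  have "Re p > 0" using p(1) K_sector by (auto simp: closed_sector_def)
  moreover have "cmod (F (of_real t)) \<le> exp (- Re p * t) * total_mass" if "t > 0" for t
    using cmod_F_le[of "Re p * t" "of_real t"] p(2) that by simp
  ultimately show ?thesis by blast
qed

end

text \<open>\<open>F_0\<close> expresses that \<mu> has integral 0. \<open>F_nonzero\<close> makes
  the supremum of |F| over the positive axis positive, by the identity theorem.\<close>

locale nonzero_semigroup_measure = semigroup_measure +
  assumes F_0: "F 0 = 0" and F_nonzero: "\<exists>z. F z \<noteq> 0"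
begin

lemma F_of_real_nonzero: "\<exists>t>0. F (of_real t) \<noteq> 0"
proof (rule ccontr)
  assume "\<not> ?thesis"
  then have zero: "F z = 0" if "z \<in> of_real ` {0<..}" for z using that by auto
  have "(1 :: complex) islimpt of_real ` {0<..}"
    unfolding islimpt_approachable
  proof (intro allI impI)
    fix e :: real assume "e > 0"
    then show "\<exists>x'\<in>of_real ` {0<..}. x' \<noteq> (1 :: complex) \<and> dist x' 1 < e"
      by (intro bexI[of _ "of_real (1 + e / 2)"] image_eqI[OF refl]) (simp_all add: dist_norm)
  qed
  then have "F z = 0" for z
    using analytic_continuation[OF F_holomorphic[of UNIV] open_UNIV connected_UNIV subset_UNIV UNIV_I _ zero UNIV_I]
    by blast
  then show False using F_nonzero by simp
qed

text \<open>Decay at infinity confines the supremum to a compact interval, and F 0 = 0 excludes its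
  left end point as a maximiser.\<close>

lemma F_attains_max: "\<exists>a>0. F (of_real a) \<noteq> 0 \<and> (\<forall>t>0. cmod (F (of_real t)) \<le> cmod (F (of_real a)))"
proof -
  obtain p where p: "0 < p" "F (of_real p) \<noteq> 0" using F_of_real_nonzero by blast
  obtain d where d: "0 < d" "\<And>t. 0 < t \<Longrightarrow> cmod (F (of_real t)) \<le> exp (- d * t) * total_mass"
    using F_of_real_le by auto
  have "((\<lambda>t. exp (- d * t) * total_mass) \<longlongrightarrow> 0 * total_mass) at_top"
  proof (intro tendsto_intros)
    have "filterlim (\<lambda>t. d * t) at_top at_top"
      by (rule filterlim_tendsto_pos_mult_at_top[OF tendsto_const d(1) filterlim_ident])
    then have "filterlim (\<lambda>t. - d * t) at_bot at_top" by (simp add: filterlim_uminus_at_top)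
    then show "((\<lambda>t. exp (- d * t)) \<longlongrightarrow> 0) at_top" by (rule filterlim_compose[OF exp_at_bot])
  qed
  then have "eventually (\<lambda>t. exp (- d * t) * total_mass < cmod (F (of_real p))) at_top"
    using p by (intro order_tendstoD(2)) auto
  then obtain q where q: "\<And>t. q \<le> t \<Longrightarrow> exp (- d * t) * total_mass < cmod (F (of_real p))"
    by (auto simp: eventually_at_top_linorder)
  \<comment> \<open>Beyond \<open>b\<close> the decay bound is below |F p|, and \<open>p\<close>
    itself lies in the interval, so nothing outside can compete.\<close>
  define b where "b = max p q"
  have "continuous_on {0..b} (\<lambda>t. cmod (F (of_real t)))"
    by (intro continuous_on_norm continuous_on_compose2[OF F_continuous[of UNIV]] continuous_intros) auto
  moreover have "{0..b} \<noteq> {}" using p by (simp add: b_def max_def)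
  ultimately obtain a where a: "a \<in> {0..b}" "\<And>t. t \<in> {0..b} \<Longrightarrow> cmod (F (of_real t)) \<le> cmod (F (of_real a))"
    using continuous_attains_sup[of "{0..b}" "\<lambda>t. cmod (F (of_real t))"] by auto
  have pa: "cmod (F (of_real p)) \<le> cmod (F (of_real a))" using p by (intro a(2)) (simp add: b_def)
  then have "F (of_real a) \<noteq> 0" using p by auto
  moreover from this have "a \<noteq> 0" using F_0 by auto
  moreover have "cmod (F (of_real t)) \<le> cmod (F (of_real a))" if "0 < t" for t
  proof (cases "t \<le> b")
    case True
    then show ?thesis using that by (intro a(2)) simp
  next
    case False
    then have "cmod (F (of_real t)) < cmod (F (of_real p))"
      using q[of t] by (intro le_less_trans[OF d(2)[OF that]]) (simp add: b_def)
    then show ?thesis using pa by linarith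
  qed
  ultimately show ?thesis using a(1) by (intro exI[of _ a]) auto
qed

text \<open>At the maximum \<open>a\<close> the function \<open>F / F a - 1\<close> is real on the real axis and equals
  \<open>(z - a) ^ n * g z\<close> with \<open>g a < 0\<close>, so \<open>F / F a > 1\<close> in the direction \<open>cis (pi / n)\<close>.\<close>

lemma F_growth_direction:
  assumes a: "0 < a" "F (of_real a) \<noteq> 0" and max: "\<And>t. 0 < t \<Longrightarrow> cmod (F (of_real t)) \<le> cmod (F (of_real a))"
  shows "\<exists>\<omega> n r k. 0 < n \<and> 0 < r \<and> 0 < k \<and> cmod \<omega> = 1 \<and>
    (\<forall>s. 0 < s \<longrightarrow> s \<le> r \<longrightarrow> cmod (F (of_real a)) + k * s ^ n \<le> cmod (F (of_real a + of_real s * \<omega>)))"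
proof -
  define f where "f z = F z / F (of_real a) - 1" for z
  have hol: "f holomorphic_on UNIV" unfolding f_def by (intro holomorphic_intros F_holomorphic) (use a in auto)
  \<comment> \<open>Here \<open>f 0 = -1\<close> because F 0 = 0, whereas \<open>f a = 0\<close>;
    hence the zero of \<open>f\<close> at \<open>a\<close> has finite order.\<close>
  have "f 0 \<noteq> f (of_real a)" using a F_0 by (simp add: f_def)
  then have "\<not> f constant_on UNIV" unfolding constant_on_def by (metis UNIV_I)
  moreover have "f (of_real a) = 0" using a by (simp add: f_def)
  ultimately obtain g r n where g: "0 < n" "0 < r" "g holomorphic_on ball (of_real a) r"
    "\<And>w. w \<in> ball (of_real a) r \<Longrightarrow> f w = (w - of_real a) ^ n * g w"
    "\<And>w. w \<in> ball (of_real a) r \<Longrightarrow> g w \<noteq> 0"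
    using holomorphic_factor_zero_nonconstant[OF hol open_UNIV connected_UNIV UNIV_I, of "of_real a"] by metis
  have Freal: "cnj (F (of_real t)) = F (of_real t)" for t using F_cnj[of "of_real t"] by simp
  then have "F (of_real t) \<in> \<real>" for t by (simp add: complex_is_Real_iff complex_eq_iff)
  then have freal: "f (of_real t) \<in> \<real>" for t unfolding f_def by (intro Reals_diff Reals_divide) auto
  have Ref: "Re (f (of_real t)) \<le> 0" if "0 < t" for t
  proof -
    have "Re (F (of_real t) / F (of_real a)) \<le> cmod (F (of_real t) / F (of_real a))" by (rule complex_Re_le_cmod)
    also have "\<dots> \<le> 1" using max[OF that] a by (simp add: norm_divide)
    finally show ?thesis by (simp add: f_def)
  qed
  have gcont: "isCont g (of_real a)"
    using holomorphic_on_imp_continuous_on[OF g(3)] g(2) by (simp add: continuous_on_eq_continuous_at)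
  have lim: "((\<lambda>t. g (of_real t)) \<longlongrightarrow> g (of_real a)) (at_right a)"
  proof (rule isCont_tendsto_compose[OF gcont])
    show "((\<lambda>t. of_real t) \<longlongrightarrow> (of_real a :: complex)) (at_right a)" by (intro tendsto_intros)
  qed
  \<comment> \<open>To the right of \<open>a\<close> the factor (t - a)^n is positive, so
    \<open>g\<close> inherits reality and the sign of \<open>f\<close>. Both pass to the limit, and
    \<open>g a \<noteq> 0\<close> makes the inequality strict.\<close>
  have near: "Im (g (of_real t)) = 0 \<and> Re (g (of_real t)) \<le> 0" if "a < t" "t < a + r" for t
  proof -
    have "of_real t \<in> ball (of_real a :: complex) r"
      using that by (simp add: dist_norm flip: of_real_diff)
    then have eq: "f (of_real t) = of_real ((t - a) ^ n) * g (of_real t)" using g(4) by simp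
    have pos: "0 < (t - a) ^ n" using that by simp
    have "Im (f (of_real t)) = 0" using freal[of t] by (simp add: complex_is_Real_iff)
    moreover have "Re (f (of_real t)) \<le> 0" using Ref that a by simp
    ultimately show ?thesis using that pos unfolding eq by (simp add: mult_le_0_iff)
  qed
  have ev: "eventually (\<lambda>t. a < t \<and> t < a + r) (at_right a)"
    using g(2) eventually_at_right[of a "a + r"] by (auto intro!: exI[of _ "a + r"])
  have "Im (g (of_real a)) = 0"
  proof (rule tendsto_unique[OF _ tendsto_Im[OF lim]])
    show "((\<lambda>t. Im (g (of_real t))) \<longlongrightarrow> 0) (at_right a)"
      by (rule tendsto_eventually) (use ev near in \<open>auto elim: eventually_mono\<close>)
  qed simp
  moreover have "Re (g (of_real a)) \<le> 0"
  proof (rule tendsto_upperbound[OF tendsto_Re[OF lim]])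
    show "eventually (\<lambda>t. Re (g (of_real t)) \<le> 0) (at_right a)"
      using ev near by (auto elim: eventually_mono)
  qed simp
  moreover have "g (of_real a) \<noteq> 0" using g(2,5) by simp
  ultimately have neg: "Re (g (of_real a)) < 0" by (auto simp: complex_eq_iff)
  define c where "c = - Re (g (of_real a)) / 2"
  have c: "0 < c" using neg by (simp add: c_def)
  have "((\<lambda>z. Re (g z)) \<longlongrightarrow> Re (g (of_real a))) (at (of_real a))"
    using gcont by (intro tendsto_Re) (simp add: isCont_def)
  then have "eventually (\<lambda>z. Re (g z) < - c) (at (of_real a))"
    by (rule order_tendstoD(2)) (use neg in \<open>simp add: c_def\<close>)
  then obtain e where e: "0 < e" "\<And>z. z \<noteq> of_real a \<Longrightarrow> dist z (of_real a) < e \<Longrightarrow> Re (g z) < - c"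
    unfolding eventually_at by auto
  define \<omega> where "\<omega> = cis (pi / n)"
  have \<omega>n: "\<omega> ^ n = - 1" unfolding \<omega>_def Complex.DeMoivre using g(1) by simp
  define q where "q = min e r / 2"
  have q: "0 < q" "q < e" "q < r" using e g by (auto simp: q_def min_def)
  have "cmod (F (of_real a)) + (cmod (F (of_real a)) * c) * s ^ n \<le> cmod (F (of_real a + of_real s * \<omega>))"
    if s: "0 < s" "s \<le> q" for s
  proof -
    let ?z = "of_real a + of_real s * \<omega>"
    have d: "dist ?z (of_real a) = s" using s by (simp add: dist_norm norm_mult \<omega>_def)
    then have "?z \<noteq> of_real a" using s by auto
    then have gz: "Re (g ?z) < - c" using e(2) d s q by simp
    have "?z \<in> ball (of_real a) r" using d s q by (simp add: dist_commute)
    then have "f ?z = (of_real s * \<omega>) ^ n * g ?z" using g(4) by simp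
    then have fz: "f ?z = of_real (s ^ n) * - g ?z" by (simp add: power_mult_distrib \<omega>n)
    have "s ^ n * c \<le> s ^ n * - Re (g ?z)" using gz s by (intro mult_left_mono) auto
    then have "1 + s ^ n * c \<le> Re (F ?z / F (of_real a))"
      using arg_cong[OF fz, of Re] by (simp add: f_def)
    also have "\<dots> \<le> cmod (F ?z) / cmod (F (of_real a))"
      by (metis complex_Re_le_cmod norm_divide)
    finally show ?thesis using a by (simp add: field_simps)
  qed
  moreover have "0 < cmod (F (of_real a)) * c" using a c by simp
  moreover have "cmod \<omega> = 1" by (simp add: \<omega>_def)
  ultimately show ?thesis using q(1) g(1) by blast
qed

text \<open>\<open>B\<close> carries a lower bound for \<open>z + u A\<close> that degenerates only at \<open>a\<close>, uniformly in \<open>u\<close>.\<close>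

definition barrier :: "real \<Rightarrow> nat \<Rightarrow> complex set \<Rightarrow> bool"
  where "barrier a n B \<longleftrightarrow> (\<exists>C\<ge>0. \<forall>z\<in>B. \<forall>u\<in>open_sector (\<alpha> - \<beta>).
    norm (fourier_borel_op \<mu> K T u) \<le> cmod (F (of_real a)) \<longrightarrow>
    (\<forall>d\<in>S. \<forall>v. cmod (z - of_real a) ^ n * norm (blinfun_apply (T d) v) \<le> C * norm (res u d z v)))"

lemma barrier_Un:
  assumes "barrier a n A" "barrier a n B" shows "barrier a n (A \<union> B)"
proof -
  let ?P = "\<lambda>C X. \<forall>z\<in>X. \<forall>u\<in>open_sector (\<alpha> - \<beta>).
    norm (fourier_borel_op \<mu> K T u) \<le> cmod (F (of_real a)) \<longrightarrow>
    (\<forall>d\<in>S. \<forall>v. cmod (z - of_real a) ^ n * norm (blinfun_apply (T d) v) \<le> C * norm (res u d z v))"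
  have mono: "?P C' X" if P: "?P C X" and CC: "C \<le> C'" for C C' X
  proof (intro ballI impI allI)
    fix z u d v
    assume "z \<in> X" "u \<in> open_sector (\<alpha> - \<beta>)" "norm (fourier_borel_op \<mu> K T u) \<le> cmod (F (of_real a))" "d \<in> S"
    then have "cmod (z - of_real a) ^ n * norm (blinfun_apply (T d) v) \<le> C * norm (res u d z v)" using P by blast
    also have "\<dots> \<le> C' * norm (res u d z v)" by (rule mult_right_mono[OF CC norm_ge_zero])
    finally show "cmod (z - of_real a) ^ n * norm (blinfun_apply (T d) v) \<le> C' * norm (res u d z v)" .
  qed
  obtain C C' where C: "0 \<le> C" "?P C A" "0 \<le> C'" "?P C' B" using assms unfolding barrier_def by blast
  have "?P (max C C') A" "?P (max C C') B" by (rule mono[OF C(2)], simp, rule mono[OF C(4)], simp)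
  then have "?P (max C C') (A \<union> B)" by blast
  moreover have "0 \<le> max C C'" using C by simp
  ultimately show ?thesis unfolding barrier_def by blast
qed

text \<open>The assumed bound on \<open>norm (fourier_borel_op \<mu> K T u)\<close> turns the excess
  of |F z| over |F a| into a positive coefficient of \<open>norm (T d v)\<close>; this is the origin
  of the weight |z - a|^n.\<close>

lemma barrier_transform:
  assumes "bounded B" "0 < k"
    and B: "\<And>z. z \<in> B \<Longrightarrow> cmod (F (of_real a)) + k * cmod (z - of_real a) ^ n \<le> cmod (F z)"
  shows "barrier a n B"
proof -
  obtain L where L: "0 < L" "\<And>z. z \<in> B \<Longrightarrow> cmod z \<le> L" using assms(1) by (auto simp: bounded_pos)
  let ?E = "exp (2 * (L * R)) * R * M * total_mass"
  have E: "0 \<le> ?E" using R M by simp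
  have "cmod (z - of_real a) ^ n * norm (blinfun_apply (T d) v) \<le> ?E / k * norm (res u d z v)"
    if z: "z \<in> B" and u: "u \<in> open_sector (\<alpha> - \<beta>)"
      and le: "norm (fourier_borel_op \<mu> K T u) \<le> cmod (F (of_real a))" and d: "d \<in> S" for z u d v
  proof -
    have "k * cmod (z - of_real a) ^ n * norm (blinfun_apply (T d) v) \<le>
        (cmod (F z) - norm (fourier_borel_op \<mu> K T u)) * norm (blinfun_apply (T d) v)"
      using B[OF z] le by (intro mult_right_mono) auto
    also have "\<dots> \<le> exp (2 * (cmod z * R)) * R * M * total_mass * norm (res u d z v)"
      by (rule norm_le_res_transform[OF u d])
    also have "\<dots> \<le> ?E * norm (res u d z v)"
      using L(2)[OF z] R(1) M(1) by (intro mult_right_mono) auto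
    finally show ?thesis using \<open>0 < k\<close> by (simp add: field_simps)
  qed
  moreover have "0 \<le> ?E / k" using E \<open>0 < k\<close> by simp
  ultimately show ?thesis unfolding barrier_def by blast
qed

text \<open>No degeneration occurs here; the weight is merely bounded by
  \<open>(L + \<bar>a\<bar>) ^ n\<close> on \<open>B\<close> and absorbed into the constant.\<close>

lemma barrier_half_plane:
  assumes "bounded B" "0 < k" and c: "c \<in> closed_sector \<beta>" and B: "\<And>z. z \<in> B \<Longrightarrow> k \<le> - Re (z * c)"
  shows "barrier a n B"
proof -
  obtain L where L: "0 < L" "\<And>z. z \<in> B \<Longrightarrow> cmod z \<le> L" using assms(1) by (auto simp: bounded_pos)
  let ?L = "(L + \<bar>a\<bar>) ^ n"
  have "cmod (z - of_real a) ^ n * norm (blinfun_apply (T d) v) \<le> ?L * (cmod c * M) / k * norm (res u d z v)"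
    if z: "z \<in> B" and u: "u \<in> open_sector (\<alpha> - \<beta>)" and d: "d \<in> S" for z u d v
  proof -
    have "k * norm (blinfun_apply (T d) v) \<le> - Re (z * c) * norm (blinfun_apply (T d) v)"
      using B[OF z] by (intro mult_right_mono) auto
    also have "\<dots> \<le> cmod c * M * norm (res u d z v)"
      using B[OF z] \<open>0 < k\<close> by (intro norm_le_res_half_plane mult_in_S u c d) simp
    finally have y: "norm (blinfun_apply (T d) v) \<le> cmod c * M * norm (res u d z v) / k"
      using \<open>0 < k\<close> by (simp add: field_simps)
    have "cmod (z - of_real a) \<le> L + \<bar>a\<bar>"
      using norm_triangle_ineq4[of z "of_real a"] L(2)[OF z] by simp
    then have "cmod (z - of_real a) ^ n * norm (blinfun_apply (T d) v) \<le> ?L * (cmod c * M * norm (res u d z v) / k)"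
      using y L by (intro mult_mono power_mono) auto
    then show ?thesis by (simp add: mult_ac)
  qed
  moreover have "0 \<le> ?L * (cmod c * M) / k" using L M \<open>0 < k\<close> by simp
  ultimately show ?thesis unfolding barrier_def by blast
qed

lemma barrier_transform_cnj:
  assumes "bounded B" "0 < k"
    and B: "\<And>z. z \<in> B \<Longrightarrow> cmod (F (of_real a)) + k * cmod (z - of_real a) ^ n \<le> cmod (F z)"
  shows "barrier a n (B \<union> cnj ` B)"
proof (rule barrier_transform[OF _ assms(2)])
  show "bounded (B \<union> cnj ` B)" using assms(1) unfolding bounded_iff by auto
  fix z assume "z \<in> B \<union> cnj ` B"
  then consider "z \<in> B" | w where "w \<in> B" "z = cnj w" by blast
  then show "cmod (F (of_real a)) + k * cmod (z - of_real a) ^ n \<le> cmod (F z)"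
  proof cases
    case 2
    have "cmod (cnj w - of_real a) = cmod (w - of_real a)"
      by (metis complex_cnj_complex_of_real complex_cnj_diff complex_mod_cnj)
    then show ?thesis using B[OF 2(1)] by (simp add: 2(2) F_cnj)
  qed (rule B)
qed

lemma cnj_closed_sector: "c \<in> closed_sector \<beta> \<Longrightarrow> cnj c \<in> closed_sector \<beta>"
  using arg_conv_arctan[of c] arg_conv_arctan[of "cnj c"] by (auto simp: closed_sector_def arctan_minus)

text \<open>Conjugation turns \<open>c\<close> into \<open>cnj c\<close>, which again lies in the
  sector, so the reflected set is covered by the reflected half-plane.\<close>

lemma barrier_half_plane_cnj:
  assumes "bounded B" "0 < k" and c: "c \<in> closed_sector \<beta>" and B: "\<And>z. z \<in> B \<Longrightarrow> k \<le> - Re (z * c)"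
  shows "barrier a n (B \<union> cnj ` B)"
proof (rule barrier_Un[OF barrier_half_plane[OF assms]])
  show "barrier a n (cnj ` B)"
  proof (rule barrier_half_plane[OF _ assms(2) cnj_closed_sector[OF c]])
    show "bounded (cnj ` B)" using assms(1) unfolding bounded_iff by auto
    fix z assume "z \<in> cnj ` B"
    then show "k \<le> - Re (z * cnj c)" using B by auto
  qed
qed

text \<open>The path has three pieces: the segment from \<open>a\<close> to \<open>p\<close>, where
  the growth of |F| supplies the bound; a path inside \<open>V\<close>, where compactness supplies a
  positive excess; and a segment from \<open>q\<close> to -1, which stays in one half-plane Re (z c)
  < 0.\<close>

lemma barrier_exists:
  assumes a: "0 < a" "F (of_real a) \<noteq> 0" and max: "\<And>t. 0 < t \<Longrightarrow> cmod (F (of_real t)) \<le> cmod (F (of_real a))"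
  shows "\<exists>n B. compact B \<and> 0 \<in> inside B \<and> barrier a n B"
proof -
  define m where "m = cmod (F (of_real a))"
  have m: "0 < m" using a by (simp add: m_def)
  obtain \<omega> n r k where n: "0 < n" "0 < r" "0 < k" "cmod \<omega> = 1"
    and grow: "\<And>s. 0 < s \<Longrightarrow> s \<le> r \<Longrightarrow> m + k * s ^ n \<le> cmod (F (of_real a + of_real s * \<omega>))"
    using F_growth_direction[OF a max] unfolding m_def by blast
  define p where "p = of_real a + of_real r * \<omega>"
  have p: "m < cmod (F p)"
  proof -
    have "0 < k * r ^ n" using n by simp
    then show ?thesis using grow[of r] n(2) unfolding p_def by linarith
  qed
  define V where "V = connected_component_set {z. cmod (F z) > m} p"
  have openU: "open {z. cmod (F z) > m}" by (intro open_Collect_less continuous_intros F_continuous)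
  have pV: "p \<in> V" using p by (simp add: V_def)
  have VU: "m < cmod (F z)" if "z \<in> V" for z
    using that connected_component_subset[of "{z. cmod (F z) > m}" p] by (auto simp: V_def)
  \<comment> \<open>Otherwise \<open>Re (z * \<xi>) \<ge> 0\<close> for all \<open>z\<close> in
    \<open>V\<close> and \<xi> in \<open>K\<close>. Then |F| is at most \<open>total_mass\<close> on
    \<open>V\<close>, and \<open>V\<close> lies in the right half-plane, which the Phragmen-Lindelof
    argument rules out.\<close>
  have "\<exists>q\<in>V. \<exists>c\<in>closed_sector \<beta>. Re (q * c) < 0"
  proof (rule ccontr)
    assume "\<not> ?thesis"
    then have pos: "\<And>z c. z \<in> V \<Longrightarrow> c \<in> closed_sector \<beta> \<Longrightarrow> 0 \<le> Re (z * c)" by (meson not_le)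
    have one: "1 \<in> closed_sector \<beta>" using \<beta> by (simp add: closed_sector_def)
    show False
    proof (rule bounded_on_component_half_plane[OF F_holomorphic m V_def p])
      show "0 \<le> Re z" if "z \<in> V" for z using pos[OF that one] by simp
      show "cmod (F z) \<le> total_mass" if "z \<in> V" for z
        using cmod_F_le[of 0 z] pos[OF that] K_sector by auto
    qed
  qed
  then obtain q c where q: "q \<in> V" and c: "c \<in> closed_sector \<beta>" "Re (q * c) < 0" by blast
  have "path_connected V"
    unfolding V_def using openU
    by (intro connected_open_path_connected open_connected_component connected_connected_component)
  then obtain \<gamma> where \<gamma>: "path \<gamma>" "path_image \<gamma> \<subseteq> V" "pathstart \<gamma> = p" "pathfinish \<gamma> = q"
    using pV q unfolding path_connected_def by blast
  define A where "A = closed_segment (of_real a) p"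
  define D where "D = closed_segment q (- 1)"
  \<comment> \<open>The two terms are the values of -Re (z c) at the end points \<open>q\<close> and
    -1; as the function is affine, their minimum bounds it on the whole segment.\<close>
  define \<kappa> where "\<kappa> = min (- Re (q * c)) (Re c)"
  have \<kappa>: "0 < \<kappa>" using c by (auto simp: \<kappa>_def closed_sector_def)
  have A: "m + k * cmod (z - of_real a) ^ n \<le> cmod (F z)" if "z \<in> A" for z
  proof -
    obtain t where t: "0 \<le> t" "t \<le> 1" "z = (1 - t) *\<^sub>R of_real a + t *\<^sub>R p"
      using \<open>z \<in> A\<close> by (auto simp: A_def in_segment)
    then have z: "z = of_real a + of_real (t * r) * \<omega>"
      by (simp add: p_def scaleR_conv_of_real algebra_simps)
    then have d: "cmod (z - of_real a) = t * r" using t n by (simp add: norm_mult)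
    show ?thesis
    proof (cases "t = 0")
      case True
      then show ?thesis using z n by (simp add: m_def zero_power)
    next
      case False
      have "t * r \<le> 1 * r" using t n by (intro mult_right_mono) auto
      then show ?thesis using grow[of "t * r"] False t n unfolding d by (simp add: z)
    qed
  qed
  have D: "\<kappa> \<le> - Re (z * c)" if "z \<in> D" for z
  proof -
    obtain t where t: "0 \<le> t" "t \<le> 1" "z = (1 - t) *\<^sub>R q + t *\<^sub>R (- 1)"
      using \<open>z \<in> D\<close> by (auto simp: D_def in_segment)
    have "(1 - t) * \<kappa> + t * \<kappa> \<le> (1 - t) * (- Re (q * c)) + t * Re c"
      using t by (intro add_mono mult_left_mono) (auto simp: \<kappa>_def)
    also have "\<dots> = - Re (z * c)" unfolding t(3) by (simp add: algebra_simps)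
    finally show ?thesis by (simp add: algebra_simps)
  qed
  have "\<exists>k'>0. \<forall>z\<in>path_image \<gamma>. m + k' * cmod (z - of_real a) ^ n \<le> cmod (F z)"
  proof -
    have comp: "compact (path_image \<gamma>)" using \<gamma>(1) by (rule compact_path_image)
    have "continuous_on (path_image \<gamma>) (\<lambda>z. cmod (F z))" by (intro continuous_intros F_continuous)
    then obtain w where w: "w \<in> path_image \<gamma>" "\<And>z. z \<in> path_image \<gamma> \<Longrightarrow> cmod (F w) \<le> cmod (F z)"
      using continuous_attains_inf[OF comp path_image_nonempty] by blast
    have "bounded ((\<lambda>z. z - of_real a) ` path_image \<gamma>)"
      by (intro compact_imp_bounded compact_continuous_image comp continuous_intros)
    then obtain L where L: "0 < L" "\<And>z. z \<in> path_image \<gamma> \<Longrightarrow> cmod (z - of_real a) \<le> L"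
      by (auto simp: bounded_pos)
    \<comment> \<open>On the compact path the excess has a positive minimum; dividing by L^n puts it
      in the weighted form used near \<open>a\<close>.\<close>
    define k' where "k' = (cmod (F w) - m) / L ^ n"
    have wm: "m < cmod (F w)" using VU w(1) \<gamma>(2) by blast
    have k': "0 < k'" using wm L by (simp add: k'_def)
    have "m + k' * cmod (z - of_real a) ^ n \<le> cmod (F z)" if "z \<in> path_image \<gamma>" for z
    proof -
      have "k' * cmod (z - of_real a) ^ n \<le> k' * L ^ n"
        using k' L(2)[OF that] by (intro mult_left_mono power_mono) auto
      also have "\<dots> = cmod (F w) - m" using L by (simp add: k'_def)
      finally show ?thesis using w(2)[OF that] by linarith
    qed
    with k' show ?thesis by blast
  qed
  then obtain k' where k': "0 < k'" "\<And>z. z \<in> path_image \<gamma> \<Longrightarrow> m + k' * cmod (z - of_real a) ^ n \<le> cmod (F z)"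
    by blast
  define l where "l = linepath (of_real a) p +++ (\<gamma> +++ linepath q (- 1))"
  have l: "path l" "pathstart l = of_real a" "pathfinish l = of_real (- 1)"
    using \<gamma> by (simp_all add: l_def)
  have img: "path_image l = A \<union> (path_image \<gamma> \<union> D)"
    using \<gamma> by (simp add: l_def path_image_join A_def D_def)
  have pos: "F z \<noteq> 0" if "m + j * cmod (z - of_real a) ^ n \<le> cmod (F z)" "0 < j" for z j
  proof -
    have "0 \<le> j * cmod (z - of_real a) ^ n" using that(2) by simp
    then have "0 < cmod (F z)" using that(1) m by linarith
    then show ?thesis by simp
  qed
  \<comment> \<open>On the first two pieces |F| is at least \<open>m > 0\<close> while F 0 = 0; on
    the last, -Re (z c) is at least \<kappa> > 0.\<close>
  have l0: "0 \<notin> path_image l"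
    unfolding img using pos[OF A n(3)] pos[OF k'(2) k'(1)] D[of 0] \<kappa> F_0 by auto
  define B where "B = path_image l \<union> cnj ` path_image l"
  have "compact B"
    unfolding B_def using l by (intro compact_Un compact_path_image compact_continuous_image continuous_intros)
  moreover have "0 \<in> inside B"
    unfolding B_def by (rule inside_path_union_cnj[OF l(1,2,3) a(1) _ l0]) simp
  moreover have "barrier a n B"
  proof -
    have B: "B = (A \<union> cnj ` A) \<union> ((path_image \<gamma> \<union> cnj ` path_image \<gamma>) \<union> (D \<union> cnj ` D))"
      unfolding B_def img by (simp only: image_Un Un_ac)
    have bdd: "bounded A" "bounded (path_image \<gamma>)" "bounded D"
      using \<gamma> by (simp_all add: A_def D_def bounded_closed_segment bounded_path_image)
    show ?thesis
      unfolding B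
      by (intro barrier_Un barrier_transform_cnj[OF bdd(1) n(3) A[unfolded m_def]]
        barrier_transform_cnj[OF bdd(2) k'(1) k'(2)[unfolded m_def]] barrier_half_plane_cnj[OF bdd(3) \<kappa> c(1) D])
  qed
  ultimately show ?thesis by blast
qed

lemma norm_orbit_integral_barrier_le:
  assumes B: "compact B" "0 \<in> inside B" and d: "0 < d" and n: "0 \<le> n" and u: "u \<noteq> 0"
    and bd: "\<And>z. z \<in> B \<Longrightarrow> cmod (z - of_real a) ^ k * norm (orbit_integral d x n (z / u)) \<le> C"
  shows "\<bar>a\<bar> ^ k * norm (orbit_integral d x n 0) \<le> C"
proof -
  define \<phi> where "\<phi> s z = (z - of_real a) ^ k * exp (z / u * of_real s)" for s :: real and z
  define y where "y s = blinfun_apply (T (of_real (s + d))) x" for s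
  define h where "h z = integral {0..n} (\<lambda>s. scaleC (\<phi> s z) (y s))" for z
  have y: "continuous_on {0..n} y" unfolding y_def by (rule continuous_on_orbit[OF d])
  have h: "h z = - scaleC ((z - of_real a) ^ k) (orbit_integral d x n (z / u))" for z
  proof -
    have "(\<lambda>s. scaleC (exp (z / u * of_real s)) (y s)) integrable_on {0..n}"
      by (intro integrable_continuous_real continuous_intros y) (use u in auto)
    from integral_linear[OF this bounded_linear_scaleC_right]
    show ?thesis
      by (simp add: h_def \<phi>_def orbit_integral_def y_def o_def scaleC_scaleC scaleC.minus_right)
  qed
  have \<phi>c: "continuous_on X (\<lambda>x. \<phi> (f x) (g x))" if "continuous_on X f" "continuous_on X g"
    for X :: "'x::topological_space set" and f g
    unfolding \<phi>_def by (intro continuous_intros that) (use u in auto)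
  have hc: "continuous_on X h" for X
  proof -
    have "continuous_on X (\<lambda>z. integral (cbox 0 n) (\<lambda>s. scaleC (\<phi> s z) (y s)))"
      by (rule integral_continuous_on_param, unfold case_prod_beta)
        (intro continuous_intros \<phi>c continuous_on_compose2[OF y], auto)
    then show ?thesis by (simp add: h_def[abs_def])
  qed
  have "norm (h 0) \<le> C"
  proof (rule maximum_principle_mean_value[where h = h and W = "inside B"])
    show "open (inside B)" by (rule open_inside[OF compact_imp_closed[OF B(1)]])
    show "bounded (inside B)" by (rule bounded_inside[OF compact_imp_bounded[OF B(1)]])
    show "continuous_on (closure (inside B)) h" by (rule hc)
    show "0 \<in> inside B" by (rule B(2))
    show "norm (h z) \<le> C" if "z \<in> frontier (inside B)" for z
      using frontier_inside_subset[OF compact_imp_closed[OF B(1)]] that bd[of z]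
      by (auto simp: h norm_scaleC norm_power)
    show "integral {0..1} (\<lambda>t. h (z + of_real r * cis (2 * pi * t))) = h z" for z r
      unfolding h_def
    proof (rule mean_value_integral[OF _ _ y])
      show "\<phi> s holomorphic_on UNIV" for s
        unfolding \<phi>_def by (intro holomorphic_intros) (use u in auto)
      show "continuous_on UNIV (\<lambda>(s, z). \<phi> s z)"
        unfolding case_prod_beta by (intro \<phi>c continuous_intros)
    qed
  qed
  then show ?thesis by (simp add: h norm_scaleC norm_power)
qed

lemma transform_lower_bound:
  assumes qn: "op_spectral_radius (T 1) = 0" and nontrivial: "t0 \<in> S" "T t0 \<noteq> 0"
    and a: "0 < a" "F (of_real a) \<noteq> 0" and max: "\<And>t. 0 < t \<Longrightarrow> cmod (F (of_real t)) \<le> cmod (F (of_real a))"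
  shows "\<exists>\<eta>>0. \<forall>u\<in>open_sector (\<alpha> - \<beta>). cmod u \<le> \<eta> \<longrightarrow>
    cmod (F (of_real a)) < norm (fourier_borel_op \<mu> K T u)"
proof -
  obtain k B where B: "compact B" "0 \<in> inside B" "barrier a k B" using barrier_exists[OF a max] by blast
  obtain C where C: "0 \<le> C" "\<And>z u d v. z \<in> B \<Longrightarrow> u \<in> open_sector (\<alpha> - \<beta>) \<Longrightarrow>
      norm (fourier_borel_op \<mu> K T u) \<le> cmod (F (of_real a)) \<Longrightarrow> d \<in> S \<Longrightarrow>
      cmod (z - of_real a) ^ k * norm (blinfun_apply (T d) v) \<le> C * norm (res u d z v)"
    using B(3) unfolding barrier_def by blast
  obtain e where e: "0 < e" "cball t0 e \<subseteq> S" using open_S nontrivial(1) by (auto simp: open_contains_cball)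
  \<comment> \<open>Three units of smoothing are spent: one inside the orbit integral, one for the
    operator T(d) in the barrier estimate, one for the final \<open>D d\<close>. Room in the open
    sector gives T(3d) \<noteq> 0, since T(t0) factors through it.\<close>
  define d where "d = e / 3"
  have d: "0 < d" using e by (simp add: d_def)
  have "t0 - of_real (3 * d) \<in> cball t0 e" using e by (simp add: d_def dist_norm)
  then have "t0 - of_real (3 * d) \<in> S" using e(2) by blast
  then have "T (t0 - of_real (3 * d) + of_real (3 * d)) = T (t0 - of_real (3 * d)) o\<^sub>L T (of_real (3 * d))"
    using d by (intro T_add S_of_real) simp_all
  then have "T (of_real (3 * d)) \<noteq> 0" using nontrivial(2) by auto
  then obtain x where x: "blinfun_apply (T (of_real (3 * d))) x \<noteq> 0"
    by (metis blinfun_eq_iff blinfun.zero_left)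
  \<comment> \<open>The summand 1 accommodates the cut-off term \<open>?E\<close>, which is of norm
    at most 1 for large \<open>n\<close>.\<close>
  define X where "X = norm (blinfun_apply (T (of_real (2 * d))) x) + 1"
  define \<Delta> where "\<Delta> = norm (D (of_real d)) * (C * X / a ^ k)"
  have X: "0 < X" by (simp add: X_def add_nonneg_pos)
  have \<Delta>: "0 \<le> \<Delta>" using C X a by (simp add: \<Delta>_def)
  obtain L where L: "0 < L" "\<And>z. z \<in> B \<Longrightarrow> cmod z \<le> L"
    using compact_imp_bounded[OF B(1)] by (auto simp: bounded_pos)
  have key: "norm (blinfun_apply (T (of_real (3 * d))) x) \<le> \<Delta> * cmod u"
    if u: "u \<in> open_sector (\<alpha> - \<beta>)" and le: "norm (fourier_borel_op \<mu> K T u) \<le> cmod (F (of_real a))" for u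
  proof -
    have u0: "u \<noteq> 0" using u by (auto simp: open_sector_def)
    have dS: "of_real d \<in> S" using d by simp
    \<comment> \<open>For \<open>z\<close> in \<open>B\<close> the exponential e^(zn/u) has modulus
      at most e^(Ln/|u|). The rate depends on \<open>u\<close>, but \<open>u\<close> is fixed while
      \<open>n\<close> grows.\<close>
    have "eventually (\<lambda>n. exp (L / cmod u * real n) * norm (blinfun_apply (T (of_real (real n + 2 * d))) x) < 1) sequentially"
      using orbit_decay[OF qn, of "2 * d" "L / cmod u" x] d by (intro order_tendstoD(2)) auto
    then have ev: "eventually (\<lambda>n. norm (blinfun_apply (T (of_real (3 * d))) x) \<le>
        norm (blinfun_apply (T (of_real (real n + 3 * d))) x) + \<Delta> * cmod u) sequentially"
    proof eventually_elim
      case (elim n)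
      have bd: "cmod (z - of_real a) ^ k * norm (orbit_integral (2 * d) x (real n) (z / u)) \<le> C * (cmod u * X)"
        if z: "z \<in> B" for z
      proof -
        let ?v = "orbit_integral d x (real n) (z / u)"
        let ?E = "scaleC (exp (z / u * of_real (real n))) (blinfun_apply (T (of_real (real n + 2 * d))) x)"
        have "res u (of_real d) z ?v = scaleC u (blinfun_apply (T (of_real (2 * d))) x - ?E)"
          using res_orbit_integral[OF d d, of "real n" u "z / u" x] u0 by simp
        moreover have "norm ?E \<le> 1"
        proof -
          have "Re (z / u) \<le> L / cmod u"
            using complex_Re_le_cmod[of "z / u"] divide_right_mono[OF L(2)[OF z], of "cmod u"]
            by (simp add: norm_divide)
          then have "Re (z / u) * real n \<le> L / cmod u * real n" by (rule mult_right_mono) simp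
          moreover have "Re (w * of_real r) = Re w * r" for w r by simp
          ultimately have "Re (z / u * of_real (real n)) \<le> L / cmod u * real n" by (simp only:)
          then have "cmod (exp (z / u * of_real (real n))) \<le> exp (L / cmod u * real n)"
            unfolding norm_exp_eq_Re by (simp only: exp_le_cancel_iff)
          then have "norm ?E \<le> exp (L / cmod u * real n) * norm (blinfun_apply (T (of_real (real n + 2 * d))) x)"
            unfolding norm_scaleC by (rule mult_right_mono) simp
          then show ?thesis using elim by linarith
        qed
        then have "norm (blinfun_apply (T (of_real (2 * d))) x - ?E) \<le> X"
          using norm_triangle_ineq4[of "blinfun_apply (T (of_real (2 * d))) x" ?E] by (simp add: X_def)
        ultimately have "norm (res u (of_real d) z ?v) \<le> cmod u * X"
          by (simp add: norm_scaleC mult_left_mono)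
        then have "C * norm (res u (of_real d) z ?v) \<le> C * (cmod u * X)" by (rule mult_left_mono[OF _ C(1)])
        moreover have "blinfun_apply (T (of_real d)) ?v = orbit_integral (2 * d) x (real n) (z / u)"
          using T_orbit_integral[OF d d] by simp
        ultimately show ?thesis using C(2)[OF z u le dS, of ?v] by simp
      qed
      have "\<bar>a\<bar> ^ k * norm (orbit_integral (2 * d) x (real n) 0) \<le> C * (cmod u * X)"
        by (rule norm_orbit_integral_barrier_le[OF B(1,2) _ _ u0 bd]) (use d in auto)
      then have small: "norm (orbit_integral (2 * d) x (real n) 0) \<le> C * X / a ^ k * cmod u"
        using a by (simp add: field_simps)
      \<comment> \<open>At 0 only the term with \<open>D d\<close> remains, the smoothed form of A y
        = x. Its left side is O(|u|) by \<open>small\<close>, while T(3d) x does not depend on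
        \<open>u\<close>.\<close>
      have "res u (of_real d) (u * 0) (orbit_integral (2 * d) x (real n) 0) =
          scaleC u (blinfun_apply (T (of_real (3 * d))) x - blinfun_apply (T (of_real (real n + 3 * d))) x)"
        using res_orbit_integral[of "2 * d" d "real n" u 0 x] d by simp
      then have "scaleC u (blinfun_apply (D (of_real d)) (orbit_integral (2 * d) x (real n) 0) -
          (blinfun_apply (T (of_real (3 * d))) x - blinfun_apply (T (of_real (real n + 3 * d))) x)) = 0"
        by (simp add: res_def scaleC.zero_left scaleC.diff_right)
      then have eq: "blinfun_apply (D (of_real d)) (orbit_integral (2 * d) x (real n) 0) =
          blinfun_apply (T (of_real (3 * d))) x - blinfun_apply (T (of_real (real n + 3 * d))) x"
        using u0 by (simp add: scaleC_eq_0_iff)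
      have "norm (blinfun_apply (D (of_real d)) (orbit_integral (2 * d) x (real n) 0)) \<le>
          norm (D (of_real d)) * (C * X / a ^ k * cmod u)"
        by (rule order.trans[OF norm_blinfun mult_left_mono[OF small norm_ge_zero]])
      then have "norm (blinfun_apply (T (of_real (3 * d))) x - blinfun_apply (T (of_real (real n + 3 * d))) x) \<le> \<Delta> * cmod u"
        unfolding eq by (simp add: \<Delta>_def mult.assoc)
      then show ?case
        using norm_triangle_sub[of "blinfun_apply (T (of_real (3 * d))) x"
          "blinfun_apply (T (of_real (real n + 3 * d))) x"] by linarith
    qed
    have "(\<lambda>n. norm (blinfun_apply (T (of_real (real n + 3 * d))) x) + \<Delta> * cmod u) \<longlonglongrightarrow> 0 + \<Delta> * cmod u"
      using orbit_decay[OF qn, of "3 * d" 0 x] d by (intro tendsto_intros) simp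
    from tendsto_lowerbound[OF this ev] show ?thesis by simp
  qed
  \<comment> \<open>The 1 added to \<Delta> avoids division by zero; the 2 bounds the norm of T(3d)
    x by half of itself, a contradiction.\<close>
  define \<eta> where "\<eta> = norm (blinfun_apply (T (of_real (3 * d))) x) / (2 * (\<Delta> + 1))"
  have \<eta>: "0 < \<eta>" using x \<Delta> by (simp add: \<eta>_def)
  have "cmod (F (of_real a)) < norm (fourier_borel_op \<mu> K T u)"
    if u: "u \<in> open_sector (\<alpha> - \<beta>)" "cmod u \<le> \<eta>" for u
  proof (rule ccontr)
    assume "\<not> ?thesis"
    then have "norm (blinfun_apply (T (of_real (3 * d))) x) \<le> \<Delta> * cmod u" using key[OF u(1)] by simp
    also have "\<dots> \<le> (\<Delta> + 1) * \<eta>" using u \<Delta> by (intro mult_mono) auto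
    also have "\<dots> = norm (blinfun_apply (T (of_real (3 * d))) x) / 2"
      using \<Delta> by (simp add: \<eta>_def field_simps)
    finally show False using x by simp
  qed
  with \<eta> show ?thesis by blast
qed

end

theorem theorem4p5:
  fixes \<alpha> \<beta> :: real
    and T :: "complex \<Rightarrow> ('a::complex_banach \<Rightarrow>\<^sub>L 'a)"
    and A :: "('a \<times> 'a) set"
    and \<mu> :: "complex set \<Rightarrow> complex"
    and K :: "complex set"
    and F :: "complex \<Rightarrow> complex"
  assumes "0 < \<alpha>" "\<alpha> < pi / 2"
    and "analytic_semigroup \<alpha> T"
    and "bounded (T ` open_sector \<alpha>)"
    and "\<exists>t\<in>open_sector \<alpha>. T t \<noteq> 0"
    and "\<forall>t\<in>open_sector \<alpha>. op_spectral_radius (T t) = 0"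
    and "A = infinitesimal_generator T"
    and "0 < \<beta>" "\<beta> < \<alpha>"
    and "compact K" "K \<subseteq> closed_sector \<beta>"
    and "complex_borel_measure \<mu>" "symmetric_measure \<mu>" "measure_supported_on \<mu> K"
    and "complex_bochner_integral \<mu> K (\<lambda>\<xi>. 1 :: complex) = 0"
    and "F = fourier_borel_transform \<mu> K"
    and "\<exists>z. F z \<noteq> 0"
  shows "\<exists>\<eta>>0. \<forall>u\<in>open_sector (\<alpha> - \<beta>). cmod u \<le> \<eta> \<longrightarrow>
    norm (fourier_borel_op \<mu> K T u) > (SUP t\<in>{0<..}. cmod (F (complex_of_real t)))"
proof -
  \<comment> \<open>F 0 = 0 is the assumption on the integral of the constant 1, as the kernel e^(-z
    \<xi>) is 1 at z = 0.\<close>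
  interpret nonzero_semigroup_measure \<alpha> T \<mu> \<beta> K
    by unfold_locales (use assms in \<open>auto simp: fourier_borel_transform_def\<close>)
  obtain a where a: "0 < a" "fourier_borel_transform \<mu> K (of_real a) \<noteq> 0"
    and max: "\<And>t. 0 < t \<Longrightarrow> cmod (fourier_borel_transform \<mu> K (of_real t)) \<le> cmod (fourier_borel_transform \<mu> K (of_real a))"
    using F_attains_max by blast
  have sup: "(SUP t\<in>{0<..}. cmod (F (complex_of_real t))) = cmod (F (of_real a))"
    unfolding assms(16) using a(1) max by (intro cSup_eq_maximum) auto
  obtain t0 where "t0 \<in> open_sector \<alpha>" "T t0 \<noteq> 0" using assms(5) by blast
  moreover have "op_spectral_radius (T 1) = 0" using assms(6) S_of_real[of 1] by simp
  ultimately show ?thesis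
    unfolding sup unfolding assms(16) using transform_lower_bound[OF _ _ _ a max] by simp
qed

end
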